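(* Assume (A2) $q_*(y)>0$ if and only if $\mathrm{numK}(y)=0$, and (A1) $L_{\mathrm{SE}}(\tilde v)\le\epsilon_{\mathrm{score}}^2$. Let $\epsilon\in(0,1)$ and suppose $$T=\ln(4d/\epsilon^2),\qquad \delta\le \epsilon/d,\qquad \epsilon_{\mathrm{score}}\le T^{-1/2}\epsilon,$$ and let $0=t_0<t_1<\dots<t_W=T-\delta$ be any partition. Then the distribution $\hat p$ of the output of the MATU algorithm run with this $T$, this partition and the estimator $\tilde v$ satisfies $\mathrm{TV}(q_*,\hat p)\le 2\epsilon$.
   Context: Setting. Integers $K\ge2$, $d\ge1$, $\mathcal{Y}=\{1,\dots,K\}^d$; the symbol $K$ is the mask token and $\mathrm{numK}(y)=\#\{i:y_i=K\}$. The masked forward process $(\mathbf{y}^\to_t)$ is the continuous-time Markov chain on $\mathcal{Y}$ with $\mathbf{y}^\to_0\sim q_*$ and rate function $R^\to(y,y')$ (rate of jumping from $y'$ to $y$): $R^\to(y,y')=1$ if $y,y'$ differ in exactly one coordinate $i$ with $y_i=K$; $R^\to(y,y)=-(d-\mathrm{numK}(y))$; $0$ otherwise. Marginals $q^\to_t$; reverse marginals $q^\gets_t:=q^\to_{T-t}$ for $t\in[0,T)$; true discrete score $v_{t,y}(y')=q^\gets_t(y')/q^\gets_t(y)$. Score estimator and loss. $\tilde v$ assigns a value $\tilde v_{t,y}(y')>0$ to each $t\in[0,T)$ and each pair $(y,y')$ with $R^\to(y,y')=1$ (i.e. $y'$ is obtained from $y$ by replacing one mask coordinate by a value in $\{1,\dots,K-1\}$),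 measurably in $t$. With $D_\phi(u\|w)=u\ln(u/w)-u+w$, $$L_{\mathrm{SE}}(\tilde v)=\frac1T\int_0^T\mathbb{E}_{\mathbf{y}\sim q^\to_t}\Big[\sum_{y'\neq\mathbf{y}}R^\to(\mathbf{y},y')\,D_\phi\big(v_{T-t,\mathbf{y}}(y')\,\|\,\tilde v_{T-t,\mathbf{y}}(y')\big)\Big]dt.$$ Estimated rates: $\tilde R_t(y',y)=R^\to(y,y')\tilde v_{t,y}(y')$ for $y'\neq y$, and $\tilde R_t(y)=\sum_{y'\neq y}\tilde R_t(y',y)$. MATU algorithm. Set $\hat y_{t_0}=(K,\dots,K)$. For $w=1,\dots,W$: let $\beta_w=K\,\mathrm{numK}(\hat y_{t_{w-1}})/(e^{T-t_w}-1)$; draw $N_w\sim\mathrm{Poisson}(\beta_w(t_w-t_{w-1}))$ (so $N_w=0$ if $\beta_w=0$); draw $N_w$ i.i.d. uniform points of $[t_{w-1},t_w]$ sorted as $\tau_1<\dots<\tau_{N_w}$; set $z_0=\hat y_{t_{w-1}}$; for $n=1,\dots,N_w$, with $z=z_{n-1}$ define the truncated rates $\hat R_{\tau_n}(y',z)=\tilde R_{\tau_n}(y',z)\min\{1,\beta_w/\tilde R_{\tau_n}(z)\}$ for $y'\neq z$, and set $z_n=y'$ with probability $\hat R_{\tau_n}(y',z)/\beta_w$ for each $y'\neq z$, and $z_n=z$ with the remaining probability $1-\sum_{y'\neq z}\hat R_{\tau_n}(y',z)/\beta_w$; then set $\hat y_{t_w}=z_{N_w}$. The output is $\hat y_{t_W}$,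 whose distribution is denoted $\hat p$. $\mathrm{TV}(p,q)=\sup_{S}|p(S)-q(S)|$. *)

theory Defs
  imports "HOL-Probability.Probability"
begin

text \<open>States are lists of length d with entries in {1..K}; K is the mask token.\<close>

definition Ystates :: "nat \<Rightarrow> nat \<Rightarrow> nat list set" where
  "Ystates K d = {y. length y = d \<and> set y \<subseteq> {1..K}}"

definition numK :: "nat \<Rightarrow> nat list \<Rightarrow> nat" where
  "numK K y = length (filter (\<lambda>a. a = K) y)"

text \<open>Forward rate R(y,y'): rate of jumping from y' to y.\<close>
definition Rfwd :: "nat \<Rightarrow> nat \<Rightarrow> nat list \<Rightarrow> nat list \<Rightarrow> real" where
  "Rfwd K d y y' =
     (if y = y' then - (real d - real (numK K y))
      else if card {i. i < d \<and> y ! i \<noteq> y' ! i} = 1 \<and>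
              (\<forall>i<d. y ! i \<noteq> y' ! i \<longrightarrow> y ! i = K) then 1
      else 0)"

definition Rapply :: "nat \<Rightarrow> nat \<Rightarrow> (nat list \<Rightarrow> real) \<Rightarrow> nat list \<Rightarrow> real" where
  "Rapply K d f y = (\<Sum>y'\<in>Ystates K d. Rfwd K d y y' * f y')"

text \<open>Forward marginals of the CTMC: q_t = exp(t R) q_0 (Kolmogorov forward semigroup).\<close>
definition qfwd :: "nat \<Rightarrow> nat \<Rightarrow> (nat list \<Rightarrow> real) \<Rightarrow> real \<Rightarrow> nat list \<Rightarrow> real" where
  "qfwd K d q0 t y = (\<Sum>n. t ^ n / fact n * ((Rapply K d ^^ n) q0) y)"

text \<open>True discrete score v_{t,y}(y') = q^<-_t(y') / q^<-_t(y), with q^<-_t = q^->_{T-t}.\<close>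
definition vscore :: "nat \<Rightarrow> nat \<Rightarrow> (nat list \<Rightarrow> real) \<Rightarrow> real \<Rightarrow> real \<Rightarrow> nat list \<Rightarrow> nat list \<Rightarrow> real" where
  "vscore K d q0 T s y y' = qfwd K d q0 (T - s) y' / qfwd K d q0 (T - s) y"

definition Dphi :: "real \<Rightarrow> real \<Rightarrow> real" where
  "Dphi u w = u * ln (u / w) - u + w"

text \<open>Score-entropy loss (nonnegative integrand, so taken as a Lebesgue nn-integral in ennreal).\<close>
definition LSE :: "nat \<Rightarrow> nat \<Rightarrow> (nat list \<Rightarrow> real) \<Rightarrow> real \<Rightarrow>
    (real \<Rightarrow> nat list \<Rightarrow> nat list \<Rightarrow> real) \<Rightarrow> ennreal" where
  "LSE K d q0 T vt =
     ennreal (1 / T) *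
     (\<integral>\<^sup>+ t\<in>{0..T}.
        ennreal (\<Sum>y\<in>Ystates K d. qfwd K d q0 t y *
          (\<Sum>y'\<in>Ystates K d - {y}. Rfwd K d y y' *
              Dphi (vscore K d q0 T (T - t) y y') (vt (T - t) y y'))) \<partial>lborel)"

definition Rtilde :: "nat \<Rightarrow> nat \<Rightarrow> (real \<Rightarrow> nat list \<Rightarrow> nat list \<Rightarrow> real) \<Rightarrow> real \<Rightarrow>
    nat list \<Rightarrow> nat list \<Rightarrow> real" where
  "Rtilde K d vt s y' y = Rfwd K d y y' * vt s y y'"

definition Rtot :: "nat \<Rightarrow> nat \<Rightarrow> (real \<Rightarrow> nat list \<Rightarrow> nat list \<Rightarrow> real) \<Rightarrow> real \<Rightarrow>
    nat list \<Rightarrow> real" where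
  "Rtot K d vt s y = (\<Sum>y'\<in>Ystates K d - {y}. Rtilde K d vt s y' y)"

definition Rhat :: "nat \<Rightarrow> nat \<Rightarrow> (real \<Rightarrow> nat list \<Rightarrow> nat list \<Rightarrow> real) \<Rightarrow> real \<Rightarrow> real \<Rightarrow>
    nat list \<Rightarrow> nat list \<Rightarrow> real" where
  "Rhat K d vt \<beta> s y' z = Rtilde K d vt s y' z * min 1 (\<beta> / Rtot K d vt s z)"

definition stepP :: "nat \<Rightarrow> nat \<Rightarrow> (real \<Rightarrow> nat list \<Rightarrow> nat list \<Rightarrow> real) \<Rightarrow> real \<Rightarrow> real \<Rightarrow>
    nat list \<Rightarrow> nat list \<Rightarrow> real" where
  "stepP K d vt \<beta> s z y =
     (if y = z then 1 - (\<Sum>y'\<in>Ystates K d - {z}. Rhat K d vt \<beta> s y' z / \<beta>)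
      else Rhat K d vt \<beta> s y z / \<beta>)"

fun runP :: "nat \<Rightarrow> nat \<Rightarrow> (real \<Rightarrow> nat list \<Rightarrow> nat list \<Rightarrow> real) \<Rightarrow> real \<Rightarrow> real list \<Rightarrow>
    nat list \<Rightarrow> nat list \<Rightarrow> real" where
  "runP K d vt \<beta> [] z y = (if y = z then 1 else 0)"
| "runP K d vt \<beta> (s # ss) z y =
     (\<Sum>z'\<in>Ystates K d. stepP K d vt \<beta> s z z' * runP K d vt \<beta> ss z' y)"

definition poissonP :: "real \<Rightarrow> nat \<Rightarrow> real" where
  "poissonP lam N = exp (- lam) * lam ^ N / fact N"

definition betaw :: "nat \<Rightarrow> real \<Rightarrow> (nat \<Rightarrow> real) \<Rightarrow> nat \<Rightarrow> nat list \<Rightarrow> real" where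
  "betaw K T t w z = real K * real (numK K z) / (exp (T - t w) - 1)"

definition windowP :: "nat \<Rightarrow> nat \<Rightarrow> (real \<Rightarrow> nat list \<Rightarrow> nat list \<Rightarrow> real) \<Rightarrow> real \<Rightarrow>
    (nat \<Rightarrow> real) \<Rightarrow> nat \<Rightarrow> nat list \<Rightarrow> nat list \<Rightarrow> real" where
  "windowP K d vt T t w z y =
     (let \<beta> = betaw K T t w z in
      (\<Sum>N. poissonP (\<beta> * (t w - t (w - 1))) N *
         (\<integral>taus. runP K d vt \<beta> (sort (map taus [0..<N])) z y
            \<partial>(PiM {..<N} (\<lambda>_. uniform_measure lborel {t (w - 1)..t w})))))"

fun matu_dist :: "nat \<Rightarrow> nat \<Rightarrow> (real \<Rightarrow> nat list \<Rightarrow> nat list \<Rightarrow> real) \<Rightarrow> real \<Rightarrow>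
    (nat \<Rightarrow> real) \<Rightarrow> nat \<Rightarrow> nat list \<Rightarrow> real" where
  "matu_dist K d vt T t 0 y = (if y = replicate d K then 1 else 0)"
| "matu_dist K d vt T t (Suc w) y =
     (\<Sum>z\<in>Ystates K d. matu_dist K d vt T t w z * windowP K d vt T t (Suc w) z y)"

definition TV :: "nat list set \<Rightarrow> (nat list \<Rightarrow> real) \<Rightarrow> (nat list \<Rightarrow> real) \<Rightarrow> real" where
  "TV Y p q = Sup {\<bar>(\<Sum>y\<in>S. p y) - (\<Sum>y\<in>S. q y)\<bar> | S. S \<subseteq> Y}"

end

theory Submission
  imports Defs
begin

text \<open>Duality replaces the relative entropy of path measures. For a terminal function h > 0 let h'(z) be its
  average over one window of the algorithm started in z. By uniformization (Poissonized order statistics)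
  h' is the value at the window start of a solution S of the backward integral equation of the truncated
  rates. Along the joint law of the true reverse chain at the window start and at time s, the expectation
  of ln S grows at most at the rate of the score entropy D, because
  R x - R' (exp x - 1) \<le> D(R || R') for every x, and because truncating R' at a level above the true
  total rate only decreases the sum of D. Chaining the windows with h = exp (l 1_A) gives
  l q(A) \<le> ln E[h] + loss + (error of starting fully masked), and Hoeffding's lemma bounds
  ln E[h] \<le> l p(A) + l^2/8. Only bounded h occur, so no logarithm is ever singular, and l = 3 eps suffices.\<close>

section \<open>Uniformization\<close>

text \<open>The Poisson rate of a window is fixed by the state z in which the window starts, so
  inside a window the algorithm is a family of chains indexed by z. The true reverse chain is split
  the same way, and only the sum over z restores its marginal and the loss. The splitting also makes
  truncation harmless: the reverse chain only removes masks, so along its joint law with the start z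
  the true total rate numK(x) / (e^(T-s) - 1) never exceeds the level fixed at the start. The second
  obstacle is regularity. The estimator is only measurable in time and may be unbounded, so no
  pointwise backward differential equation is at hand. Truncation caps the total rate by \<beta>,
  hence S is Lipschitz in time, which is enough for an increment estimate. The two eps in the bound
  have separate origins: one pays for stopping at T - \<delta>, the other is a bound for (l^2/8 + l
  eps^2/4 + eps^2) / l, a Pinsker inequality in dual form.\<close>

lemma poissonP_nonneg: "0 \<le> c \<Longrightarrow> 0 \<le> poissonP c n"
  by (simp add: poissonP_def)

lemma poissonP_sums: "(\<lambda>n. poissonP c n * u) sums u"
proof -
  have "(\<lambda>n. c ^ n / fact n) sums exp c"
    using exp_converges[of c] by (simp add: scaleR_conv_of_real field_simps)
  then have "(\<lambda>n. exp (- c) * u * (c ^ n / fact n)) sums (exp (- c) * u * exp c)"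
    by (rule sums_mult)
  moreover have "exp (- c) * u * exp c = u" by (simp add: exp_minus field_simps)
  moreover have "exp (- c) * u * (c ^ n / fact n) = poissonP c n * u" for n
    by (simp add: poissonP_def)
  ultimately show ?thesis by (simp only:)
qed

section \<open>Runs of a time-dependent kernel along sorted times\<close>

locale step_kernel =
  fixes Y :: "'a set" and p :: "real \<Rightarrow> 'a \<Rightarrow> 'a \<Rightarrow> real" and h :: "'a \<Rightarrow> real"
  assumes fin: "finite Y"
    and p_meas [measurable]: "\<And>x x'. (\<lambda>s. p s x x') \<in> borel_measurable borel"
begin

primrec run :: "real list \<Rightarrow> 'a \<Rightarrow> real" where
  "run [] x = h x"
| "run (s # ss) x = (\<Sum>x'\<in>Y. p s x x' * run ss x')"

text \<open>Indexed by an arbitrary finite set instead of {..<n}, so that deleting the earliest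
  point stays within the definition and induction on the cardinality is possible.\<close>

definition sortrun :: "nat set \<Rightarrow> (nat \<Rightarrow> real) \<Rightarrow> 'a \<Rightarrow> real" where
  "sortrun I \<omega> x = run (sort (map \<omega> (sorted_list_of_set I))) x"

lemma sortrun_cong:
  assumes "finite I" "\<And>i. i \<in> I \<Longrightarrow> \<omega> i = \<omega>' i"
  shows "sortrun I \<omega> x = sortrun I \<omega>' x"
proof -
  have "map \<omega> (sorted_list_of_set I) = map \<omega>' (sorted_list_of_set I)"
    using assms by auto
  then show ?thesis unfolding sortrun_def by (rule arg_cong)
qed

lemma sortrun_remove_min:
  assumes "finite I" "k \<in> I" "\<And>j. j \<in> I \<Longrightarrow> \<omega> k \<le> \<omega> j"
  shows "sortrun I \<omega> x = (\<Sum>x'\<in>Y. p (\<omega> k) x x' * sortrun (I - {k}) \<omega> x')"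
proof -
  have "sort (map \<omega> (sorted_list_of_set I)) = \<omega> k # sort (map \<omega> (sorted_list_of_set (I - {k})))"
  proof (rule properties_for_sort)
    have "mset (sorted_list_of_set I) = add_mset k (mset (sorted_list_of_set (I - {k})))"
      using mset_set.remove[OF assms(1,2)]
      by (metis mset_sorted_list_of_multiset sorted_list_of_mset_set)
    then show "mset (\<omega> k # sort (map \<omega> (sorted_list_of_set (I - {k})))) = mset (map \<omega> (sorted_list_of_set I))"
      by simp
    show "sorted (\<omega> k # sort (map \<omega> (sorted_list_of_set (I - {k}))))"
      using assms by auto
  qed
  then show ?thesis by (simp add: sortrun_def)
qed

text \<open>Ties are broken by the index, so that the decomposition over the earliest point holds pointwise
  and yields measurability; in integrals ties form a null set.\<close>

definition first_min :: "nat set \<Rightarrow> nat \<Rightarrow> (nat \<Rightarrow> real) \<Rightarrow> bool" where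
  "first_min I k \<omega> \<longleftrightarrow> (\<forall>j\<in>I - {k}. if k < j then \<not> \<omega> j < \<omega> k else \<omega> k < \<omega> j)"

lemma first_min_unique:
  assumes "finite I" "I \<noteq> {}"
  shows "\<exists>!k. k \<in> I \<and> first_min I k \<omega>"
proof -
  define A where "A = {k\<in>I. \<omega> k = Min (\<omega> ` I)}"
  have "Min (\<omega> ` I) \<in> \<omega> ` I" using assms by (intro Min_in) auto
  then obtain i where "i \<in> I" "\<omega> i = Min (\<omega> ` I)" by force
  then have A: "finite A" "A \<noteq> {}"
    using assms by (auto simp: A_def)
  have le: "Min (\<omega> ` I) \<le> \<omega> j" if "j \<in> I" for j using that assms by simp
  have MA: "Min A \<in> A" using A by simp
  have MA': "Min A \<in> I" "\<omega> (Min A) = Min (\<omega> ` I)" using MA unfolding A_def by blast+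
  have "first_min I (Min A) \<omega>"
    unfolding first_min_def
  proof
    fix j assume j: "j \<in> I - {Min A}"
    have "\<omega> j \<noteq> \<omega> (Min A)" if "\<not> Min A < j"
    proof
      assume "\<omega> j = \<omega> (Min A)"
      then have "j \<in> A" using j MA' by (simp add: A_def)
      then have "Min A \<le> j" using A by simp
      then show False using that j by auto
    qed
    with le[of j] j MA' show "if Min A < j then \<not> \<omega> j < \<omega> (Min A) else \<omega> (Min A) < \<omega> j"
      by (cases "Min A < j") auto
  qed
  moreover have "k = k'" if "k \<in> I" "first_min I k \<omega>" "k' \<in> I" "first_min I k' \<omega>" for k k'
  proof (rule ccontr)
    assume "k \<noteq> k'"
    then have "k' \<in> I - {k}" "k \<in> I - {k'}" using that by auto
    with that have "if k < k' then \<not> \<omega> k' < \<omega> k else \<omega> k < \<omega> k'"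
      "if k' < k then \<not> \<omega> k < \<omega> k' else \<omega> k' < \<omega> k"
      unfolding first_min_def by blast+
    then show False using \<open>k \<noteq> k'\<close> by (auto split: if_splits)
  qed
  ultimately show ?thesis using MA'(1) by blast
qed

lemma sortrun_decompose:
  assumes "finite I" "I \<noteq> {}"
  shows "sortrun I \<omega> x =
    (\<Sum>k\<in>I. of_bool (first_min I k \<omega>) * (\<Sum>x'\<in>Y. p (\<omega> k) x x' * sortrun (I - {k}) \<omega> x'))"
proof -
  define k where "k = (THE k. k \<in> I \<and> first_min I k \<omega>)"
  have k: "k \<in> I" "first_min I k \<omega>"
    using theI'[OF first_min_unique[OF assms, of \<omega>]] by (simp_all add: k_def)
  have u: "k' = k" if "k' \<in> I" "first_min I k' \<omega>" for k'
    using the1_equality[OF first_min_unique[OF assms, of \<omega>], of k'] that by (simp add: k_def)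
  have "(\<Sum>k\<in>I. of_bool (first_min I k \<omega>) * (\<Sum>x'\<in>Y. p (\<omega> k) x x' * sortrun (I - {k}) \<omega> x'))
     = (\<Sum>k'\<in>I. if k' = k then (\<Sum>x'\<in>Y. p (\<omega> k) x x' * sortrun (I - {k}) \<omega> x') else 0)"
  proof (rule sum.cong[OF refl])
    fix k' assume "k' \<in> I"
    show "of_bool (first_min I k' \<omega>) * (\<Sum>x'\<in>Y. p (\<omega> k') x x' * sortrun (I - {k'}) \<omega> x') =
      (if k' = k then \<Sum>x'\<in>Y. p (\<omega> k) x x' * sortrun (I - {k}) \<omega> x' else 0)"
    proof (cases "k' = k")
      case False
      then have "\<not> first_min I k' \<omega>" using u[OF \<open>k' \<in> I\<close>] by blast
      with False show ?thesis by simp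
    qed (simp add: k)
  qed
  also have "\<dots> = (\<Sum>x'\<in>Y. p (\<omega> k) x x' * sortrun (I - {k}) \<omega> x')"
    using assms k by simp
  also have "\<dots> = sortrun I \<omega> x"
  proof (rule sortrun_remove_min[symmetric])
    fix j assume "j \<in> I"
    then show "\<omega> k \<le> \<omega> j"
    proof (cases "j = k")
      case False
      with \<open>j \<in> I\<close> k(2) have "if k < j then \<not> \<omega> j < \<omega> k else \<omega> k < \<omega> j"
        by (auto simp only: first_min_def)
      then show ?thesis by (auto split: if_splits)
    qed simp
  qed (use assms k in auto)
  finally show ?thesis by simp
qed

text \<open>No measurability of sorting is used: splitting by the earliest point leaves finite sums
  of products of measurable terms with fewer points, and \<open>restrict\<close> moves each shorter
  run to the product space over its own index set.\<close>

lemma sortrun_measurable: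
  assumes "finite I"
  shows "(\<lambda>\<omega>. sortrun I \<omega> x) \<in> borel_measurable (PiM I (\<lambda>_. borel))"
  using assms
proof (induction "card I" arbitrary: I x)
  case 0
  then show ?case by (simp add: sortrun_def)
next
  case (Suc n)
  have "(\<lambda>\<omega>. sortrun (I - {k}) \<omega> x') \<in> borel_measurable (PiM I (\<lambda>_. borel))" if "k \<in> I" for k x'
  proof -
    have "(\<lambda>\<omega>. sortrun (I - {k}) (restrict \<omega> (I - {k})) x') \<in> borel_measurable (PiM I (\<lambda>_. borel))"
      using Suc that by (intro measurable_compose[OF measurable_restrict_subset Suc(1)]) auto
    also have "(\<lambda>\<omega>. sortrun (I - {k}) (restrict \<omega> (I - {k})) x') = (\<lambda>\<omega>. sortrun (I - {k}) \<omega> x')"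
      using Suc by (intro ext sortrun_cong) auto
    finally show ?thesis .
  qed
  note [measurable] = this
  have [measurable]: "(\<lambda>\<omega>. \<omega> k) \<in> borel_measurable (PiM I (\<lambda>_. borel))" if "k \<in> I" for k :: nat
    using that by (rule measurable_component_singleton)
  have [measurable]: "(\<lambda>\<omega>. p (\<omega> k) x x') \<in> borel_measurable (PiM I (\<lambda>_. borel))" if "k \<in> I" for k x'
    using that by measurable
  have [measurable]: "Measurable.pred (PiM I (\<lambda>_. borel)) (first_min I k)" if "k \<in> I" for k
    unfolding first_min_def using that \<open>finite I\<close>
    by (intro pred_intros_finite pred_intros_logic borel_measurable_pred_less measurable_If) auto
  have "I \<noteq> {}" using Suc by auto
  then show ?case
    unfolding sortrun_decompose[OF \<open>finite I\<close> \<open>I \<noteq> {}\<close>]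
    by (intro borel_measurable_sum borel_measurable_times
        measurable_compose[OF _ measurable_of_bool]) measurable
qed


end

text \<open>Stochasticity is kept out of \<open>step_kernel\<close> because \<open>stepP\<close> is
  known to have it only for times in its window. The lower bound \<open>m\<close> is 1 for test
  functions whose logarithm is taken, and 0 for the indicators that read off single transition
  probabilities.\<close>

locale jump_kernel = step_kernel Y p h
  for Y :: "'a set" and p :: "real \<Rightarrow> 'a \<Rightarrow> 'a \<Rightarrow> real" and h :: "'a \<Rightarrow> real" +
  fixes m M a b :: real
  assumes p_nonneg: "\<And>s x x'. x \<in> Y \<Longrightarrow> x' \<in> Y \<Longrightarrow> 0 \<le> p s x x'"
    and p_sum: "\<And>s x. x \<in> Y \<Longrightarrow> (\<Sum>x'\<in>Y. p s x x') = 1"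
    and m_nonneg: "0 \<le> m"
    and h_lower: "\<And>x. x \<in> Y \<Longrightarrow> m \<le> h x"
    and h_upper: "\<And>x. x \<in> Y \<Longrightarrow> h x \<le> M"
    and ab: "a < b"
begin

section \<open>Averages over independent uniform times and their order statistics\<close>

abbreviation \<mu> :: "real measure" where
  "\<mu> \<equiv> uniform_measure lborel {a..b}"

lemma prob_space_\<mu>: "prob_space \<mu>"
  using ab by (intro prob_space_uniform_measure) auto

lemma p_average_bounds:
  assumes "x \<in> Y" "\<And>x'. x' \<in> Y \<Longrightarrow> l \<le> f x'" "\<And>x'. x' \<in> Y \<Longrightarrow> f x' \<le> u"
  shows "l \<le> (\<Sum>x'\<in>Y. p s x x' * f x')" "(\<Sum>x'\<in>Y. p s x x' * f x') \<le> u"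
proof -
  have "(\<Sum>x'\<in>Y. p s x x' * l) \<le> (\<Sum>x'\<in>Y. p s x x' * f x')"
    "(\<Sum>x'\<in>Y. p s x x' * f x') \<le> (\<Sum>x'\<in>Y. p s x x' * u)"
    using assms p_nonneg by (intro sum_mono mult_left_mono; simp)+
  then show "l \<le> (\<Sum>x'\<in>Y. p s x x' * f x')" "(\<Sum>x'\<in>Y. p s x x' * f x') \<le> u"
    using p_sum[OF assms(1)] by (simp_all flip: sum_distrib_right)
qed

lemma run_bounds:
  assumes "x \<in> Y"
  shows "m \<le> run ss x \<and> run ss x \<le> M"
  using assms
  by (induction ss arbitrary: x) (auto simp: h_lower h_upper intro!: p_average_bounds)

lemma sortrun_bounds:
  assumes "x \<in> Y"
  shows "m \<le> sortrun I \<omega> x" "sortrun I \<omega> x \<le> M"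
  using run_bounds[OF assms] by (auto simp: sortrun_def)

lemma sets_PiM_\<mu>: "sets (PiM I (\<lambda>_. \<mu>)) = sets (PiM I (\<lambda>_. borel))"
  by (intro sets_PiM_cong) auto

lemma measurable_PiM_\<mu>: "f \<in> measurable (PiM I (\<lambda>_. borel)) N \<Longrightarrow> f \<in> measurable (PiM I (\<lambda>_. \<mu>)) N"
  using measurable_cong_sets[OF sets_PiM_\<mu> refl] by blast

lemma prob_space_PiM_\<mu>: "prob_space (PiM I (\<lambda>_. \<mu>))"
  by (intro prob_space_PiM prob_space_\<mu>)

lemma AE_\<mu>_neq: "AE r in \<mu>. r \<noteq> c"
proof (rule AE_uniform_measureI)
  have "AE r in lborel. r \<noteq> c" by (rule AE_lborel_singleton)
  then show "AE r in lborel. r \<in> {a..b} \<longrightarrow> r \<noteq> c" by eventually_elim simp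
qed simp

text \<open>Integrate coordinate i first: with the other coordinates fixed, a tie with j is a single
  value of r, which has probability zero.\<close>

lemma AE_PiM_distinct:
  fixes I :: "nat set"
  assumes "finite I"
  shows "AE \<omega> in PiM I (\<lambda>_. \<mu>). inj_on \<omega> I"
proof -
  interpret product_sigma_finite "\<lambda>_::nat. \<mu>"
    by unfold_locales (use prob_space_\<mu> prob_space_imp_sigma_finite sigma_finite_measure.sigma_finite_countable in blast)
  have "AE \<omega> in PiM I (\<lambda>_. \<mu>). \<omega> i \<noteq> \<omega> j" if "i \<in> I" "j \<in> I" "i \<noteq> j" for i j
  proof -
    have I: "I = insert i (I - {i})" using that by auto
    let ?A = "{\<omega> \<in> space (PiM I (\<lambda>_. \<mu>)). \<omega> i = \<omega> j}"
    have meas: "(\<lambda>\<omega>. \<omega> k) \<in> borel_measurable (PiM I (\<lambda>_. \<mu>))" if "k \<in> I" for k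
      by (intro measurable_PiM_\<mu> measurable_component_singleton that)
    have A: "?A \<in> sets (PiM I (\<lambda>_. \<mu>))"
      using meas that by (intro borel_measurable_eq) auto
    have "emeasure (PiM I (\<lambda>_. \<mu>)) ?A = (\<integral>\<^sup>+ \<omega>. indicator ?A \<omega> \<partial>(PiM (insert i (I - {i})) (\<lambda>_. \<mu>)))"
      using A I by simp
    also have "\<dots> = (\<integral>\<^sup>+ \<omega>. (\<integral>\<^sup>+ r. indicator ?A (fun_upd \<omega> i r) \<partial>\<mu>) \<partial>(PiM (I - {i}) (\<lambda>_. \<mu>)))"
      using assms A I by (intro product_nn_integral_insert) auto
    also have "\<dots> = (\<integral>\<^sup>+ \<omega>. 0 \<partial>(PiM (I - {i}) (\<lambda>_. \<mu>)))"
    proof (rule nn_integral_cong)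
      fix \<omega> :: "nat \<Rightarrow> real"
      have "(\<integral>\<^sup>+ r. indicator ?A (fun_upd \<omega> i r) \<partial>\<mu>) = (\<integral>\<^sup>+ r. 0 \<partial>\<mu>)"
        using AE_\<mu>_neq[of "\<omega> j"] that
        by (intro nn_integral_cong_AE) (auto elim!: eventually_mono split: split_indicator)
      then show "(\<integral>\<^sup>+ r. indicator ?A (fun_upd \<omega> i r) \<partial>\<mu>) = 0" by simp
    qed
    finally have "emeasure (PiM I (\<lambda>_. \<mu>)) ?A = 0" by simp
    then show ?thesis using A by (intro AE_I[of _ _ ?A]) auto
  qed
  then have "AE \<omega> in PiM I (\<lambda>_. \<mu>). \<forall>i\<in>I. \<forall>j\<in>I. i \<noteq> j \<longrightarrow> \<omega> i \<noteq> \<omega> j"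
    using assms by (intro AE_finite_allI) (auto intro: AE_impI)
  then show ?thesis by eventually_elim (auto simp: inj_on_def)
qed

text \<open>The iterated integral over increasing times s < r_1 < ... < r_n. As \<mu> is normalised,
  this is the expectation over n sample points restricted to one of their n! possible
  orders.\<close>

primrec G :: "nat \<Rightarrow> real \<Rightarrow> 'a \<Rightarrow> real" where
  "G 0 s x = h x"
| "G (Suc n) s x = (\<integral>r. of_bool (s < r) * (\<Sum>x'\<in>Y. p r x x' * G n r x') \<partial>\<mu>)"

lemma G_measurable [measurable]: "(\<lambda>s. G n s x) \<in> borel_measurable borel"
proof (induction n arbitrary: x)
  case (Suc n)
  note [measurable] = Suc
  interpret sigma_finite_measure \<mu>
    using prob_space_\<mu> prob_space_imp_sigma_finite by blast
  show ?case
    unfolding G.simps by (rule borel_measurable_lebesgue_integral) measurable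
qed simp

text \<open>Any of the n + 1 points may be the earliest, and each choice contributes the same amount
  n! \<open>G (Suc n) s x\<close>. Once its position r is fixed, the other n points must all be
  later than r, which is the induction hypothesis with r in place of s; this is why the lower end s
  is free in the statement.\<close>

lemma order_statistics_integral:
  assumes "finite I" "card I = n" "x \<in> Y"
  shows "(\<integral>\<omega>. of_bool (\<forall>i\<in>I. s < \<omega> i) * sortrun I \<omega> x \<partial>(PiM I (\<lambda>_. \<mu>))) = fact n * G n s x"
  using assms
proof (induction n arbitrary: I s x)
  case 0
  interpret prob_space "PiM I (\<lambda>_. \<mu>)" by (rule prob_space_PiM_\<mu>)
  from 0 show ?case using prob_space by (simp add: sortrun_def)
next
  case (Suc n)
  interpret P: product_sigma_finite "\<lambda>_::nat. \<mu>"
    by unfold_locales (use prob_space_\<mu> prob_space_imp_sigma_finite sigma_finite_measure.sigma_finite_countable in blast)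
  interpret U: prob_space \<mu> by (rule prob_space_\<mu>)
  interpret Q: prob_space "PiM I (\<lambda>_. \<mu>)" by (rule prob_space_PiM_\<mu>)
  have "I \<noteq> {}" using Suc by auto
  \<comment> \<open>The part of the integrand where point k comes first. The condition s < \<omega>
    i for all i shrinks to s < \<omega> k, and the order condition moves next to the shorter run,
    matching the induction hypothesis with s := \<omega> k.\<close>
  define T where "T k \<omega> = of_bool (s < \<omega> k) * (\<Sum>x'\<in>Y. p (\<omega> k) x x' *
      (of_bool (\<forall>i\<in>I - {k}. \<omega> k < \<omega> i) * sortrun (I - {k}) \<omega> x'))" for k \<omega>
  have comp: "(\<lambda>\<omega>. \<omega> k) \<in> borel_measurable (PiM J (\<lambda>_. \<mu>))" if "k \<in> J" for k and J :: "nat set"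
    by (intro measurable_PiM_\<mu> measurable_component_singleton that)
  have srm: "(\<lambda>\<omega>. sortrun J \<omega> x') \<in> borel_measurable (PiM J (\<lambda>_. \<mu>))" if "finite J" for x' J
    by (intro measurable_PiM_\<mu> sortrun_measurable that)
  have srm': "(\<lambda>\<omega>. sortrun (I - {k}) \<omega> x') \<in> borel_measurable (PiM I (\<lambda>_. \<mu>))" for x' k
  proof -
    have "(\<lambda>\<omega>. sortrun (I - {k}) (restrict \<omega> (I - {k})) x') \<in> borel_measurable (PiM I (\<lambda>_. \<mu>))"
      using Suc by (intro measurable_compose[OF measurable_restrict_subset srm]) auto
    also have "(\<lambda>\<omega>. sortrun (I - {k}) (restrict \<omega> (I - {k})) x') = (\<lambda>\<omega>. sortrun (I - {k}) \<omega> x')"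
      using Suc by (intro ext sortrun_cong) auto
    finally show ?thesis .
  qed
  have T_meas: "T k \<in> borel_measurable (PiM I (\<lambda>_. \<mu>))" if "k \<in> I" for k
  proof -
    have [measurable]: "Measurable.pred (PiM I (\<lambda>_. \<mu>)) (\<lambda>\<omega>. \<forall>i\<in>I - {k}. \<omega> k < \<omega> i)"
      using that Suc comp by (intro pred_intros_finite borel_measurable_pred_less) auto
    note [measurable] = comp[OF that] srm'
    show ?thesis unfolding T_def by measurable
  qed
  have guarded: "0 \<le> of_bool P * sortrun J \<omega> x'" "of_bool P * sortrun J \<omega> x' \<le> M" if "x' \<in> Y" for P J \<omega> x'
  proof -
    have "0 \<le> sortrun J \<omega> x'" "sortrun J \<omega> x' \<le> M"
      using sortrun_bounds[OF that] m_nonneg order_trans by blast+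
    then show "0 \<le> of_bool P * sortrun J \<omega> x'" "of_bool P * sortrun J \<omega> x' \<le> M" by (cases P; simp)+
  qed
  have T_bd: "norm (T k \<omega>) \<le> M" for k \<omega>
  proof -
    let ?S = "\<Sum>x'\<in>Y. p (\<omega> k) x x' * (of_bool (\<forall>i\<in>I - {k}. \<omega> k < \<omega> i) * sortrun (I - {k}) \<omega> x')"
    have "0 \<le> ?S" "?S \<le> M"
      by (rule p_average_bounds[OF \<open>x \<in> Y\<close> guarded]; assumption)+
    then show ?thesis unfolding T_def by (cases "s < \<omega> k") simp_all
  qed
  have T_int: "integrable (PiM I (\<lambda>_. \<mu>)) (T k)" if "k \<in> I" for k
    using T_bd T_meas[OF that] by (intro Q.integrable_const_bound[where B = M]) auto
  have "(\<integral>\<omega>. of_bool (\<forall>i\<in>I. s < \<omega> i) * sortrun I \<omega> x \<partial>(PiM I (\<lambda>_. \<mu>))) = (\<integral>\<omega>. (\<Sum>k\<in>I. T k \<omega>) \<partial>(PiM I (\<lambda>_. \<mu>)))"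
  proof (rule integral_cong_AE)
    have [measurable]: "Measurable.pred (PiM I (\<lambda>_. \<mu>)) (\<lambda>\<omega>. \<forall>i\<in>I. s < \<omega> i)"
      using Suc comp by (intro pred_intros_finite borel_measurable_pred_less) auto
    note [measurable] = srm[OF \<open>finite I\<close>]
    show "(\<lambda>\<omega>. of_bool (\<forall>i\<in>I. s < \<omega> i) * sortrun I \<omega> x) \<in> borel_measurable (PiM I (\<lambda>_. \<mu>))"
      by measurable
    show "(\<lambda>\<omega>. \<Sum>k\<in>I. T k \<omega>) \<in> borel_measurable (PiM I (\<lambda>_. \<mu>))"
      using T_meas by (intro borel_measurable_sum) auto
    show "AE \<omega> in PiM I (\<lambda>_. \<mu>). of_bool (\<forall>i\<in>I. s < \<omega> i) * sortrun I \<omega> x = (\<Sum>k\<in>I. T k \<omega>)"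
      using AE_PiM_distinct[OF \<open>finite I\<close>]
    proof eventually_elim
      fix \<omega> :: "nat \<Rightarrow> real" assume inj: "inj_on \<omega> I"
      have *: "first_min I k \<omega> \<longleftrightarrow> (\<forall>i\<in>I - {k}. \<omega> k < \<omega> i)" if "k \<in> I" for k
        unfolding first_min_def
      proof (rule ball_cong[OF refl])
        fix j assume "j \<in> I - {k}"
        then have "\<omega> j \<noteq> \<omega> k" using inj that by (auto simp: inj_on_def)
        then show "(if k < j then \<not> \<omega> j < \<omega> k else \<omega> k < \<omega> j) \<longleftrightarrow> \<omega> k < \<omega> j" by auto
      qed
      have "of_bool (\<forall>i\<in>I. s < \<omega> i) * (of_bool (first_min I k \<omega>) * (\<Sum>x'\<in>Y. p (\<omega> k) x x' * sortrun (I - {k}) \<omega> x'))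
        = T k \<omega>" if "k \<in> I" for k
      proof (cases "first_min I k \<omega>")
        case True
        then have "(\<forall>i\<in>I. s < \<omega> i) \<longleftrightarrow> s < \<omega> k"
          using that *[OF that] by (auto intro: less_trans)
        then show ?thesis using True *[OF that] by (simp add: T_def)
      qed (use *[OF that] in \<open>auto simp: T_def\<close>)
      then show "of_bool (\<forall>i\<in>I. s < \<omega> i) * sortrun I \<omega> x = (\<Sum>k\<in>I. T k \<omega>)"
        unfolding sortrun_decompose[OF \<open>finite I\<close> \<open>I \<noteq> {}\<close>, of \<omega> x] sum_distrib_left
        by (intro sum.cong) auto
    qed
  qed
  also have "\<dots> = (\<Sum>k\<in>I. \<integral>\<omega>. T k \<omega> \<partial>(PiM I (\<lambda>_. \<mu>)))"
    using T_int by (rule Bochner_Integration.integral_sum)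
  also have "\<dots> = (\<Sum>k\<in>I. fact n * G (Suc n) s x)"
  proof (rule sum.cong[OF refl])
    fix k assume k: "k \<in> I"
    let ?J = "I - {k}"
    have I: "I = insert k ?J" using k by auto
    have J: "finite ?J" "card ?J = n" using Suc k by auto
    interpret R: prob_space "PiM ?J (\<lambda>_. \<mu>)" by (rule prob_space_PiM_\<mu>)
    interpret RU: pair_prob_space "PiM ?J (\<lambda>_. \<mu>)" \<mu> ..
    have upd: "(\<lambda>(\<omega>, r). T k (fun_upd \<omega> k r)) \<in> borel_measurable (PiM ?J (\<lambda>_. \<mu>) \<Otimes>\<^sub>M \<mu>)"
      using measurable_compose[OF measurable_add_dim[of k ?J "\<lambda>_. \<mu>"], of "T k" borel] T_meas[OF k] I
      by (simp add: case_prod_beta)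
    have "(\<integral>\<omega>. T k \<omega> \<partial>(PiM I (\<lambda>_. \<mu>))) = (\<integral>\<omega>. (\<integral>r. T k (fun_upd \<omega> k r) \<partial>\<mu>) \<partial>(PiM ?J (\<lambda>_. \<mu>)))"
      using P.product_integral_insert[of ?J k "T k"] T_int[OF k] J I by simp
    \<comment> \<open>Exchanging the integrals holds the earliest time r fixed while the remaining
      points are averaged.\<close>
    also have "\<dots> = (\<integral>r. (\<integral>\<omega>. T k (fun_upd \<omega> k r) \<partial>(PiM ?J (\<lambda>_. \<mu>))) \<partial>\<mu>)"
      using upd T_bd by (intro RU.Fubini_integral[symmetric] RU.integrable_const_bound[where B = M]) auto
    also have "\<dots> = (\<integral>r. fact n * (of_bool (s < r) * (\<Sum>x'\<in>Y. p r x x' * G n r x')) \<partial>\<mu>)"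
    proof (rule Bochner_Integration.integral_cong[OF refl])
      fix r
      have Tk: "T k (fun_upd \<omega> k r) = of_bool (s < r) * (\<Sum>x'\<in>Y. p r x x' *
        (of_bool (\<forall>i\<in>?J. r < \<omega> i) * sortrun ?J \<omega> x'))" for \<omega>
      proof -
        have "sortrun ?J (fun_upd \<omega> k r) x' = sortrun ?J \<omega> x'" for x'
          by (rule sortrun_cong) (use J in auto)
        then show ?thesis by (simp add: T_def)
      qed
      have int: "integrable (PiM ?J (\<lambda>_. \<mu>)) (\<lambda>\<omega>. of_bool (\<forall>i\<in>?J. r < \<omega> i) * sortrun ?J \<omega> x')" if "x' \<in> Y" for x'
      proof (rule R.integrable_const_bound[where B = M])
        have [measurable]: "Measurable.pred (PiM ?J (\<lambda>_. \<mu>)) (\<lambda>\<omega>. \<forall>i\<in>?J. r < \<omega> i)"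
          using J comp by (intro pred_intros_finite borel_measurable_pred_less) auto
        note [measurable] = srm[OF J(1)]
        show "(\<lambda>\<omega>. of_bool (\<forall>i\<in>?J. r < \<omega> i) * sortrun ?J \<omega> x') \<in> borel_measurable (PiM ?J (\<lambda>_. \<mu>))"
          by measurable
        show "AE \<omega> in PiM ?J (\<lambda>_. \<mu>). norm (of_bool (\<forall>i\<in>?J. r < \<omega> i) * sortrun ?J \<omega> x') \<le> M"
          using guarded[OF that] by (intro AE_I2) (simp only: real_norm_def abs_of_nonneg)
      qed
      show "(\<integral>\<omega>. T k (fun_upd \<omega> k r) \<partial>(PiM ?J (\<lambda>_. \<mu>))) =
        fact n * (of_bool (s < r) * (\<Sum>x'\<in>Y. p r x x' * G n r x'))"
        unfolding Tk using int Suc.IH[OF J]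
        by (simp add: Bochner_Integration.integral_sum sum_distrib_left mult_ac)
    qed
    finally show "(\<integral>\<omega>. T k \<omega> \<partial>(PiM I (\<lambda>_. \<mu>))) = fact n * G (Suc n) s x"
      by simp
  qed
  also have "\<dots> = fact (Suc n) * G (Suc n) s x"
    using Suc by (simp add: algebra_simps)
  finally show ?case .
qed


text \<open>The factor 1 / n! comes from the order statistics: n! \<open>G n s x\<close> is the
  expectation of a quantity in [0, M].\<close>

lemma G_bounds:
  assumes "x \<in> Y"
  shows "0 \<le> G n s x" "G n s x \<le> M / fact n"
proof -
  interpret prob_space "PiM {..<n} (\<lambda>_. \<mu>)" by (rule prob_space_PiM_\<mu>)
  let ?f = "\<lambda>\<omega>. of_bool (\<forall>i\<in>{..<n}. s < \<omega> i) * sortrun {..<n} \<omega> x"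
  have M: "0 \<le> M" using h_lower[OF assms] h_upper[OF assms] m_nonneg by linarith
  have bd: "0 \<le> ?f \<omega>" "?f \<omega> \<le> M" for \<omega>
    using sortrun_bounds[OF assms, of "{..<n}" \<omega>] m_nonneg M
    by (cases "\<forall>i\<in>{..<n}. s < \<omega> i"; simp)+
  have "0 \<le> (\<integral>\<omega>. ?f \<omega> \<partial>(PiM {..<n} (\<lambda>_. \<mu>)))"
    using bd by (intro Bochner_Integration.integral_nonneg)
  \<comment> \<open>In the non-integrable case the integral is 0 by convention, and 0 \<le>
    M.\<close>
  moreover have "(\<integral>\<omega>. ?f \<omega> \<partial>(PiM {..<n} (\<lambda>_. \<mu>))) \<le> M"
    using bd(2) M
    by (cases "integrable (PiM {..<n} (\<lambda>_. \<mu>)) ?f")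
       (auto intro!: integral_le_const simp: not_integrable_integral_eq simp del: of_bool_eq_1_iff)
  ultimately have "0 \<le> fact n * G n s x" "fact n * G n s x \<le> M"
    using order_statistics_integral[of "{..<n}" n x s] assms by simp_all
  then show "0 \<le> G n s x" "G n s x \<le> M / fact n"
    using fact_gt_zero[of n, where ?'a = real]
    by (auto simp: zero_le_mult_iff pos_le_divide_eq mult.commute)
qed

text \<open>Passes from the uniform law to the gauge integral over [s, b], in which the increment
  estimates are phrased. The condition s < r differs from r in the closed interval at one point
  only; the factor b - a removes the normalisation.\<close>

lemma integral_\<mu>:
  assumes [measurable]: "f \<in> borel_measurable borel" and bd: "\<And>r. \<bar>f r\<bar> \<le> B" and s: "s \<in> {a..b}"
  shows "(b - a) * (\<integral>r. of_bool (s < r) * f r \<partial>\<mu>) = integral {s..b} f"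
proof -
  have set_int: "set_integrable lborel {s..b} f"
    unfolding set_integrable_def using bd
    by (intro integrableI_bounded_set_indicator[where B = B]) (auto simp: emeasure_lborel_Icc_eq)
  have \<mu>: "\<mu> = density lborel (\<lambda>r. ennreal (indicator {a..b} r / (b - a)))"
    unfolding uniform_measure_def using ab
    by (intro density_cong) (auto split: split_indicator simp: divide_ennreal simp flip: ennreal_1)
  have "(\<integral>r. of_bool (s < r) * f r \<partial>\<mu>) = (\<integral>r. (indicator {a..b} r / (b - a)) *\<^sub>R (of_bool (s < r) * f r) \<partial>lborel)"
    unfolding \<mu> using ab by (intro integral_density) auto
  also have "\<dots> = (\<integral>r. (indicator {s..b} r *\<^sub>R f r) / (b - a) \<partial>lborel)"
  proof (rule integral_cong_AE)
    have "AE r in lborel. r \<noteq> s" by (rule AE_lborel_singleton)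
    then show "AE r in lborel. (indicator {a..b} r / (b - a)) *\<^sub>R (of_bool (s < r) * f r) = (indicator {s..b} r *\<^sub>R f r) / (b - a)"
      by eventually_elim (use s in \<open>auto split: split_indicator\<close>)
  qed auto
  also have "\<dots> = integral {s..b} f / (b - a)"
    using set_borel_integral_eq_integral(2)[OF set_int] by (simp add: set_lebesgue_integral_def)
  finally show "(b - a) * (\<integral>r. of_bool (s < r) * f r \<partial>\<mu>) = integral {s..b} f"
    using ab by simp
qed

lemma integral_sortrun:
  assumes "x \<in> Y"
  shows "(\<integral>\<omega>. run (sort (map \<omega> [0..<n])) x \<partial>(PiM {..<n} (\<lambda>_. \<mu>))) = fact n * G n a x"
proof -
  have "AE r in \<mu>. a < r"
  proof (rule AE_uniform_measureI)
    have "AE r in lborel. r \<noteq> a" by (rule AE_lborel_singleton)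
    then show "AE r in lborel. r \<in> {a..b} \<longrightarrow> a < r" by eventually_elim auto
  qed simp
  then have "AE \<omega> in PiM {..<n} (\<lambda>_. \<mu>). a < \<omega> i" if "i \<in> {..<n}" for i
    using that by (intro AE_PiM_component prob_space_\<mu>)
  then have AE: "AE \<omega> in PiM {..<n} (\<lambda>_. \<mu>). \<forall>i\<in>{..<n}. a < \<omega> i"
    by (intro AE_finite_allI) auto
  have eq: "run (sort (map \<omega> [0..<n])) x = sortrun {..<n} \<omega> x" for \<omega>
    by (simp add: sortrun_def lessThan_atLeast0)
  have m1: "(\<lambda>\<omega>. sortrun {..<n} \<omega> x) \<in> borel_measurable (PiM {..<n} (\<lambda>_. \<mu>))"
    by (intro measurable_PiM_\<mu> sortrun_measurable) simp
  have [measurable]: "Measurable.pred (PiM {..<n} (\<lambda>_. \<mu>)) (\<lambda>\<omega>. \<forall>i\<in>{..<n}. a < \<omega> i)"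
    by (intro pred_intros_finite borel_measurable_pred_less measurable_PiM_\<mu> measurable_component_singleton) auto
  note [measurable] = m1
  have "(\<integral>\<omega>. run (sort (map \<omega> [0..<n])) x \<partial>(PiM {..<n} (\<lambda>_. \<mu>))) =
      (\<integral>\<omega>. of_bool (\<forall>i\<in>{..<n}. a < \<omega> i) * sortrun {..<n} \<omega> x \<partial>(PiM {..<n} (\<lambda>_. \<mu>)))"
    unfolding eq
  proof (rule integral_cong_AE)
    show "AE \<omega> in PiM {..<n} (\<lambda>_. \<mu>). sortrun {..<n} \<omega> x = of_bool (\<forall>i\<in>{..<n}. a < \<omega> i) * sortrun {..<n} \<omega> x"
      using AE by eventually_elim simp
  qed measurable
  then show ?thesis
    using order_statistics_integral[of "{..<n}" n x a] assms by simp
qed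

lemma AE_PiM_interval:
  fixes n :: nat
  shows "AE \<omega> in PiM {..<n} (\<lambda>_. \<mu>). \<forall>i\<in>{..<n}. \<omega> i \<in> {a..b}"
proof -
  have "AE r in \<mu>. r \<in> {a..b}" by (rule AE_uniform_measureI) simp_all
  then have "AE \<omega> in PiM {..<n} (\<lambda>_. \<mu>). \<omega> i \<in> {a..b}" if "i \<in> {..<n}" for i
    using that by (intro AE_PiM_component[where P = "\<lambda>r. r \<in> {a..b}"] prob_space_\<mu>)
  then show ?thesis by (intro AE_finite_allI) simp_all
qed

lemma run_eq_sortrun: "run (sort (map \<omega> [0..<n])) x = sortrun {..<n} \<omega> x"
  by (simp add: sortrun_def lessThan_atLeast0)

lemma integrable_run:
  assumes "x \<in> Y"
  shows "integrable (PiM {..<n} (\<lambda>_. \<mu>)) (\<lambda>\<omega>. run (sort (map \<omega> [0..<n])) x)"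
proof -
  interpret prob_space "PiM {..<n} (\<lambda>_. \<mu>)" by (rule prob_space_PiM_\<mu>)
  have "norm (sortrun {..<n} \<omega> x) \<le> M" for \<omega>
    using sortrun_bounds[OF assms, of "{..<n}" \<omega>] m_nonneg by simp
  then show ?thesis
    unfolding run_eq_sortrun
    by (intro integrable_const_bound[where B = M] measurable_PiM_\<mu> sortrun_measurable) simp_all
qed

text \<open>Sample times lie in the window almost surely, so a kernel may be changed freely outside
  it. This justifies replacing \<open>stepP\<close> by a kernel that is stochastic at all
  times.\<close>

lemma integral_run_cong:
  assumes "step_kernel Y p'" "\<And>s x x'. s \<in> {a..b} \<Longrightarrow> x \<in> Y \<Longrightarrow> x' \<in> Y \<Longrightarrow> p' s x x' = p s x x'" and "x \<in> Y"
  shows "(\<integral>\<omega>. step_kernel.run Y p' h (sort (map \<omega> [0..<n])) x \<partial>(PiM {..<n} (\<lambda>_. \<mu>))) =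
    (\<integral>\<omega>. run (sort (map \<omega> [0..<n])) x \<partial>(PiM {..<n} (\<lambda>_. \<mu>)))"
proof -
  interpret p': step_kernel Y p' h by (rule assms(1))
  have run_eq: "p'.run ss y = run ss y" if "set ss \<subseteq> {a..b}" "y \<in> Y" for ss y
    using that by (induction ss arbitrary: y) (auto intro!: sum.cong simp: assms(2))
  have eq': "p'.run (sort (map \<omega> [0..<n])) x = p'.sortrun {..<n} \<omega> x" for \<omega>
    by (simp add: p'.sortrun_def lessThan_atLeast0)
  show ?thesis
  proof (rule integral_cong_AE)
    show "(\<lambda>\<omega>. p'.run (sort (map \<omega> [0..<n])) x) \<in> borel_measurable (PiM {..<n} (\<lambda>_. \<mu>))"
      unfolding eq' by (intro measurable_PiM_\<mu> p'.sortrun_measurable) simp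
    show "AE \<omega> in PiM {..<n} (\<lambda>_. \<mu>). p'.run (sort (map \<omega> [0..<n])) x = run (sort (map \<omega> [0..<n])) x"
      using AE_PiM_interval
    proof eventually_elim
      fix \<omega> :: "nat \<Rightarrow> real" assume "\<forall>i\<in>{..<n}. \<omega> i \<in> {a..b}"
      then show "p'.run (sort (map \<omega> [0..<n])) x = run (sort (map \<omega> [0..<n])) x"
        by (intro run_eq) (auto simp: assms(3))
    qed
  qed (use integrable_run[OF assms(3)] in blast)
qed

lemma integral_run_bounds:
  assumes "x \<in> Y"
  shows "m \<le> (\<integral>\<omega>. run (sort (map \<omega> [0..<n])) x \<partial>(PiM {..<n} (\<lambda>_. \<mu>)))"
    and "(\<integral>\<omega>. run (sort (map \<omega> [0..<n])) x \<partial>(PiM {..<n} (\<lambda>_. \<mu>))) \<le> M"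
proof -
  interpret prob_space "PiM {..<n} (\<lambda>_. \<mu>)" by (rule prob_space_PiM_\<mu>)
  show "m \<le> (\<integral>\<omega>. run (sort (map \<omega> [0..<n])) x \<partial>(PiM {..<n} (\<lambda>_. \<mu>)))"
    using run_bounds[OF assms] by (intro integral_ge_const integrable_run assms) auto
  show "(\<integral>\<omega>. run (sort (map \<omega> [0..<n])) x \<partial>(PiM {..<n} (\<lambda>_. \<mu>))) \<le> M"
    using run_bounds[OF assms] by (intro integral_le_const integrable_run assms) auto
qed

section \<open>Poisson number of sample times and the backward equation\<close>

context
  fixes \<beta> :: real
  assumes \<beta>: "0 \<le> \<beta>"
begin

text \<open>The Poisson mixture without its factor exp (- (\<beta> * (b - a))). Leaving it out
  removes the diagonal term: S solves - S' = \<beta> P S in integrated form, whereas exp (- (\<beta>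
  * (b - s))) * S s x is the expected terminal value for a Poisson stream started at time s.\<close>

definition S :: "real \<Rightarrow> 'a \<Rightarrow> real" where
  "S s x = (\<Sum>n. (\<beta> * (b - a)) ^ n * G n s x)"

lemma S_term_bounds:
  assumes "x \<in> Y"
  shows "0 \<le> (\<beta> * (b - a)) ^ n * G n s x" "(\<beta> * (b - a)) ^ n * G n s x \<le> M * ((\<beta> * (b - a)) ^ n / fact n)"
  using G_bounds[OF assms, of n s] \<beta> ab mult_left_mono[of "G n s x" "M / fact n" "(\<beta> * (b - a)) ^ n"]
  by (simp_all add: mult.commute)

lemma summable_M: "summable (\<lambda>n. M * ((\<beta> * (b - a)) ^ n / fact n))"
  using summable_exp[of "\<beta> * (b - a)"] by (intro summable_mult) (simp add: field_simps)

lemma S_summable: "x \<in> Y \<Longrightarrow> summable (\<lambda>n. (\<beta> * (b - a)) ^ n * G n s x)"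
  using S_term_bounds by (intro summable_comparison_test'[OF summable_M]) simp

lemma S_lower: "x \<in> Y \<Longrightarrow> m \<le> S s x"
  using sum_le_suminf[OF S_summable, of x "{0}" s] S_term_bounds(1)[of x] h_lower[of x]
  unfolding S_def by (simp del: of_bool_eq_1_iff)

lemma S_upper: "x \<in> Y \<Longrightarrow> S s x \<le> M * exp (\<beta> * (b - a))"
proof -
  assume "x \<in> Y"
  have "S s x \<le> (\<Sum>n. M * ((\<beta> * (b - a)) ^ n / fact n))"
    unfolding S_def using \<open>x \<in> Y\<close> by (intro suminf_le S_term_bounds S_summable summable_M)
  also have "\<dots> = M * exp (\<beta> * (b - a))"
    using exp_converges[of "\<beta> * (b - a)"]
    by (intro sums_unique[symmetric] sums_mult) (simp add: scaleR_conv_of_real field_simps)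
  finally show ?thesis .
qed

lemma S_measurable [measurable]: "(\<lambda>s. S s x) \<in> borel_measurable borel"
  unfolding S_def by measurable

text \<open>The n! in the denominator of the Poisson weight cancels the n! orders of the sample
  points.\<close>

lemma poisson_average:
  assumes "x \<in> Y"
  shows "(\<Sum>n. poissonP (\<beta> * (b - a)) n * (\<integral>\<omega>. run (sort (map \<omega> [0..<n])) x \<partial>(PiM {..<n} (\<lambda>_. \<mu>))))
    = exp (- (\<beta> * (b - a))) * S a x"
proof -
  have "poissonP (\<beta> * (b - a)) n * (\<integral>\<omega>. run (sort (map \<omega> [0..<n])) x \<partial>(PiM {..<n} (\<lambda>_. \<mu>))) =
    exp (- (\<beta> * (b - a))) * ((\<beta> * (b - a)) ^ n * G n a x)" for n
    unfolding integral_sortrun[OF assms] poissonP_def by simp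
  then show ?thesis
    unfolding S_def by (simp only: suminf_mult[OF S_summable[OF assms]])
qed

lemma poisson_summable:
  assumes "x \<in> Y"
  shows "summable (\<lambda>n. poissonP (\<beta> * (b - a)) n * (\<integral>\<omega>. run (sort (map \<omega> [0..<n])) x \<partial>(PiM {..<n} (\<lambda>_. \<mu>))))"
proof -
  have c: "0 \<le> \<beta> * (b - a)" using \<beta> ab by simp
  show ?thesis
  proof (rule summable_comparison_test'[OF sums_summable[OF poissonP_sums], of 0])
    fix n
    have "0 \<le> (\<integral>\<omega>. run (sort (map \<omega> [0..<n])) x \<partial>(PiM {..<n} (\<lambda>_. \<mu>)))"
      using integral_run_bounds(1)[OF assms, of n] m_nonneg by linarith
    then show "norm (poissonP (\<beta> * (b - a)) n * (\<integral>\<omega>. run (sort (map \<omega> [0..<n])) x \<partial>(PiM {..<n} (\<lambda>_. \<mu>))))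
        \<le> poissonP (\<beta> * (b - a)) n * M"
      using poissonP_nonneg[OF c] integral_run_bounds(2)[OF assms]
      by (simp add: abs_mult mult_left_mono)
  qed
qed

lemma poisson_average_bounds:
  assumes "x \<in> Y"
  shows "m \<le> exp (- (\<beta> * (b - a))) * S a x" "exp (- (\<beta> * (b - a))) * S a x \<le> M"
proof -
  have c: "0 \<le> \<beta> * (b - a)" using \<beta> ab by simp
  note P = poisson_average[OF assms] poissonP_sums
  have "(\<Sum>n. poissonP (\<beta> * (b - a)) n * m) \<le> exp (- (\<beta> * (b - a))) * S a x"
    unfolding P(1)[symmetric]
    by (intro suminf_le mult_left_mono integral_run_bounds poissonP_nonneg c assms
        sums_summable[OF P(2)] poisson_summable)
  then show "m \<le> exp (- (\<beta> * (b - a))) * S a x" using sums_unique[OF P(2), of m] by simp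
  have "exp (- (\<beta> * (b - a))) * S a x \<le> (\<Sum>n. poissonP (\<beta> * (b - a)) n * M)"
    unfolding P(1)[symmetric]
    by (intro suminf_le mult_left_mono integral_run_bounds poissonP_nonneg c assms
        sums_summable[OF P(2)] poisson_summable)
  then show "exp (- (\<beta> * (b - a))) * S a x \<le> M" using sums_unique[OF P(2), of M] by simp
qed

text \<open>The summand for n + 1 is an integral of the summand for n, so the shifted series is S
  under the integral. The exchange of sum and integral is dominated by the exponential series M c^n
  / n! with c = \<beta> (b - a).\<close>

lemma S_integral_equation:
  assumes x: "x \<in> Y" and s: "s \<in> {a..b}"
  shows "S s x = h x + \<beta> * integral {s..b} (\<lambda>r. \<Sum>x'\<in>Y. p r x x' * S r x')"
proof -
  interpret U: prob_space \<mu> by (rule prob_space_\<mu>)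
  let ?c = "\<beta> * (b - a)"
  let ?f = "\<lambda>n r. of_bool (s < r) * (\<Sum>x'\<in>Y. p r x x' * (?c ^ n * G n r x'))"
  have avg: "0 \<le> (\<Sum>x'\<in>Y. p r x x' * (?c ^ n * G n r x'))"
    "(\<Sum>x'\<in>Y. p r x x' * (?c ^ n * G n r x')) \<le> M * (?c ^ n / fact n)" for n r
    by (rule p_average_bounds[OF x S_term_bounds]; assumption)+
  have bd: "norm (?f n r) \<le> M * (?c ^ n / fact n)" for n r
    using avg[of r n] by (cases "s < r") simp_all
  have int: "integrable \<mu> (?f n)" for n
    using bd by (intro U.integrable_const_bound[where B = "M * (?c ^ n / fact n)"]) auto
  have norm_int: "(\<integral>r. norm (?f n r) \<partial>\<mu>) \<le> M * (?c ^ n / fact n)" for n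
    by (rule U.integral_le_const[OF integrable_norm[OF int]]) (use bd in blast)
  have "(\<lambda>n. ?c ^ (Suc n) * G (Suc n) s x) = (\<lambda>n. ?c * (\<integral>r. ?f n r \<partial>\<mu>))"
  proof
    fix n
    have "?f n r = ?c ^ n * (of_bool (s < r) * (\<Sum>x'\<in>Y. p r x x' * G n r x'))" for r
      by (simp add: sum_distrib_left mult_ac)
    then have "(\<integral>r. ?f n r \<partial>\<mu>) = ?c ^ n * G (Suc n) s x"
      by (simp only: integral_mult_right_zero G.simps)
    then show "?c ^ (Suc n) * G (Suc n) s x = ?c * (\<integral>r. ?f n r \<partial>\<mu>)"
      by (simp only: power_Suc mult.assoc)
  qed
  then have "S s x = h x + (\<Sum>n. ?c * (\<integral>r. ?f n r \<partial>\<mu>))"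
    using suminf_split_head[OF S_summable[OF x, of s]] by (simp add: S_def)
  also have "(\<Sum>n. ?c * (\<integral>r. ?f n r \<partial>\<mu>)) = ?c * (\<Sum>n. \<integral>r. ?f n r \<partial>\<mu>)"
  proof (rule suminf_mult)
    show "summable (\<lambda>n. \<integral>r. ?f n r \<partial>\<mu>)"
      by (rule summable_comparison_test'[OF summable_M, of 0])
        (rule order_trans[OF integral_norm_bound norm_int])
  qed
  also have "(\<Sum>n. \<integral>r. ?f n r \<partial>\<mu>) = (\<integral>r. (\<Sum>n. ?f n r) \<partial>\<mu>)"
  proof (rule integral_suminf[symmetric])
    show "AE r in \<mu>. summable (\<lambda>n. norm (?f n r))"
      using bd by (intro AE_I2 summable_comparison_test'[OF summable_M]) simp
    show "summable (\<lambda>n. \<integral>r. norm (?f n r) \<partial>\<mu>)"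
      using norm_int by (intro summable_comparison_test'[OF summable_M, of 0]) simp
  qed (rule int)
  also have "(\<integral>r. (\<Sum>n. ?f n r) \<partial>\<mu>) = (\<integral>r. of_bool (s < r) * (\<Sum>x'\<in>Y. p r x x' * S r x') \<partial>\<mu>)"
  proof (rule Bochner_Integration.integral_cong[OF refl])
    fix r
    have "(\<lambda>n. ?f n r) sums (of_bool (s < r) * (\<Sum>x'\<in>Y. p r x x' * S r x'))"
      unfolding S_def by (intro sums_mult sums_sum summable_sums S_summable)
    then show "(\<Sum>n. ?f n r) = of_bool (s < r) * (\<Sum>x'\<in>Y. p r x x' * S r x')"
      by (rule sums_unique[symmetric])
  qed
  also have "?c * \<dots> = \<beta> * ((b - a) * \<dots>)" by simp
  also have "(b - a) * (\<integral>r. of_bool (s < r) * (\<Sum>x'\<in>Y. p r x x' * S r x') \<partial>\<mu>) =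
     integral {s..b} (\<lambda>r. \<Sum>x'\<in>Y. p r x x' * S r x')"
  proof (rule integral_\<mu>[OF _ _ s])
    show "\<bar>\<Sum>x'\<in>Y. p r x x' * S r x'\<bar> \<le> M * exp ?c" for r
    proof -
      have "m \<le> (\<Sum>x'\<in>Y. p r x x' * S r x')" "(\<Sum>x'\<in>Y. p r x x' * S r x') \<le> M * exp ?c"
        by (rule p_average_bounds[OF x S_lower S_upper]; assumption)+
      then show ?thesis using m_nonneg by linarith
    qed
  qed measurable
  finally show ?thesis .
qed

end

end

section \<open>Increments of a weighted logarithm\<close>

lemma bounded_borel_integrable_on:
  fixes f :: "real \<Rightarrow> real"
  assumes [measurable]: "f \<in> borel_measurable borel" and "\<And>r. r \<in> {a..b} \<Longrightarrow> \<bar>f r\<bar> \<le> B"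
  shows "f integrable_on {a..b}"
proof (rule set_borel_integral_eq_integral(1))
  show "set_integrable lborel {a..b} f"
    unfolding set_integrable_def using assms(2)
    by (intro integrableI_bounded_set_indicator[where B = B]) (auto simp: emeasure_lborel_Icc_eq)
qed

text \<open>Stands in for the fundamental theorem of calculus, which is not available for the merely measurable
  rates: quadratic errors vanish under refinement of the partition.\<close>

lemma increment_le_integral:
  fixes \<Phi> f :: "real \<Rightarrow> real"
  assumes ab: "a \<le> b" and f: "f integrable_on {a..b}"
    and step: "\<And>s s'. a \<le> s \<Longrightarrow> s \<le> s' \<Longrightarrow> s' \<le> b \<Longrightarrow>
      \<Phi> s' - \<Phi> s \<le> integral {s..s'} f + C * (s' - s)\<^sup>2"
  shows "\<Phi> b - \<Phi> a \<le> integral {a..b} f"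
proof -
  have "\<Phi> b - \<Phi> a - integral {a..b} f \<le> C * (b - a)\<^sup>2 * (1 / real (Suc n))" for n
  proof -
    define L where "L = (b - a) / real (Suc n)"
    have L: "0 \<le> L" using ab by (simp add: L_def)
    have iL: "a + real i * L \<le> b" if "i \<le> Suc n" for i
    proof -
      have "real i * L \<le> real (Suc n) * L" using that L by (intro mult_right_mono) auto
      then show ?thesis by (simp add: L_def)
    qed
    have "\<Phi> (a + real i * L) - \<Phi> a \<le> integral {a..a + real i * L} f + real i * (C * L\<^sup>2)" if "i \<le> Suc n" for i
      using that
    proof (induction i)
      case (Suc i)
      let ?s = "a + real i * L" and ?s' = "a + real (Suc i) * L"
      have s: "a \<le> ?s" "?s \<le> ?s'" "?s' \<le> b"
        using L iL[OF Suc.prems] by (auto simp: algebra_simps)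
      have "\<Phi> ?s' - \<Phi> ?s \<le> integral {?s..?s'} f + C * (?s' - ?s)\<^sup>2"
        by (rule step[OF s])
      moreover have "?s' - ?s = L" by (simp add: algebra_simps)
      moreover have "integral {a..?s} f + integral {?s..?s'} f = integral {a..?s'} f"
        using s f by (intro Henstock_Kurzweil_Integration.integral_combine)
          (auto intro: integrable_on_subinterval)
      ultimately show ?case using Suc by (simp add: algebra_simps)
    qed simp
    from this[of "Suc n"] have "\<Phi> b - \<Phi> a \<le> integral {a..b} f + real (Suc n) * (C * L\<^sup>2)"
      by (simp add: L_def)
    also have "real (Suc n) * (C * L\<^sup>2) = C * (b - a)\<^sup>2 * (1 / real (Suc n))"
      by (simp add: L_def power2_eq_square)
    finally show ?thesis by simp
  qed
  moreover have "(\<lambda>n. C * (b - a)\<^sup>2 * (1 / real (Suc n))) \<longlonglongrightarrow> C * (b - a)\<^sup>2 * 0"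
    by (intro tendsto_mult tendsto_const LIMSEQ_Suc[OF lim_1_over_n])
  ultimately have "\<Phi> b - \<Phi> a - integral {a..b} f \<le> C * (b - a)\<^sup>2 * 0"
    by (intro LIMSEQ_le_const) auto
  then show ?thesis by simp
qed

lemma ln_diff_le_quotient:
  fixes x y :: real
  assumes "0 < x" "0 < y"
  shows "ln x - ln y \<le> (x - y) / y"
  using ln_le_minus_one[of "x / y"] assms by (simp add: ln_div diff_divide_distrib)

lemma mult_le_of_abs_le:
  fixes x y u v :: real
  assumes "\<bar>x\<bar> \<le> u" "\<bar>y\<bar> \<le> v"
  shows "x * y \<le> u * v"
proof -
  have "x * y \<le> \<bar>x\<bar> * \<bar>y\<bar>" by (metis abs_ge_self abs_mult)
  also have "\<dots> \<le> u * v" using assms by (intro mult_mono) auto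
  finally show ?thesis .
qed

text \<open>Integrated form of (J ln S)' = j ln S - J g / S, where S' = - g holds only in the
  integrated sense. An inequality is enough, so concavity of ln gives the local step with
  coefficients frozen at the endpoints of [s, s']. As J and S are Lipschitz, unfreezing them costs
  O((s' - s)^2), which \<open>increment_le_integral\<close> discards.\<close>

lemma weighted_log_increment:
  fixes J j g S :: "real \<Rightarrow> real"
  assumes ab: "a \<le> b"
    and g_meas [measurable]: "g \<in> borel_measurable borel" and g_bd: "\<And>r. r \<in> {a..b} \<Longrightarrow> \<bar>g r\<bar> \<le> B"
    and S_meas [measurable]: "S \<in> borel_measurable borel"
    and S_eq: "\<And>s. s \<in> {a..b} \<Longrightarrow> S s = c + integral {s..b} g"
    and m: "0 < m" and S_lower: "\<And>s. s \<in> {a..b} \<Longrightarrow> m \<le> S s"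
    and S_upper: "\<And>s. s \<in> {a..b} \<Longrightarrow> S s \<le> M"
    and J_deriv: "\<And>s. (J has_real_derivative j s) (at s)"
    and j_cont: "continuous_on UNIV j"
    and J_nonneg: "\<And>s. s \<in> {a..b} \<Longrightarrow> 0 \<le> J s"
  shows "(\<lambda>r. j r * ln (S r) - J r * g r / S r) integrable_on {a..b}" (is ?int)
    and "J b * ln (S b) - J a * ln (S a) \<le> integral {a..b} (\<lambda>r. j r * ln (S r) - J r * g r / S r)"
proof -
  let ?f = "\<lambda>r. j r * ln (S r) - J r * g r / S r"
  have J_cont: "continuous_on UNIV J"
    using J_deriv by (meson DERIV_continuous_on has_field_derivative_at_within)
  have [measurable]: "j \<in> borel_measurable borel" "J \<in> borel_measurable borel"
    using j_cont J_cont by (auto intro: borel_measurable_continuous_onI)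
  have "bounded (j ` {a..b})" "bounded (J ` {a..b})"
    using j_cont J_cont by (auto intro!: compact_imp_bounded compact_continuous_image intro: continuous_on_subset)
  then obtain j0 J0 where j0: "\<And>r. r \<in> {a..b} \<Longrightarrow> \<bar>j r\<bar> \<le> j0" and J0: "\<And>r. r \<in> {a..b} \<Longrightarrow> \<bar>J r\<bar> \<le> J0"
    unfolding bounded_iff real_norm_def by blast
  have pos: "0 \<le> j0" "0 \<le> J0" "0 \<le> B"
    using j0[of a] J0[of a] g_bd[of a] ab by auto
  have S_pos: "0 < S r" if "r \<in> {a..b}" for r using m S_lower[OF that] by linarith
  define \<Lambda> where "\<Lambda> = max \<bar>ln m\<bar> \<bar>ln M\<bar>"
  have lnS: "\<bar>ln (S r)\<bar> \<le> \<Lambda>" if "r \<in> {a..b}" for r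
  proof -
    have "ln m \<le> ln (S r)" "ln (S r) \<le> ln M"
      using m S_lower[OF that] S_upper[OF that] S_pos[OF that] by (auto intro: ln_mono)
    then show ?thesis by (auto simp: \<Lambda>_def)
  qed
  show int: ?int
  proof (rule bounded_borel_integrable_on)
    fix r assume r: "r \<in> {a..b}"
    have "\<bar>?f r\<bar> \<le> \<bar>j r\<bar> * \<bar>ln (S r)\<bar> + \<bar>J r\<bar> * \<bar>g r\<bar> / S r"
      using S_pos[OF r] by (auto simp: abs_mult intro!: order_trans[OF abs_triangle_ineq4])
    also have "\<dots> \<le> j0 * \<Lambda> + J0 * B / m"
      using pos m lnS[OF r] j0[OF r] J0[OF r] g_bd[OF r] S_lower[OF r]
      by (intro add_mono mult_mono frac_le) auto
    finally show "\<bar>?f r\<bar> \<le> j0 * \<Lambda> + J0 * B / m" .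
  qed measurable
  \<comment> \<open>First summand: the bound on \<open>j\<close> times the Lipschitz constant of ln
    S. Second summand: the Lipschitz constant of J / S times the bound on \<open>g\<close>.\<close>
  define C where "C = j0 * (B / m) + (j0 / m + J0 * B / m\<^sup>2) * B"
  show "J b * ln (S b) - J a * ln (S a) \<le> integral {a..b} ?f"
  proof (rule increment_le_integral[OF ab int])
    fix s s' assume ss: "a \<le> s" "s \<le> s'" "s' \<le> b"
    then have s_in: "s \<in> {a..b}" "s' \<in> {a..b}" by auto
    have int_g: "g integrable_on {u..v}" if "a \<le> u" "v \<le> b" for u v
      by (rule bounded_borel_integrable_on[where B = B]) (use g_bd that in auto)
    have S_diff: "S u - S v = integral {u..v} g" if "a \<le> u" "u \<le> v" "v \<le> b" for u v
    proof -
      have "integral {u..v} g + integral {v..b} g = integral {u..b} g"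
        using that int_g by (intro Henstock_Kurzweil_Integration.integral_combine) auto
      then show ?thesis using S_eq[of u] S_eq[of v] that by simp
    qed
    have S_lip: "\<bar>S u - S v\<bar> \<le> B * (v - u)" if "a \<le> u" "u \<le> v" "v \<le> b" for u v
      unfolding S_diff[OF that]
      using has_integral_bound_real[OF pos(3) _ integrable_integral[OF int_g[of u v]], of "{}"] that g_bd by auto
    have J_diff: "(j has_integral (J v - J u)) {u..v}" if "u \<le> v" for u v
      using J_deriv that
      by (intro fundamental_theorem_of_calculus)
         (auto simp: has_real_derivative_iff_has_vector_derivative[symmetric] intro: has_field_derivative_at_within)
    have J_lip: "\<bar>J v - J u\<bar> \<le> j0 * (v - u)" if "a \<le> u" "u \<le> v" "v \<le> b" for u v
      using has_integral_bound_real[OF pos(1) _ J_diff[OF that(2)], of "{}"] that j0 by auto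
    let ?A = "ln (S s')" and ?R = "J s / S s"
    have "J s' * ln (S s') - J s * ln (S s) = (J s' - J s) * ?A + J s * (ln (S s') - ln (S s))"
      by (simp add: algebra_simps)
    also have "\<dots> \<le> (J s' - J s) * ?A + J s * ((S s' - S s) / S s)"
      using ln_diff_le_quotient[OF S_pos S_pos] s_in J_nonneg by (intro add_left_mono mult_left_mono) auto
    also have "\<dots> = (J s' - J s) * ?A - ?R * integral {s..s'} g"
      using S_diff[OF ss] by (simp add: algebra_simps diff_divide_distrib)
    also have "\<dots> = integral {s..s'} (\<lambda>r. j r * ?A - ?R * g r)"
      using J_diff[OF ss(2)] int_g[of s s'] ss
      by (intro integral_unique[symmetric] has_integral_diff has_integral_mult_left has_integral_mult_right)
         auto
    also have "\<dots> \<le> integral {s..s'} (\<lambda>r. ?f r + C * (s' - s))"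
    proof (rule integral_le)
      show "(\<lambda>r. j r * ?A - ?R * g r) integrable_on {s..s'}"
        using J_diff[OF ss(2)] int_g[of s s'] ss
        by (intro integrable_diff integrable_on_mult_left integrable_on_mult_right) auto
      show "(\<lambda>r. ?f r + C * (s' - s)) integrable_on {s..s'}"
        using ss by (intro integrable_add integrable_on_subinterval[OF int] integrable_const_ivl) auto
      fix r assume r: "r \<in> {s..s'}"
      then have r': "r \<in> {a..b}" "a \<le> r" "r \<le> b" using ss by auto
      have "\<bar>ln (S s') - ln (S r)\<bar> \<le> B * (s' - s) / m"
      proof -
        have d: "\<bar>S r - S s'\<bar> \<le> B * (s' - s)"
          using S_lip[of r s'] r r' ss pos by (smt (verit) atLeastAtMost_iff mult_left_mono)
        have "ln (S s') - ln (S r) \<le> \<bar>S r - S s'\<bar> / m"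
          by (rule order_trans[OF ln_diff_le_quotient[OF S_pos[OF s_in(2)] S_pos[OF r'(1)]] frac_le])
             (use S_lower[OF r'(1)] m in auto)
        moreover have "ln (S r) - ln (S s') \<le> \<bar>S r - S s'\<bar> / m"
          by (rule order_trans[OF ln_diff_le_quotient[OF S_pos[OF r'(1)] S_pos[OF s_in(2)]] frac_le])
             (use S_lower[OF s_in(2)] m in auto)
        ultimately have "\<bar>ln (S s') - ln (S r)\<bar> \<le> \<bar>S r - S s'\<bar> / m" by linarith
        also have "\<dots> \<le> B * (s' - s) / m" using d m by (intro divide_right_mono) auto
        finally show ?thesis .
      qed
      then have e1: "j r * (ln (S s') - ln (S r)) \<le> j0 * (B * (s' - s) / m)"
        by (rule mult_le_of_abs_le[OF j0[OF r'(1)]])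
      have "\<bar>J r / S r - J s / S s\<bar> \<le> (j0 / m + J0 * B / m\<^sup>2) * (s' - s)"
      proof -
        have Jd: "\<bar>J r - J s\<bar> \<le> j0 * (s' - s)"
          using J_lip[of s r] r r' ss pos by (smt (verit) atLeastAtMost_iff mult_left_mono)
        have Sd: "\<bar>S s - S r\<bar> \<le> B * (s' - s)"
          using S_lip[of s r] r r' ss pos by (smt (verit) atLeastAtMost_iff mult_left_mono)
        have "J r / S r - J s / S s = (J r - J s) / S r + J s * (S s - S r) / (S r * S s)"
          using S_pos[OF r'(1)] S_pos[OF s_in(1)] by (simp add: field_simps)
        also have "\<bar>\<dots>\<bar> \<le> \<bar>J r - J s\<bar> / S r + \<bar>J s\<bar> * \<bar>S s - S r\<bar> / (S r * S s)"
          using S_pos[OF r'(1)] S_pos[OF s_in(1)]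
          by (auto simp: abs_mult intro!: order_trans[OF abs_triangle_ineq])
        also have "\<dots> \<le> j0 * (s' - s) / m + J0 * (B * (s' - s)) / (m * m)"
          using Jd Sd J0[OF s_in(1)] S_lower[OF r'(1)] S_lower[OF s_in(1)] m pos ss
          by (intro add_mono frac_le mult_mono) auto
        also have "\<dots> = (j0 / m + J0 * B / m\<^sup>2) * (s' - s)"
          by (simp add: algebra_simps power2_eq_square)
        finally show ?thesis .
      qed
      then have e2: "(J r / S r - J s / S s) * g r \<le> (j0 / m + J0 * B / m\<^sup>2) * (s' - s) * B"
        by (rule mult_le_of_abs_le[OF _ g_bd[OF r'(1)]])
      have "j r * ?A - ?R * g r = ?f r + j r * (ln (S s') - ln (S r)) + (J r / S r - J s / S s) * g r"
        by (simp add: algebra_simps)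
      also have "\<dots> \<le> ?f r + j0 * (B * (s' - s) / m) + (j0 / m + J0 * B / m\<^sup>2) * (s' - s) * B"
        using e1 e2 by linarith
      also have "\<dots> = ?f r + C * (s' - s)"
        by (simp add: C_def algebra_simps add_divide_distrib)
      finally show "j r * ?A - ?R * g r \<le> ?f r + C * (s' - s)" .
    qed
    also have "\<dots> = integral {s..s'} ?f + C * (s' - s)\<^sup>2"
      using ss integrable_on_subinterval[OF int, of s s']
      by (subst Henstock_Kurzweil_Integration.integral_add) (auto simp: power2_eq_square)
    finally show "J s' * ln (S s') - J s * ln (S s) \<le> integral {s..s'} ?f + C * (s' - s)\<^sup>2" .
  qed
qed

section \<open>The masked forward process\<close>

lemma Ystates_nth: "y \<in> Ystates K d \<Longrightarrow> i < d \<Longrightarrow> y ! i \<in> {1..K}"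
  unfolding Ystates_def using nth_mem by blast

lemma Ystates_length: "y \<in> Ystates K d \<Longrightarrow> length y = d"
  by (simp add: Ystates_def)

lemma Ystates_update: "y \<in> Ystates K d \<Longrightarrow> a \<in> {1..K} \<Longrightarrow> y[i := a] \<in> Ystates K d"
  unfolding Ystates_def using set_update_subset_insert[of y i a] by auto

lemma finite_Ystates [simp]: "finite (Ystates K d)"
  using finite_lists_length_eq[of "{1..K}" d] by (simp add: Ystates_def conj_commute)

lemma Ystates_0: "Ystates K 0 = {[]}"
  by (auto simp: Ystates_def)

lemma Ystates_Suc: "Ystates K (Suc d) = (\<lambda>(a, y). a # y) ` ({1..K} \<times> Ystates K d)"
  by (auto simp: Ystates_def length_Suc_conv image_iff)

lemma sum_Ystates_prod:
  fixes g :: "nat \<Rightarrow> nat \<Rightarrow> real"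
  shows "(\<Sum>y\<in>Ystates K d. \<Prod>i<d. g i (y ! i)) = (\<Prod>i<d. \<Sum>a\<in>{1..K}. g i a)"
proof (induction d arbitrary: g)
  case 0
  then show ?case by (simp add: Ystates_0)
next
  case (Suc d)
  have "(\<Sum>y\<in>Ystates K (Suc d). \<Prod>i<Suc d. g i (y ! i)) =
    (\<Sum>(a, y)\<in>{1..K} \<times> Ystates K d. \<Prod>i<Suc d. g i ((a # y) ! i))"
    unfolding Ystates_Suc by (subst sum.reindex) (auto simp: inj_on_def intro!: sum.cong)
  also have "\<dots> = (\<Sum>a\<in>{1..K}. \<Sum>y\<in>Ystates K d. g 0 a * (\<Prod>i<d. g (Suc i) (y ! i)))"
    unfolding sum.cartesian_product[symmetric] by (simp add: prod.lessThan_Suc_shift del: prod.lessThan_Suc)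
  also have "\<dots> = (\<Sum>a\<in>{1..K}. g 0 a) * (\<Sum>y\<in>Ystates K d. \<Prod>i<d. g (Suc i) (y ! i))"
    by (simp add: sum_product)
  also have "\<dots> = (\<Prod>i<Suc d. \<Sum>a\<in>{1..K}. g i a)"
    using Suc[of "\<lambda>i. g (Suc i)"] by (simp add: prod.lessThan_Suc_shift del: prod.lessThan_Suc)
  finally show ?case .
qed

lemma numK_card: "y \<in> Ystates K d \<Longrightarrow> numK K y = card {i. i < d \<and> y ! i = K}"
  by (simp add: numK_def length_filter_conv_card Ystates_length)

text \<open>Rewrites the Hamming condition as a list update, so that sums over neighbours become
  sums over a position and, from the masked side, a token. The token K is excluded because y'
  differs from y at the masked position.\<close>

lemma Rfwd_offdiag:
  assumes "y \<in> Ystates K d" "y' \<in> Ystates K d" "y \<noteq> y'"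
  shows "Rfwd K d y y' = of_bool (\<exists>i<d. y ! i = K \<and> (\<exists>a\<in>{1..<K}. y' = y[i := a]))"
proof -
  let ?D = "{i. i < d \<and> y ! i \<noteq> y' ! i}"
  have len: "length y = d" "length y' = d" using assms by (auto simp: Ystates_length)
  have "(card ?D = 1 \<and> (\<forall>i<d. y ! i \<noteq> y' ! i \<longrightarrow> y ! i = K)) \<longleftrightarrow>
    (\<exists>i<d. y ! i = K \<and> (\<exists>a\<in>{1..<K}. y' = y[i := a]))" (is "?L \<longleftrightarrow> ?R")
  proof
    assume L: ?L
    then have "card ?D = 1" by (rule conjunct1)
    then obtain i where i: "?D = {i}" by (rule card_1_singletonE)
    have "i \<in> ?D" unfolding i by (rule singletonI)
    then have id: "i < d" "y ! i \<noteq> y' ! i" by auto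
    have yi: "y ! i = K" using L[THEN conjunct2] id by simp
    have "y' ! i \<noteq> K" using id yi by metis
    then have a: "y' ! i \<in> {1..<K}"
      using Ystates_nth[OF assms(2) id(1)] by simp
    have "y' = y[i := y' ! i]"
    proof (rule nth_equalityI)
      fix j assume j: "j < length y'"
      show "y' ! j = y[i := y' ! i] ! j"
      proof (cases "j = i")
        case False
        then have "j \<notin> ?D" unfolding i by simp
        then show ?thesis using False j len by simp
      qed (use id len in simp)
    qed (use len in simp)
    with id yi a show ?R by blast
  next
    assume ?R
    then obtain i a where i: "i < d" "y ! i = K" "a \<in> {1..<K}" "y' = y[i := a]" by blast
    have "?D = {i}"
    proof (rule set_eqI)
      fix j show "j \<in> ?D \<longleftrightarrow> j \<in> {i}"
        using i(1-3) len unfolding i(4) by (cases "j = i") auto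
    qed
    then have D: "j = i" if "j < d" "y ! j \<noteq> y' ! j" for j using that by blast
    have "y ! j = K" if "j < d" "y ! j \<noteq> y' ! j" for j
      using D[OF that] i(2) by simp
    then show ?L using \<open>?D = {i}\<close> by simp
  qed
  then show ?thesis using assms(3) by (simp add: Rfwd_def)
qed

lemma sum_Rfwd_from:
  assumes y: "y \<in> Ystates K d"
  shows "(\<Sum>y'\<in>Ystates K d - {y}. Rfwd K d y y' * \<phi> y') =
    (\<Sum>i | i < d \<and> y ! i = K. \<Sum>a\<in>{1..<K}. \<phi> (y[i := a]))"
proof -
  let ?A = "{i. i < d \<and> y ! i = K} \<times> {1..<K}"
  let ?u = "\<lambda>(i, a). y[i := a]"
  have len: "length y = d" using y by (simp add: Ystates_length)
  have im: "?u ` ?A \<subseteq> Ystates K d - {y}"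
  proof safe
    fix i a assume i: "i < d" "K = y ! i" "a \<in> {1..<y ! i}"
    show "y[i := a] \<in> Ystates (y ! i) d" using i y by (intro Ystates_update) auto
  next
    fix i a assume i: "i < d" "K = y ! i" "a \<in> {1..<y ! i}" "y[i := a] = y"
    then have "a = y ! i" using len by (metis nth_list_update_eq)
    then show False using i by simp
  qed
  have inj: "inj_on ?u ?A"
  proof (rule inj_onI, clarify)
    fix i a i' a' assume i: "i < d" "i' < d" "a \<in> {1..<y ! i}" "a' \<in> {1..<y ! i}" "K = y ! i" "y ! i' = y ! i"
      and eq: "y[i := a] = y[i' := a']"
    have "y[i := a] ! i = y[i' := a'] ! i" using eq by simp
    then have "i = i'" using i len by (auto simp: nth_list_update split: if_splits)
    moreover from this have "a = a'" using eq i len by (metis nth_list_update_eq)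
    ultimately show "i = i' \<and> a = a'" by simp
  qed
  have iff: "(\<exists>i<d. y ! i = K \<and> (\<exists>a\<in>{1..<K}. y' = y[i := a])) \<longleftrightarrow> y' \<in> ?u ` ?A" for y'
    by (auto simp: image_iff)
  have "(\<Sum>y'\<in>Ystates K d - {y}. Rfwd K d y y' * \<phi> y') = (\<Sum>y'\<in>Ystates K d - {y}. if y' \<in> ?u ` ?A then \<phi> y' else 0)"
  proof (rule sum.cong[OF refl])
    fix y' assume "y' \<in> Ystates K d - {y}"
    then have "Rfwd K d y y' = of_bool (y' \<in> ?u ` ?A)"
      using Rfwd_offdiag[OF y, of y'] unfolding iff by blast
    then show "Rfwd K d y y' * \<phi> y' = (if y' \<in> ?u ` ?A then \<phi> y' else 0)" by simp
  qed
  also have "\<dots> = (\<Sum>y'\<in>?u ` ?A. \<phi> y')"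
    using im by (subst sum.inter_restrict[symmetric]) (auto simp: Int_absorb1)
  also have "\<dots> = (\<Sum>(i, a)\<in>?A. \<phi> (y[i := a]))"
    using inj by (subst sum.reindex) (auto simp: case_prod_beta)
  also have "\<dots> = (\<Sum>i | i < d \<and> y ! i = K. \<Sum>a\<in>{1..<K}. \<phi> (y[i := a]))"
    by (simp add: sum.cartesian_product)
  finally show ?thesis .
qed

lemma sum_Rfwd_to:
  assumes x: "x \<in> Ystates K d" and K: "1 \<le> K"
  shows "(\<Sum>x'\<in>Ystates K d - {x}. Rfwd K d x' x * \<phi> x') =
    (\<Sum>i | i < d \<and> x ! i \<noteq> K. \<phi> (x[i := K]))"
proof -
  let ?A = "{i. i < d \<and> x ! i \<noteq> K}"
  let ?u = "\<lambda>i. x[i := K]"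
  have len: "length x = d" using x by (simp add: Ystates_length)
  have im: "?u ` ?A \<subseteq> Ystates K d - {x}"
  proof safe
    fix i assume i: "i < d" "x ! i \<noteq> K"
    show "x[i := K] \<in> Ystates K d" using K x by (intro Ystates_update) auto
  next
    fix i assume i: "i < d" "x ! i \<noteq> K" "x[i := K] = x"
    then show False using len by (metis nth_list_update_eq)
  qed
  have inj: "inj_on ?u ?A"
  proof (rule inj_onI, clarify)
    fix i i' assume i: "i < d" "i' < d" "x ! i \<noteq> K" "x ! i' \<noteq> K" and eq: "x[i := K] = x[i' := K]"
    have "x[i := K] ! i = x[i' := K] ! i" using eq by simp
    then show "i = i'" using i len by (auto simp: nth_list_update split: if_splits)
  qed
  have iff: "(\<exists>i<d. x' ! i = K \<and> (\<exists>a\<in>{1..<K}. x = x'[i := a])) \<longleftrightarrow> x' \<in> ?u ` ?A" if "x' \<in> Ystates K d" for x'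
  proof
    assume "\<exists>i<d. x' ! i = K \<and> (\<exists>a\<in>{1..<K}. x = x'[i := a])"
    then obtain i a where i: "i < d" "x' ! i = K" "a \<in> {1..<K}" "x = x'[i := a]" by blast
    have "x' = x[i := K]" using i by (metis list_update_id list_update_overwrite)
    moreover have "x ! i \<noteq> K" using i that by (auto simp: Ystates_length)
    ultimately show "x' \<in> ?u ` ?A" using i by blast
  next
    assume "x' \<in> ?u ` ?A"
    then obtain i where i: "i < d" "x ! i \<noteq> K" "x' = x[i := K]" by blast
    have "x' ! i = K" using i len by simp
    moreover have "x = x'[i := x ! i]" using i by simp
    moreover have "x ! i \<in> {1..<K}" using Ystates_nth[OF x i(1)] i by auto
    ultimately show "\<exists>i<d. x' ! i = K \<and> (\<exists>a\<in>{1..<K}. x = x'[i := a])" using i by blast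
  qed
  have "(\<Sum>x'\<in>Ystates K d - {x}. Rfwd K d x' x * \<phi> x') = (\<Sum>x'\<in>Ystates K d - {x}. if x' \<in> ?u ` ?A then \<phi> x' else 0)"
  proof (rule sum.cong[OF refl])
    fix x' assume x': "x' \<in> Ystates K d - {x}"
    then have "Rfwd K d x' x = of_bool (x' \<in> ?u ` ?A)"
      using Rfwd_offdiag[OF _ x, of x'] unfolding iff[of x', OF DiffD1[OF x']] by blast
    then show "Rfwd K d x' x * \<phi> x' = (if x' \<in> ?u ` ?A then \<phi> x' else 0)" by simp
  qed
  also have "\<dots> = (\<Sum>x'\<in>?u ` ?A. \<phi> x')"
    using im by (subst sum.inter_restrict[symmetric]) (auto simp: Int_absorb1)
  also have "\<dots> = (\<Sum>i | i < d \<and> x ! i \<noteq> K. \<phi> (x[i := K]))"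
    using inj by (subst sum.reindex) auto
  finally show ?thesis .
qed

section \<open>Transition probabilities in closed form and the Kolmogorov equations\<close>

definition coordP :: "nat \<Rightarrow> real \<Rightarrow> nat \<Rightarrow> nat \<Rightarrow> real" where
  "coordP K t a b = (if a = b then if a = K then 1 else exp (- t) else if b = K then 1 - exp (- t) else 0)"

text \<open>Under the forward process each unmasked coordinate is masked at its own rate-one
  exponential time and then stays masked, so the transition matrix factorises over the coordinates.
  The product is tied to the power series \<open>qfwd\<close> only by the Kolmogorov equations and
  \<open>qfwd_eq_marg\<close>.\<close>

definition transP :: "nat \<Rightarrow> nat \<Rightarrow> real \<Rightarrow> nat list \<Rightarrow> nat list \<Rightarrow> real" where
  "transP K d t x z = (\<Prod>i<d. coordP K t (x ! i) (z ! i))"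

lemma coordP_nonneg: "0 \<le> t \<Longrightarrow> 0 \<le> coordP K t a b"
  by (auto simp: coordP_def)

lemma coordP_le_1: "0 \<le> t \<Longrightarrow> coordP K t a b \<le> 1"
  by (auto simp: coordP_def)

lemma transP_nonneg: "0 \<le> t \<Longrightarrow> 0 \<le> transP K d t x z"
  unfolding transP_def by (intro prod_nonneg ballI coordP_nonneg)

lemma transP_le_1: "0 \<le> t \<Longrightarrow> transP K d t x z \<le> 1"
  unfolding transP_def by (intro prod_le_1) (auto intro: coordP_nonneg coordP_le_1)

lemma transP_0:
  assumes "x \<in> Ystates K d" "z \<in> Ystates K d"
  shows "transP K d 0 x z = of_bool (x = z)"
proof (cases "x = z")
  case False
  then obtain i where i: "i < d" "x ! i \<noteq> z ! i"
    using assms by (metis Ystates_length nth_equalityI)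
  then have "coordP K 0 (x ! i) (z ! i) = 0" by (auto simp: coordP_def)
  then have "transP K d 0 x z = 0"
    unfolding transP_def using i by (intro prod_zero) auto
  then show ?thesis using False by simp
qed (simp add: transP_def coordP_def prod.neutral)

text \<open>The forward process never removes a mask. Read backwards, this keeps the number of masks
  of the reverse chain at or below its value at the window start, on which the Poisson rate
  depends.\<close>

lemma transP_numK_mono:
  assumes "x \<in> Ystates K d" "z \<in> Ystates K d" "transP K d t x z \<noteq> 0"
  shows "numK K x \<le> numK K z"
proof -
  have nz: "coordP K t (x ! i) (z ! i) \<noteq> 0" if "i < d" for i
    using assms(3) that unfolding transP_def by auto
  have "z ! i = K" if "i < d" "x ! i = K" for i
    using nz[OF that(1)] that(2) by (auto simp: coordP_def split: if_splits)
  then have "{i. i < d \<and> x ! i = K} \<subseteq> {i. i < d \<and> z ! i = K}" by auto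
  then show ?thesis using assms by (auto simp: numK_card intro: card_mono)
qed

lemma sum_coordP:
  assumes "a \<in> {1..K}"
  shows "(\<Sum>b\<in>{1..<K}. coordP K t a b) = (if a = K then 0 else exp (- t))"
proof -
  have "(\<Sum>b\<in>{1..<K}. coordP K t a b) = (\<Sum>b\<in>{1..<K}. if b = a then exp (- t) else 0)"
    using assms by (intro sum.cong) (auto simp: coordP_def)
  then show ?thesis using assms by auto
qed

lemma transP_sum:
  assumes "x \<in> Ystates K d"
  shows "(\<Sum>z\<in>Ystates K d. transP K d t x z) = 1"
proof -
  have "(\<Sum>z\<in>Ystates K d. transP K d t x z) = (\<Prod>i<d. \<Sum>b\<in>{1..K}. coordP K t (x ! i) b)"
    unfolding transP_def by (rule sum_Ystates_prod)
  also have "\<dots> = (\<Prod>i<d. 1)"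
  proof (rule prod.cong[OF refl])
    fix i assume "i \<in> {..<d}"
    then have a: "x ! i \<in> {1..K}" using Ystates_nth[OF assms] by simp
    then have "{1..K} = insert K {1..<K}" by auto
    then show "(\<Sum>b\<in>{1..K}. coordP K t (x ! i) b) = 1"
      using sum_coordP[OF a, of t] by (simp add: coordP_def)
  qed
  finally show ?thesis by simp
qed

text \<open>An unmasked endpoint forbids any masking on the way, so all d coordinates must survive,
  each with probability exp (- t).\<close>

lemma transP_unmasked:
  assumes y: "y \<in> Ystates K d" "numK K y = 0" and x: "x \<in> Ystates K d"
  shows "transP K d t x y = (if x = y then exp (- (real d * t)) else 0)"
proof -
  have nK: "y ! i \<noteq> K" if "i < d" for i
    using y that by (auto simp: numK_def filter_empty_conv Ystates_length)
  show ?thesis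
  proof (cases "x = y")
    case True
    then have "transP K d t x y = (\<Prod>i<d. exp (- t))"
      unfolding transP_def using nK by (intro prod.cong) (auto simp: coordP_def)
    then show ?thesis using True by (simp add: exp_of_nat_mult[symmetric])
  next
    case False
    then obtain i where i: "i < d" "x ! i \<noteq> y ! i"
      using nth_equalityI[of x y] Ystates_length[OF x] Ystates_length[OF y(1)] by auto
    then have "coordP K t (x ! i) (y ! i) = 0" using nK by (auto simp: coordP_def)
    then have "transP K d t x y = 0" using i unfolding transP_def by (intro prod_zero) auto
    then show ?thesis using False by simp
  qed
qed

lemma transP_update_left:
  assumes "i < d" "length x = d"
  shows "transP K d t (x[i := c]) z = coordP K t c (z ! i) * (\<Prod>j\<in>{..<d} - {i}. coordP K t (x ! j) (z ! j))"
proof -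
  have "transP K d t (x[i := c]) z = coordP K t (x[i := c] ! i) (z ! i) *
      (\<Prod>j\<in>{..<d} - {i}. coordP K t (x[i := c] ! j) (z ! j))"
    unfolding transP_def using assms by (intro prod.remove) auto
  also have "(\<Prod>j\<in>{..<d} - {i}. coordP K t (x[i := c] ! j) (z ! j)) = (\<Prod>j\<in>{..<d} - {i}. coordP K t (x ! j) (z ! j))"
    by (intro prod.cong) auto
  finally show ?thesis using assms by simp
qed

lemma transP_update_right:
  assumes "i < d" "length z = d"
  shows "transP K d t x (z[i := c]) = coordP K t (x ! i) c * (\<Prod>j\<in>{..<d} - {i}. coordP K t (x ! j) (z ! j))"
proof -
  have "transP K d t x (z[i := c]) = coordP K t (x ! i) (z[i := c] ! i) *
      (\<Prod>j\<in>{..<d} - {i}. coordP K t (x ! j) (z[i := c] ! j))"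
    unfolding transP_def using assms by (intro prod.remove) auto
  also have "(\<Prod>j\<in>{..<d} - {i}. coordP K t (x ! j) (z[i := c] ! j)) = (\<Prod>j\<in>{..<d} - {i}. coordP K t (x ! j) (z ! j))"
    by (intro prod.cong) auto
  finally show ?thesis using assms by simp
qed

lemma transP_remove:
  assumes "i < d"
  shows "transP K d t x z = coordP K t (x ! i) (z ! i) * (\<Prod>j\<in>{..<d} - {i}. coordP K t (x ! j) (z ! j))"
  unfolding transP_def using assms by (intro prod.remove) auto

lemma coordP_deriv:
  "((\<lambda>t. coordP K t a b) has_real_derivative
     (if a = b then if a = K then 0 else - exp (- t) else if b = K then exp (- t) else 0)) (at t)"
  unfolding coordP_def by (auto intro!: derivative_eq_intros)

lemma transP_deriv:
  "((\<lambda>t. transP K d t x z) has_real_derivative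
     (\<Sum>i<d. (if x ! i = z ! i then if x ! i = K then 0 else - exp (- t) else if z ! i = K then exp (- t) else 0) *
        (\<Prod>j\<in>{..<d} - {i}. coordP K t (x ! j) (z ! j)))) (at t)"
  unfolding transP_def by (intro has_field_derivative_prod coordP_deriv)

text \<open>Kolmogorov's backward equation: differentiating factor i amounts to masking coordinate i
  of the starting state. Both Kolmogorov equations are needed, since in the joint law of the reverse
  chain the current state is the endpoint of the marginal and the starting point of the
  transition.\<close>

lemma transP_deriv_backward:
  assumes x: "x \<in> Ystates K d" and K: "1 \<le> K"
  shows "((\<lambda>t. transP K d t x z) has_real_derivative
     ((\<Sum>x'\<in>Ystates K d - {x}. Rfwd K d x' x * transP K d t x' z) - (real d - real (numK K x)) * transP K d t x z)) (at t)"
proof -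
  have len: "length x = d" using x by (simp add: Ystates_length)
  have card: "card {i. i < d \<and> x ! i \<noteq> K} = d - numK K x"
  proof -
    have "{i. i < d \<and> x ! i \<noteq> K} = {..<d} - {i. i < d \<and> x ! i = K}" by auto
    then show ?thesis using numK_card[OF x] by (simp add: card_Diff_subset subset_eq)
  qed
  have le: "numK K x \<le> d" using len length_filter_le[of "\<lambda>a. a = K"] by (metis numK_def)
  have "(\<Sum>i<d. (if x ! i = z ! i then if x ! i = K then 0 else - exp (- t) else if z ! i = K then exp (- t) else 0) *
        (\<Prod>j\<in>{..<d} - {i}. coordP K t (x ! j) (z ! j))) =
     (\<Sum>i<d. if x ! i \<noteq> K then transP K d t (x[i := K]) z - transP K d t x z else 0)"
  proof (rule sum.cong[OF refl])
    fix i assume "i \<in> {..<d}"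
    then have i: "i < d" by simp
    show "(if x ! i = z ! i then if x ! i = K then 0 else - exp (- t) else if z ! i = K then exp (- t) else 0) *
        (\<Prod>j\<in>{..<d} - {i}. coordP K t (x ! j) (z ! j)) =
      (if x ! i \<noteq> K then transP K d t (x[i := K]) z - transP K d t x z else 0)"
      unfolding transP_update_left[OF i len] transP_remove[OF i, of K t x]
      by (auto simp: coordP_def algebra_simps)
  qed
  also have "\<dots> = (\<Sum>i | i < d \<and> x ! i \<noteq> K. transP K d t (x[i := K]) z - transP K d t x z)"
    by (subst sum.inter_filter[symmetric]) (auto intro: sum.cong)
  also have "\<dots> = (\<Sum>x'\<in>Ystates K d - {x}. Rfwd K d x' x * transP K d t x' z) - (real d - real (numK K x)) * transP K d t x z"
    using card le by (simp add: sum_Rfwd_to[OF x K] sum_subtractf of_nat_diff)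
  finally show ?thesis using transP_deriv[of K d x z t] by simp
qed

text \<open>Kolmogorov's forward equation: a mask at position i of z may have replaced any token a,
  and \<open>sum_coordP\<close> adds up these possibilities.\<close>

lemma transP_deriv_forward:
  assumes x: "x \<in> Ystates K d" and z: "z \<in> Ystates K d"
  shows "((\<lambda>t. transP K d t x z) has_real_derivative Rapply K d (transP K d t x) z) (at t)"
proof -
  have len: "length z = d" using z by (simp add: Ystates_length)
  have card: "card {i. i < d \<and> z ! i \<noteq> K} = d - numK K z"
  proof -
    have "{i. i < d \<and> z ! i \<noteq> K} = {..<d} - {i. i < d \<and> z ! i = K}" by auto
    then show ?thesis using numK_card[OF z] by (simp add: card_Diff_subset subset_eq)
  qed
  have le: "numK K z \<le> d" using len length_filter_le[of "\<lambda>a. a = K"] by (metis numK_def)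
  let ?r = "\<lambda>i. \<Prod>j\<in>{..<d} - {i}. coordP K t (x ! j) (z ! j)"
  have "(\<Sum>i<d. (if x ! i = z ! i then if x ! i = K then 0 else - exp (- t) else if z ! i = K then exp (- t) else 0) * ?r i) =
     (\<Sum>i<d. (if z ! i = K then \<Sum>a\<in>{1..<K}. transP K d t x (z[i := a]) else 0)
       - (if z ! i \<noteq> K then transP K d t x z else 0))"
  proof (rule sum.cong[OF refl])
    fix i assume "i \<in> {..<d}"
    then have i: "i < d" by simp
    have "(\<Sum>a\<in>{1..<K}. transP K d t x (z[i := a])) = (if x ! i = K then 0 else exp (- t)) * ?r i"
      unfolding transP_update_right[OF i len] sum_distrib_right[symmetric]
      using sum_coordP[OF Ystates_nth[OF x i]] by simp
    then show "(if x ! i = z ! i then if x ! i = K then 0 else - exp (- t) else if z ! i = K then exp (- t) else 0) * ?r i =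
      (if z ! i = K then \<Sum>a\<in>{1..<K}. transP K d t x (z[i := a]) else 0) - (if z ! i \<noteq> K then transP K d t x z else 0)"
      unfolding transP_remove[OF i, of K t x z]
      by (auto simp: coordP_def)
  qed
  also have "\<dots> = (\<Sum>i | i < d \<and> z ! i = K. \<Sum>a\<in>{1..<K}. transP K d t x (z[i := a]))
     - (\<Sum>i | i < d \<and> z ! i \<noteq> K. transP K d t x z)"
    unfolding sum_subtractf
    by (intro arg_cong2[where f = "(-)"]; subst sum.inter_filter[symmetric]) (auto intro: sum.cong)
  also have "\<dots> = Rapply K d (transP K d t x) z"
  proof -
    have "Rapply K d (transP K d t x) z = Rfwd K d z z * transP K d t x z +
        (\<Sum>y'\<in>Ystates K d - {z}. Rfwd K d z y' * transP K d t x y')"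
      unfolding Rapply_def using z by (intro sum.remove) auto
    also have "(\<Sum>y'\<in>Ystates K d - {z}. Rfwd K d z y' * transP K d t x y') =
        (\<Sum>i | i < d \<and> z ! i = K. \<Sum>a\<in>{1..<K}. transP K d t x (z[i := a]))"
      by (rule sum_Rfwd_from[OF z])
    finally show ?thesis
      using card le by (simp add: Rfwd_def[of K d z z] of_nat_diff algebra_simps)
  qed
  finally show ?thesis using transP_deriv[of K d x z t] by simp
qed


section \<open>Iterates of the generator\<close>

lemma Rapply_cong:
  "(\<And>y. y \<in> Ystates K d \<Longrightarrow> f y = g y) \<Longrightarrow> Rapply K d f = Rapply K d g"
  by (auto simp: Rapply_def intro!: ext sum.cong)

lemma Rapply_funpow_Suc:
  "(Rapply K d ^^ Suc n) g y = (\<Sum>y'\<in>Ystates K d. Rfwd K d y y' * (Rapply K d ^^ n) g y')"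
  by (simp add: Rapply_def[of K d "(Rapply K d ^^ n) g"])

lemma Rapply_funpow_deriv:
  assumes "\<And>y s. y \<in> Ystates K d \<Longrightarrow> ((\<lambda>t. f t y) has_real_derivative Rapply K d (f s) y) (at s)"
    and "y \<in> Ystates K d"
  shows "((\<lambda>t. (Rapply K d ^^ n) (f t) y) has_real_derivative (Rapply K d ^^ Suc n) (f s) y) (at s)"
  using assms(2)
proof (induction n arbitrary: y s)
  case (Suc n)
  have "((\<lambda>t. \<Sum>y'\<in>Ystates K d. Rfwd K d y y' * (Rapply K d ^^ n) (f t) y') has_real_derivative
      (\<Sum>y'\<in>Ystates K d. Rfwd K d y y' * (Rapply K d ^^ Suc n) (f s) y')) (at s)"
    by (intro DERIV_sum DERIV_cmult Suc.IH)
  then show ?case by (simp only: Rapply_funpow_Suc)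
qed (use assms(1) in simp)

lemma Rapply_funpow_bound:
  fixes K d :: nat
  defines "C \<equiv> \<Sum>y\<in>Ystates K d. \<Sum>y'\<in>Ystates K d. \<bar>Rfwd K d y y'\<bar>"
  assumes "\<And>y. y \<in> Ystates K d \<Longrightarrow> \<bar>f y\<bar> \<le> B" and "y \<in> Ystates K d"
  shows "\<bar>(Rapply K d ^^ n) f y\<bar> \<le> C ^ n * B"
  using assms(3)
proof (induction n arbitrary: y)
  case (Suc n)
  have B: "0 \<le> C ^ n * B" using Suc.IH[OF Suc.prems] by linarith
  have "\<bar>(Rapply K d ^^ Suc n) f y\<bar> \<le> (\<Sum>y'\<in>Ystates K d. \<bar>Rfwd K d y y' * (Rapply K d ^^ n) f y'\<bar>)"
    unfolding Rapply_funpow_Suc by (rule sum_abs)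
  also have "\<dots> \<le> (\<Sum>y'\<in>Ystates K d. \<bar>Rfwd K d y y'\<bar> * (C ^ n * B))"
    unfolding abs_mult by (intro sum_mono mult_left_mono Suc.IH) auto
  also have "\<dots> = (\<Sum>y'\<in>Ystates K d. \<bar>Rfwd K d y y'\<bar>) * (C ^ n * B)"
    by (rule sum_distrib_right[symmetric])
  also have "(\<Sum>y'\<in>Ystates K d. \<bar>Rfwd K d y y'\<bar>) \<le> C"
    unfolding C_def using Suc.prems
    by (intro member_le_sum[where f = "\<lambda>y. \<Sum>y'\<in>Ystates K d. \<bar>Rfwd K d y y'\<bar>"]) (auto intro: sum_nonneg)
  then have "(\<Sum>y'\<in>Ystates K d. \<bar>Rfwd K d y y'\<bar>) * (C ^ n * B) \<le> C * (C ^ n * B)"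
    using B by (rule mult_right_mono)
  finally show ?case by simp
qed (use assms(2) in simp)

section \<open>Marginals started from an unmasked law\<close>

locale masked_diffusion =
  fixes K d :: nat and q :: "nat list \<Rightarrow> real"
  assumes K2: "2 \<le> K"
    and q_nonneg: "\<And>y. y \<in> Ystates K d \<Longrightarrow> 0 \<le> q y"
    and q_sum: "(\<Sum>y\<in>Ystates K d. q y) = 1"
    and q_pos_iff: "\<And>y. y \<in> Ystates K d \<Longrightarrow> 0 < q y \<longleftrightarrow> numK K y = 0"
begin

abbreviation Y where "Y \<equiv> Ystates K d"

definition marg :: "real \<Rightarrow> nat list \<Rightarrow> real" where
  "marg t y = (\<Sum>x\<in>Y. q x * transP K d t x y)"

lemma q_masked: "y \<in> Y \<Longrightarrow> numK K y \<noteq> 0 \<Longrightarrow> q y = 0"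
  using q_nonneg[of y] q_pos_iff[of y] by simp

lemma marg_0: "y \<in> Y \<Longrightarrow> marg 0 y = q y"
  by (simp add: marg_def transP_0 if_distrib cong: sum.cong if_cong)

lemma marg_nonneg: "0 \<le> t \<Longrightarrow> y \<in> Y \<Longrightarrow> 0 \<le> marg t y"
  unfolding marg_def by (intro sum_nonneg mult_nonneg_nonneg q_nonneg transP_nonneg)

lemma marg_le_1: "0 \<le> t \<Longrightarrow> marg t y \<le> 1"
  unfolding marg_def q_sum[symmetric]
  by (intro sum_mono mult_left_le q_nonneg transP_le_1)

lemma transP_continuous: "continuous_on A (\<lambda>t. transP K d t x z)"
  by (intro continuous_at_imp_continuous_on ballI DERIV_isCont[OF transP_deriv])

lemma marg_continuous: "continuous_on A (\<lambda>t. marg t y)"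
  unfolding marg_def by (intro continuous_intros transP_continuous)

lemma marg_measurable [measurable]: "(\<lambda>t. marg t y) \<in> borel_measurable borel"
  by (intro borel_measurable_continuous_onI marg_continuous)

lemma transP_measurable [measurable]: "(\<lambda>t. transP K d t x z) \<in> borel_measurable borel"
  by (intro borel_measurable_continuous_onI transP_continuous)

lemma marg_sum: "(\<Sum>y\<in>Y. marg t y) = 1"
proof -
  have "(\<Sum>y\<in>Y. marg t y) = (\<Sum>x\<in>Y. q x * (\<Sum>y\<in>Y. transP K d t x y))"
    unfolding marg_def sum_distrib_left by (rule sum.swap)
  then show ?thesis using q_sum by (simp add: transP_sum)
qed

lemma marg_deriv:
  assumes "y \<in> Y"
  shows "((\<lambda>t. marg t y) has_real_derivative Rapply K d (marg t) y) (at t)"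
proof -
  have "((\<lambda>t. marg t y) has_real_derivative (\<Sum>x\<in>Y. q x * Rapply K d (transP K d t x) y)) (at t)"
    unfolding marg_def using assms by (intro DERIV_sum DERIV_cmult transP_deriv_forward)
  also have "(\<Sum>x\<in>Y. q x * Rapply K d (transP K d t x) y) = Rapply K d (marg t) y"
    unfolding Rapply_def marg_def sum_distrib_left by (subst sum.swap) (simp add: mult_ac)
  finally show ?thesis .
qed

text \<open>By the forward equation the n-th derivative of the marginal is the n-th iterate of the
  generator, bounded by C^n at all nonnegative times because marginals lie in [0, 1]. The Taylor
  remainder is then at most (C t)^n / n!, so the power series converges to the closed form.\<close>

lemma qfwd_eq_marg:
  assumes t: "0 < t" and y: "y \<in> Y"
  shows "qfwd K d q t y = marg t y"
proof -
  define C where "C = (\<Sum>y\<in>Y. \<Sum>y'\<in>Y. \<bar>Rfwd K d y y'\<bar>)"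
  let ?D = "\<lambda>n s. (Rapply K d ^^ n) (marg s) y"
  \<comment> \<open>\<open>q\<close> and \<open>marg 0\<close> agree only on the state space, but
    \<open>Rapply\<close> reads no other values.\<close>
  have funpow_q: "(Rapply K d ^^ n) q y = ?D n 0" for n
  proof (cases n)
    case (Suc n')
    have "Rapply K d q = Rapply K d (marg 0)" by (rule Rapply_cong) (simp add: marg_0)
    then show ?thesis unfolding Suc funpow_Suc_right comp_def by simp
  qed (use y marg_0 in simp)
  have err: "\<bar>marg t y - (\<Sum>m<n. ?D m 0 / fact m * t ^ m)\<bar> \<le> (C * t) ^ n / fact n" for n
  proof -
    have "\<exists>s. 0 < s \<and> s \<le> t \<and> marg t y = (\<Sum>m<n. ?D m 0 / fact m * t ^ m) + ?D n s / fact n * t ^ n"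
      using t y by (intro Maclaurin2) (auto intro: Rapply_funpow_deriv[OF marg_deriv] simp del: funpow.simps)
    then obtain s where s: "0 < s" "marg t y = (\<Sum>m<n. ?D m 0 / fact m * t ^ m) + ?D n s / fact n * t ^ n" by blast
    have "\<bar>?D n s\<bar> \<le> C ^ n * 1"
      unfolding C_def using s y marg_nonneg[of s] marg_le_1[of s] by (intro Rapply_funpow_bound) auto
    then have "\<bar>?D n s\<bar> * (t ^ n / fact n) \<le> C ^ n * (t ^ n / fact n)"
      using t by (intro mult_right_mono) auto
    then show ?thesis using s t by (simp add: abs_mult power_mult_distrib)
  qed
  have "(\<lambda>n. (C * t) ^ n / fact n) \<longlonglongrightarrow> 0"
    using summable_LIMSEQ_zero[OF summable_exp[of "C * t"]] by (simp add: field_simps)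
  then have "(\<lambda>n. marg t y - (\<Sum>m<n. ?D m 0 / fact m * t ^ m)) \<longlonglongrightarrow> 0"
    by (rule Lim_null_comparison[rotated]) (use err in simp)
  from tendsto_diff[OF tendsto_const[of "marg t y"] this]
  have "(\<lambda>n. \<Sum>m<n. ?D m 0 / fact m * t ^ m) \<longlonglongrightarrow> marg t y" by simp
  then have "(\<lambda>m. ?D m 0 / fact m * t ^ m) sums marg t y" by (simp add: sums_def)
  then have "(\<lambda>n. t ^ n / fact n * (Rapply K d ^^ n) q y) sums marg t y"
    unfolding funpow_q by (simp add: mult.commute)
  then show ?thesis unfolding qfwd_def by (rule sums_unique[symmetric])
qed

lemma marg_pos:
  assumes "0 < t" "y \<in> Y"
  shows "0 < marg t y"
proof -
  \<comment> \<open>An unmasked state from which y can be reached: every mask of y becomes the token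
    1, which differs from K since 2 \<le> K.\<close>
  define x where "x = map (\<lambda>a. if a = K then 1 else a) y"
  have x: "x \<in> Y" using assms K2 by (auto simp: x_def Ystates_def)
  have "numK K x = 0" using K2 by (auto simp: x_def numK_def filter_empty_conv)
  then have "0 < q x" using q_pos_iff[OF x] by simp
  moreover have "0 < transP K d t x y"
    unfolding transP_def
  proof (rule prod_pos)
    fix i assume "i \<in> {..<d}"
    then show "0 < coordP K t (x ! i) (y ! i)"
      using assms K2 by (auto simp: coordP_def x_def Ystates_length)
  qed
  ultimately have "0 < q x * transP K d t x y" by simp
  also have "\<dots> \<le> marg t y"
    unfolding marg_def using x assms q_nonneg
    by (intro member_le_sum) (auto intro!: mult_nonneg_nonneg transP_nonneg)
  finally show ?thesis .
qed

text \<open>Source of the shape of \<open>betaw\<close>. From an unmasked start, coordinate i is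
  still a token with probability e^(-t) and masked with probability 1 - e^(-t), independently of the
  others, so each mask is removed at total rate e^(-t) / (1 - e^(-t)) = 1 / (e^t - 1), whatever the
  values of \<open>q\<close>. Starting states with masks drop out because \<open>q\<close> vanishes
  there.\<close>

lemma reverse_total_rate:
  assumes t: "0 < t" and y: "y \<in> Y"
  shows "(\<Sum>y'\<in>Y - {y}. Rfwd K d y y' * marg t y') = real (numK K y) / (exp t - 1) * marg t y"
proof -
  have len: "length y = d" using y by (simp add: Ystates_length)
  have et: "exp (- t) = (1 - exp (- t)) / (exp t - 1)"
    using t by (simp add: field_simps exp_minus)
  have "(\<Sum>a\<in>{1..<K}. marg t (y[i := a])) = marg t y / (exp t - 1)" if i: "i < d" "y ! i = K" for i
  proof -
    have "(\<Sum>a\<in>{1..<K}. marg t (y[i := a])) = (\<Sum>x\<in>Y. q x * (\<Sum>a\<in>{1..<K}. transP K d t x (y[i := a])))"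
      unfolding marg_def sum_distrib_left by (rule sum.swap)
    also have "\<dots> = (\<Sum>x\<in>Y. q x * (transP K d t x y / (exp t - 1)))"
    proof (rule sum.cong[OF refl])
      fix x assume x: "x \<in> Y"
      show "q x * (\<Sum>a\<in>{1..<K}. transP K d t x (y[i := a])) = q x * (transP K d t x y / (exp t - 1))"
      proof (cases "numK K x = 0")
        case True
        then have "x ! i \<noteq> K"
          using i(1) x by (auto simp: numK_def filter_empty_conv Ystates_length)
        then have "(\<Sum>a\<in>{1..<K}. transP K d t x (y[i := a])) =
            exp (- t) * (\<Prod>j\<in>{..<d} - {i}. coordP K t (x ! j) (y ! j))"
          unfolding transP_update_right[OF i(1) len] sum_distrib_right[symmetric]
          using sum_coordP[OF Ystates_nth[OF x i(1)]] by simp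
        also have "\<dots> = transP K d t x y / (exp t - 1)"
          unfolding transP_remove[OF i(1), of K t x y] using i \<open>x ! i \<noteq> K\<close>
          by (subst et) (simp add: coordP_def)
        finally show ?thesis by simp
      qed (simp add: q_masked x)
    qed
    also have "\<dots> = marg t y / (exp t - 1)"
      unfolding marg_def by (simp add: sum_divide_distrib)
    finally show ?thesis .
  qed
  then show ?thesis
    unfolding sum_Rfwd_from[OF y] by (simp add: numK_card[OF y])
qed

lemma marg_unmasked:
  assumes "y \<in> Y" "numK K y = 0"
  shows "marg t y = exp (- (real d * t)) * q y"
proof -
  have "marg t y = (\<Sum>x\<in>Y. if x = y then exp (- (real d * t)) * q y else 0)"
    unfolding marg_def by (intro sum.cong) (auto simp: transP_unmasked assms)
  then show ?thesis using assms by simp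
qed

lemma marg_all_masked: "marg t (replicate d K) = (1 - exp (- t)) ^ d"
proof -
  have "marg t (replicate d K) = (\<Sum>x\<in>Y. q x * (1 - exp (- t)) ^ d)"
    unfolding marg_def
  proof (rule sum.cong[OF refl])
    fix x assume x: "x \<in> Y"
    show "q x * transP K d t x (replicate d K) = q x * (1 - exp (- t)) ^ d"
    proof (cases "numK K x = 0")
      case True
      then have "x ! i \<noteq> K" if "i < d" for i
        using x that by (auto simp: numK_def filter_empty_conv Ystates_length)
      then have "transP K d t x (replicate d K) = (\<Prod>i<d. 1 - exp (- t))"
        unfolding transP_def by (intro prod.cong) (auto simp: coordP_def)
      then show ?thesis by simp
    qed (simp add: q_masked x)
  qed
  then show ?thesis using q_sum by (simp flip: sum_distrib_right)
qed

lemma all_masked_in: "replicate d K \<in> Y"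
  using K2 by (auto simp: Ystates_def)

end

section \<open>Score entropy along a window\<close>

lemma Dphi_nonneg: "0 < u \<Longrightarrow> 0 < w \<Longrightarrow> 0 \<le> Dphi u w"
proof -
  assume uw: "0 < u" "0 < w"
  then have "u * ln (w / u) \<le> u * (w / u - 1)"
    by (intro mult_left_mono ln_le_minus_one) auto
  with uw show "0 \<le> Dphi u w" by (simp add: Dphi_def ln_div algebra_simps)
qed

text \<open>A Fenchel-Young inequality: it is the nonnegativity of \<open>Dphi\<close> against the
  tilted rate w e^\<xi>.\<close>

lemma jump_duality:
  assumes "0 < R" "0 < w"
  shows "R * \<xi> - w * (exp \<xi> - 1) \<le> Dphi R w"
  using Dphi_nonneg[of R "w * exp \<xi>"] assms by (simp add: Dphi_def ln_div ln_mult algebra_simps)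

text \<open>Let s be the total estimated rate. Scaling all rates by c = \<beta> / s < 1 changes the
  sum by - (\<Sum> R) ln c - s (1 - c). As \<Sum> R \<le> \<beta> and - ln c \<le> 1 / c - 1, the
  first term is at most \<beta> (1 / c - 1) = s (1 - c).\<close>

lemma Dphi_truncated_le:
  fixes R R' :: "'a \<Rightarrow> real"
  assumes A: "finite A" and R: "\<And>i. i \<in> A \<Longrightarrow> 0 < R i" and R': "\<And>i. i \<in> A \<Longrightarrow> 0 < R' i"
    and le: "(\<Sum>i\<in>A. R i) \<le> \<beta>" and \<beta>: "0 < \<beta>"
  defines "c \<equiv> min 1 (\<beta> / (\<Sum>i\<in>A. R' i))"
  shows "(\<Sum>i\<in>A. Dphi (R i) (R' i * c)) \<le> (\<Sum>i\<in>A. Dphi (R i) (R' i))"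
proof (cases "(\<Sum>i\<in>A. R' i) \<le> \<beta>")
  case True
  show ?thesis
  proof (cases "A = {}")
    case False
    then have "0 < (\<Sum>i\<in>A. R' i)" using A R' by (intro sum_pos)
    then have "c = 1" using True by (simp add: c_def)
    then show ?thesis by simp
  qed simp
next
  case False
  define s where "s = (\<Sum>i\<in>A. R' i)"
  have s: "\<beta> < s" "c = \<beta> / s" using False \<beta> by (auto simp: s_def c_def)
  then have c: "0 < c" using \<beta> by simp
  have "Dphi (R i) (R' i * c) = Dphi (R i) (R' i) - R i * ln c - R' i * (1 - c)" if "i \<in> A" for i
    using R[OF that] R'[OF that] c by (simp add: Dphi_def ln_div ln_mult algebra_simps)
  then have eq: "(\<Sum>i\<in>A. Dphi (R i) (R' i * c)) = (\<Sum>i\<in>A. Dphi (R i) (R' i)) - (\<Sum>i\<in>A. R i) * ln c - s * (1 - c)"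
    by (simp add: sum_subtractf sum_distrib_right s_def)
  have "(\<Sum>i\<in>A. R i) * - ln c \<le> \<beta> * - ln c"
    using le s \<beta> by (intro mult_right_mono) (simp_all add: ln_le_zero_iff)
  also have "\<dots> \<le> \<beta> * (1 / c - 1)"
    using ln_le_minus_one[of "1 / c"] c \<beta> by (intro mult_left_mono) (auto simp: ln_div)
  also have "\<dots> = s * (1 - c)" unfolding s(2) using s(1) \<beta> by (simp add: field_simps)
  finally show ?thesis unfolding eq by simp
qed

lemma sum_offdiag_swap:
  fixes \<phi> :: "'a \<Rightarrow> 'a \<Rightarrow> real"
  assumes "finite A"
  shows "(\<Sum>x\<in>A. \<Sum>y\<in>A - {x}. \<phi> x y) = (\<Sum>x\<in>A. \<Sum>y\<in>A - {x}. \<phi> y x)"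
proof -
  have *: "(\<Sum>y\<in>A - {x}. f y) = (\<Sum>y\<in>A. if y = x then 0 else f y)" for x and f :: "'a \<Rightarrow> real"
    using assms by (intro sum.mono_neutral_cong_left) auto
  have "(\<Sum>x\<in>A. \<Sum>y\<in>A. if y = x then 0 else \<phi> x y) = (\<Sum>y\<in>A. \<Sum>x\<in>A. if y = x then 0 else \<phi> x y)"
    by (rule sum.swap)
  also have "\<dots> = (\<Sum>y\<in>A. \<Sum>x\<in>A. if x = y then 0 else \<phi> x y)"
    by (intro sum.cong) auto
  finally show ?thesis unfolding * .
qed

lemma Rfwd_offdiag_cases:
  assumes "y \<in> Ystates K d" "y' \<in> Ystates K d" "y \<noteq> y'"
  shows "Rfwd K d y y' = 0 \<or> Rfwd K d y y' = 1"
  unfolding Rfwd_offdiag[OF assms] by (auto simp only: of_bool_def split: if_splits)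

section \<open>Loss and truncated rates of the estimator\<close>

locale score_estimator = masked_diffusion +
  fixes T :: real and vt :: "real \<Rightarrow> nat list \<Rightarrow> nat list \<Rightarrow> real"
  assumes vt_pos: "\<And>s y y'. 0 \<le> s \<Longrightarrow> s < T \<Longrightarrow> y \<in> Y \<Longrightarrow> y' \<in> Y \<Longrightarrow> Rfwd K d y y' = 1 \<Longrightarrow> 0 < vt s y y'"
    and vt_meas [measurable]: "\<And>y y'. (\<lambda>s. vt s y y') \<in> borel_measurable borel"
begin

definition state_loss :: "real \<Rightarrow> nat list \<Rightarrow> real" where
  "state_loss s y = (\<Sum>y'\<in>Y - {y}. Rfwd K d y y' * Dphi (marg (T - s) y' / marg (T - s) y) (vt s y y'))"

definition loss_rate :: "real \<Rightarrow> real" where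
  "loss_rate s = (\<Sum>y\<in>Y. marg (T - s) y * state_loss s y)"

lemma state_loss_measurable [measurable]: "(\<lambda>s. state_loss s y) \<in> borel_measurable borel"
  unfolding state_loss_def Dphi_def by measurable

lemma loss_rate_measurable [measurable]: "loss_rate \<in> borel_measurable borel"
  unfolding loss_rate_def by measurable

lemma state_loss_nonneg:
  assumes "0 \<le> s" "s < T" "y \<in> Y"
  shows "0 \<le> state_loss s y"
  unfolding state_loss_def
proof (rule sum_nonneg)
  fix y' assume y': "y' \<in> Y - {y}"
  then have "Rfwd K d y y' = 0 \<or> Rfwd K d y y' = 1"
    using assms by (intro Rfwd_offdiag_cases) auto
  then show "0 \<le> Rfwd K d y y' * Dphi (marg (T - s) y' / marg (T - s) y) (vt s y y')"
    using assms y' vt_pos[of s y y'] by (auto intro!: Dphi_nonneg divide_pos_pos marg_pos)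
qed

lemma loss_rate_nonneg: "0 \<le> s \<Longrightarrow> s < T \<Longrightarrow> 0 \<le> loss_rate s"
  unfolding loss_rate_def by (intro sum_nonneg mult_nonneg_nonneg marg_nonneg state_loss_nonneg) auto

lemma Rtilde_nonneg:
  assumes "0 \<le> s" "s < T" "x \<in> Y" "x' \<in> Y" "x' \<noteq> x"
  shows "0 \<le> Rtilde K d vt s x' x"
  using Rfwd_offdiag_cases[of x K d x'] vt_pos[of s x x'] assms by (auto simp: Rtilde_def)

lemma Rtot_nonneg: "0 \<le> s \<Longrightarrow> s < T \<Longrightarrow> x \<in> Y \<Longrightarrow> 0 \<le> Rtot K d vt s x"
  unfolding Rtot_def by (intro sum_nonneg Rtilde_nonneg) auto

lemma sum_Rhat: "(\<Sum>x'\<in>Y - {x}. Rhat K d vt \<beta> s x' x) = Rtot K d vt s x * min 1 (\<beta> / Rtot K d vt s x)"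
  unfolding Rhat_def Rtot_def by (rule sum_distrib_right[symmetric])

lemma Rhat_nonneg:
  assumes "0 \<le> s" "s < T" "x \<in> Y" "x' \<in> Y" "x' \<noteq> x" "0 < \<beta>"
  shows "0 \<le> Rhat K d vt \<beta> s x' x"
  unfolding Rhat_def using Rtilde_nonneg[OF assms(1-5)] Rtot_nonneg[OF assms(1-3)] assms(6) by simp

lemma stepP_nonneg:
  assumes s: "0 \<le> s" "s < T" and x: "x \<in> Y" "x' \<in> Y" and \<beta>: "0 < \<beta>"
  shows "0 \<le> stepP K d vt \<beta> s x x'"
proof (cases "x' = x")
  case True
  \<comment> \<open>If the total rate is 0, then \<beta> / 0 = 0 makes the truncation factor 0; the
    product is 0 in any case.\<close>
  have "Rtot K d vt s x * min 1 (\<beta> / Rtot K d vt s x) \<le> \<beta>"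
    using Rtot_nonneg[OF s x(1)] \<beta> by (cases "Rtot K d vt s x = 0") (auto simp: min_def field_simps)
  then have "(\<Sum>x'\<in>Y - {x}. Rhat K d vt \<beta> s x' x / \<beta>) \<le> 1"
    using \<beta> by (simp add: sum_divide_distrib[symmetric] sum_Rhat)
  then show ?thesis using True by (simp add: stepP_def)
next
  case False
  then show ?thesis using Rhat_nonneg[OF s x False \<beta>] \<beta> by (simp add: stepP_def)
qed

text \<open>The step is the identity plus 1 / \<beta> times the generator of the truncated rates.
  The identity part is what the mass term of \<open>joint_drift_bound\<close> compensates.\<close>

lemma sum_stepP:
  assumes "x \<in> Y"
  shows "(\<Sum>x'\<in>Y. stepP K d vt \<beta> s x x' * f x') =
    f x + (\<Sum>x'\<in>Y - {x}. Rhat K d vt \<beta> s x' x / \<beta> * (f x' - f x))"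
proof -
  have "(\<Sum>x'\<in>Y. stepP K d vt \<beta> s x x' * f x') = stepP K d vt \<beta> s x x * f x +
      (\<Sum>x'\<in>Y - {x}. stepP K d vt \<beta> s x x' * f x')"
    using assms by (intro sum.remove) auto
  also have "(\<Sum>x'\<in>Y - {x}. stepP K d vt \<beta> s x x' * f x') = (\<Sum>x'\<in>Y - {x}. Rhat K d vt \<beta> s x' x / \<beta> * f x')"
    by (intro sum.cong) (auto simp: stepP_def)
  finally show ?thesis
    by (simp add: stepP_def[of K d vt \<beta> s x x] right_diff_distrib sum_subtractf sum_distrib_right left_diff_distrib)
qed

lemma stepP_measurable [measurable]: "(\<lambda>s. stepP K d vt \<beta> s x x') \<in> borel_measurable borel"
  unfolding stepP_def Rhat_def Rtot_def Rtilde_def by measurable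

text \<open>\<open>jump_duality\<close> on each edge with \<xi> = ln (S x') - ln (S x), so that exp
  \<xi> = S x' / S x, followed by \<open>Dphi_truncated_le\<close>. Through
  \<open>reverse_total_rate\<close> the hypothesis \<open>rate\<close> says that the true total rate
  out of x is at most the cap.\<close>

lemma truncated_rate_bound:
  assumes s: "0 \<le> s" "s < T" and x: "x \<in> Y" and \<beta>: "0 < \<beta>"
    and rate: "real (numK K x) / (exp (T - s) - 1) \<le> \<beta>"
    and S: "\<And>y. y \<in> Y \<Longrightarrow> 0 < S y"
  shows "(\<Sum>x'\<in>Y - {x}. Rfwd K d x x' * (marg (T - s) x' / marg (T - s) x) * (ln (S x') - ln (S x)))
      - (\<Sum>x'\<in>Y - {x}. Rhat K d vt \<beta> s x' x * (S x' / S x - 1)) \<le> state_loss s x"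
proof -
  let ?A = "{x' \<in> Y - {x}. Rfwd K d x x' = 1}"
  let ?v = "\<lambda>x'. marg (T - s) x' / marg (T - s) x"
  let ?c = "min 1 (\<beta> / Rtot K d vt s x)"
  have A: "(\<Sum>x'\<in>Y - {x}. Rfwd K d x x' * f x') = (\<Sum>x'\<in>?A. f x')" for f :: "nat list \<Rightarrow> real"
  proof -
    have "(\<Sum>x'\<in>Y - {x}. Rfwd K d x x' * f x') = (\<Sum>x'\<in>Y - {x}. if Rfwd K d x x' = 1 then f x' else 0)"
      using Rfwd_offdiag_cases[OF x] by (intro sum.cong) force+
    then show ?thesis by (simp only: sum.inter_filter finite_Diff finite_Ystates)
  qed
  have v: "0 < ?v x'" if "x' \<in> ?A" for x'
    using that s x by (auto intro!: divide_pos_pos marg_pos)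
  have w: "0 < vt s x x'" if "x' \<in> ?A" for x'
    using that s x by (intro vt_pos) auto
  have tot: "Rtot K d vt s x = (\<Sum>x'\<in>?A. vt s x x')"
    unfolding Rtot_def Rtilde_def by (rule A)
  have "(\<Sum>x'\<in>?A. ?v x') = real (numK K x) / (exp (T - s) - 1)"
  proof -
    have "(\<Sum>x'\<in>?A. ?v x') = (\<Sum>x'\<in>Y - {x}. Rfwd K d x x' * marg (T - s) x') / marg (T - s) x"
      unfolding A[symmetric] by (simp add: sum_divide_distrib)
    then show ?thesis
      using reverse_total_rate[of "T - s" x] marg_pos[of "T - s" x] s x by simp
  qed
  with rate have v_le: "(\<Sum>x'\<in>?A. ?v x') \<le> \<beta>" by simp
  have cw: "0 < vt s x x' * ?c" if "x' \<in> ?A" for x'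
  proof -
    have "0 < Rtot K d vt s x"
      unfolding tot using that w by (intro sum_pos) auto
    then show ?thesis using w[OF that] \<beta> by simp
  qed
  have "(\<Sum>x'\<in>Y - {x}. Rfwd K d x x' * ?v x' * (ln (S x') - ln (S x)))
      - (\<Sum>x'\<in>Y - {x}. Rhat K d vt \<beta> s x' x * (S x' / S x - 1))
    = (\<Sum>x'\<in>?A. ?v x' * (ln (S x') - ln (S x))) - (\<Sum>x'\<in>?A. vt s x x' * ?c * (S x' / S x - 1))"
    unfolding Rhat_def Rtilde_def A[symmetric] by (simp only: mult.assoc)
  also have "\<dots> = (\<Sum>x'\<in>?A. ?v x' * (ln (S x') - ln (S x)) - vt s x x' * ?c * (exp (ln (S x') - ln (S x)) - 1))"
    unfolding sum_subtractf[symmetric]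
    using S x by (intro sum.cong) (auto simp: exp_diff)
  also have "\<dots> \<le> (\<Sum>x'\<in>?A. Dphi (?v x') (vt s x x' * ?c))"
    by (intro sum_mono jump_duality v cw)
  also have "\<dots> \<le> (\<Sum>x'\<in>?A. Dphi (?v x') (vt s x x'))"
    unfolding tot by (rule Dphi_truncated_le[OF _ v w v_le \<beta>]) auto
  also have "\<dots> = state_loss s x"
    unfolding state_loss_def A ..
  finally show ?thesis .
qed

section \<open>The joint law of window start and current state\<close>

text \<open>With F x = transP (s - a) x z and the marginal at time T - s in place of \<open>\<mu>\<close>, this is the derivative in s
  of the joint law of the reverse chain being in z at time a and in x at time s.\<close>

definition joint_drift :: "(nat list \<Rightarrow> real) \<Rightarrow> (nat list \<Rightarrow> real) \<Rightarrow> nat list \<Rightarrow> real" where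
  "joint_drift \<mu> F x = \<mu> x * ((\<Sum>x'\<in>Y - {x}. Rfwd K d x' x * F x') - (real d - real (numK K x)) * F x)
     - Rapply K d \<mu> x * F x"

text \<open>The diagonal rates of the two Kolmogorov equations cancel. What remains is inflow minus
  outflow of the reverse chain, whose rate from x to x' is the forward rate times \<mu> x' / \<mu>
  x.\<close>

lemma joint_drift_flux:
  assumes x: "x \<in> Y"
  shows "joint_drift \<mu> F x = (\<Sum>x'\<in>Y - {x}. Rfwd K d x' x * \<mu> x * F x') - (\<Sum>x'\<in>Y - {x}. Rfwd K d x x' * \<mu> x' * F x)"
proof -
  have "Rapply K d \<mu> x = Rfwd K d x x * \<mu> x + (\<Sum>x'\<in>Y - {x}. Rfwd K d x x' * \<mu> x')"
    unfolding Rapply_def using x by (intro sum.remove) auto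
  moreover have "(\<Sum>x'\<in>Y - {x}. Rfwd K d x x' * \<mu> x' * F x) = (\<Sum>x'\<in>Y - {x}. Rfwd K d x x' * \<mu> x') * F x"
    by (rule sum_distrib_right[symmetric])
  moreover have "(\<Sum>x'\<in>Y - {x}. Rfwd K d x' x * \<mu> x * F x') = \<mu> x * (\<Sum>x'\<in>Y - {x}. Rfwd K d x' x * F x')"
    unfolding sum_distrib_left by (simp only: mult_ac)
  moreover have "Rfwd K d x x = - (real d - real (numK K x))" by (simp add: Rfwd_def)
  ultimately show ?thesis unfolding joint_drift_def by (simp only: ring_distribs) (simp add: left_diff_distrib right_diff_distrib mult_ac)
qed

text \<open>Summation by parts: relabelling the inflow moves the drift onto \<psi>. For constant
  \<psi> this is conservation of mass.\<close>

lemma sum_joint_drift: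
  "(\<Sum>x\<in>Y. joint_drift \<mu> F x * \<psi> x) = (\<Sum>x\<in>Y. \<Sum>x'\<in>Y - {x}. Rfwd K d x x' * \<mu> x' * F x * (\<psi> x' - \<psi> x))"
proof -
  have "(\<Sum>x\<in>Y. joint_drift \<mu> F x * \<psi> x) =
    (\<Sum>x\<in>Y. \<Sum>x'\<in>Y - {x}. Rfwd K d x' x * \<mu> x * F x' * \<psi> x) - (\<Sum>x\<in>Y. \<Sum>x'\<in>Y - {x}. Rfwd K d x x' * \<mu> x' * F x * \<psi> x)"
    by (subst sum_subtractf[symmetric], intro sum.cong refl)
      (simp only: joint_drift_flux left_diff_distrib sum_distrib_right)
  also have "(\<Sum>x\<in>Y. \<Sum>x'\<in>Y - {x}. Rfwd K d x' x * \<mu> x * F x' * \<psi> x) = (\<Sum>x\<in>Y. \<Sum>x'\<in>Y - {x}. Rfwd K d x x' * \<mu> x' * F x * \<psi> x')"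
    by (rule sum_offdiag_swap) simp
  finally show ?thesis by (simp add: right_diff_distrib sum_subtractf)
qed

text \<open>The identity part of \<open>stepP\<close> contributes - \<beta> times the mass, which
  the mass term on the left offsets. States with F x = 0 contribute nothing, so the comparison of
  rates is demanded only on the support of F.\<close>

lemma joint_drift_bound:
  fixes F S :: "nat list \<Rightarrow> real"
  assumes s: "0 \<le> s" "s < T" and \<beta>: "0 < \<beta>"
    and F: "\<And>x. x \<in> Y \<Longrightarrow> 0 \<le> F x"
    and rate: "\<And>x. x \<in> Y \<Longrightarrow> F x \<noteq> 0 \<Longrightarrow> real (numK K x) / (exp (T - s) - 1) \<le> \<beta>"
    and S: "\<And>x. x \<in> Y \<Longrightarrow> 0 < S x"
  shows "(\<Sum>x\<in>Y. joint_drift (marg (T - s)) F x * ln (S x)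
       - marg (T - s) x * F x * (\<beta> * (\<Sum>x'\<in>Y. stepP K d vt \<beta> s x x' * S x')) / S x)
     + \<beta> * (\<Sum>x\<in>Y. marg (T - s) x * F x)
    \<le> (\<Sum>x\<in>Y. marg (T - s) x * F x * state_loss s x)"
proof -
  let ?m = "marg (T - s)"
  have "(\<Sum>x'\<in>Y - {x}. Rfwd K d x x' * ?m x' * F x * (ln (S x') - ln (S x)))
      - ?m x * F x * (\<beta> * (\<Sum>x'\<in>Y. stepP K d vt \<beta> s x x' * S x')) / S x + \<beta> * (?m x * F x)
    \<le> ?m x * F x * state_loss s x" if x: "x \<in> Y" for x
  proof (cases "F x = 0")
    case False
    have m: "0 < ?m x" using s x by (intro marg_pos) auto
    note Sx = S[OF x]
    let ?U = "\<Sum>x'\<in>Y. stepP K d vt \<beta> s x x' * S x'"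
    let ?P = "\<Sum>x'\<in>Y - {x}. Rfwd K d x x' * (?m x' / ?m x) * (ln (S x') - ln (S x))"
    let ?Q = "\<Sum>x'\<in>Y - {x}. Rhat K d vt \<beta> s x' x * (S x' / S x - 1)"
    have e1: "(\<Sum>x'\<in>Y - {x}. Rfwd K d x x' * ?m x' * F x * (ln (S x') - ln (S x))) =
       ?m x * F x * (\<Sum>x'\<in>Y - {x}. Rfwd K d x x' * (?m x' / ?m x) * (ln (S x') - ln (S x)))"
      unfolding sum_distrib_left using m by (intro sum.cong) (auto simp: field_simps)
    have e2: "\<beta> * ?U / S x = \<beta> +
        (\<Sum>x'\<in>Y - {x}. Rhat K d vt \<beta> s x' x * (S x' / S x - 1))"
    proof -
      have "\<beta> * ?U / S x = \<beta> +
          (\<Sum>x'\<in>Y - {x}. \<beta> * (Rhat K d vt \<beta> s x' x / \<beta> * (S x' - S x)) / S x)"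
        unfolding sum_stepP[OF x] using Sx
        by (simp add: ring_distribs add_divide_distrib sum_distrib_left sum_divide_distrib)
      also have "(\<Sum>x'\<in>Y - {x}. \<beta> * (Rhat K d vt \<beta> s x' x / \<beta> * (S x' - S x)) / S x) = ?Q"
        using Sx \<beta> by (intro sum.cong) (auto simp: field_simps)
      finally show ?thesis .
    qed
    have "(\<Sum>x'\<in>Y - {x}. Rfwd K d x x' * ?m x' * F x * (ln (S x') - ln (S x)))
        - ?m x * F x * (\<beta> * ?U) / S x + \<beta> * (?m x * F x)
      = ?m x * F x * ?P - ?m x * F x * (\<beta> * ?U / S x) + \<beta> * (?m x * F x)"
      unfolding e1 by simp
    also have "\<dots> = ?m x * F x * (?P - ?Q)"
      unfolding e2 by (simp only: ring_distribs mult.commute[of \<beta>])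
    also have "\<dots> \<le> ?m x * F x * state_loss s x"
      using m F[OF x] by (intro mult_left_mono truncated_rate_bound s x \<beta> rate False S) auto
    finally show ?thesis .
  qed simp
  then have "(\<Sum>x\<in>Y. (\<Sum>x'\<in>Y - {x}. Rfwd K d x x' * ?m x' * F x * (ln (S x') - ln (S x)))
      - ?m x * F x * (\<beta> * (\<Sum>x'\<in>Y. stepP K d vt \<beta> s x x' * S x')) / S x + \<beta> * (?m x * F x))
    \<le> (\<Sum>x\<in>Y. ?m x * F x * state_loss s x)"
    by (intro sum_mono) auto
  then show ?thesis
    unfolding sum_subtractf sum.distrib sum_distrib_left sum_joint_drift by (simp add: sum_distrib_left)
qed


lemma joint_law_deriv:
  assumes x: "x \<in> Y"
  shows "((\<lambda>s. marg (T - s) x * transP K d (s - a) x z) has_real_derivative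
    joint_drift (marg (T - s)) (\<lambda>x. transP K d (s - a) x z) x) (at s)"
proof -
  have 1: "((\<lambda>s. marg (T - s) x) has_real_derivative Rapply K d (marg (T - s)) x * (- 1)) (at s)"
    by (rule DERIV_chain2[OF marg_deriv[OF x]]) (auto intro!: derivative_eq_intros)
  have K: "1 \<le> K" using K2 by simp
  have 2: "((\<lambda>s. transP K d (s - a) x z) has_real_derivative
     ((\<Sum>x'\<in>Y - {x}. Rfwd K d x' x * transP K d (s - a) x' z) - (real d - real (numK K x)) * transP K d (s - a) x z) * 1) (at s)"
    by (rule DERIV_chain2[OF transP_deriv_backward[OF x K]]) (auto intro!: derivative_eq_intros)
  show ?thesis
    using DERIV_mult[OF 1 2] by (simp add: joint_drift_def algebra_simps)
qed

text \<open>Chapman-Kolmogorov by differentiation: the mass does not change with s, and at s = a the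
  transition is the identity.\<close>

lemma joint_law_mass:
  assumes z: "z \<in> Y"
  shows "(\<Sum>x\<in>Y. marg (T - s) x * transP K d (s - a) x z) = marg (T - a) z"
proof -
  let ?f = "\<lambda>s. \<Sum>x\<in>Y. marg (T - s) x * transP K d (s - a) x z"
  have "(?f has_real_derivative 0) (at s)" for s
  proof -
    have "(?f has_real_derivative (\<Sum>x\<in>Y. joint_drift (marg (T - s)) (\<lambda>x. transP K d (s - a) x z) x)) (at s)"
      by (intro DERIV_sum joint_law_deriv)
    then show ?thesis
      using sum_joint_drift[of "marg (T - s)" "\<lambda>x. transP K d (s - a) x z" "\<lambda>_. 1"] by simp
  qed
  then have "?f s = ?f a" by (intro DERIV_isconst_all) blast
  also have "?f a = (\<Sum>x\<in>Y. if x = z then marg (T - a) z else 0)"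
    by (intro sum.cong) (auto simp: transP_0 z)
  finally show ?thesis using z by simp
qed

text \<open>The share of the loss at time s carried by the reverse paths that were in z at time a.
  Each z needs its own share because \<beta> depends on z.\<close>

definition start_loss :: "real \<Rightarrow> nat list \<Rightarrow> real \<Rightarrow> real" where
  "start_loss a z s = (\<Sum>x\<in>Y. marg (T - s) x * transP K d (s - a) x z * state_loss s x)"

lemma start_loss_nonneg: "0 \<le> a \<Longrightarrow> a \<le> s \<Longrightarrow> s < T \<Longrightarrow> 0 \<le> start_loss a z s"
  unfolding start_loss_def
  by (intro sum_nonneg mult_nonneg_nonneg marg_nonneg transP_nonneg state_loss_nonneg) auto

text \<open>The estimator gives no pointwise bound in time, but transition probabilities are at most
  1, so the full loss dominates.\<close>

lemma start_loss_integrable_on: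
  assumes ab: "0 \<le> a" "b < T" and int: "set_integrable lborel {a..b} loss_rate"
  shows "start_loss a z integrable_on {a..b}"
proof (rule set_borel_integral_eq_integral(1))
  show "set_integrable lborel {a..b} (start_loss a z)"
    unfolding set_integrable_def
  proof (rule Bochner_Integration.integrable_bound[OF int[unfolded set_integrable_def]])
    show "(\<lambda>s. indicator {a..b} s *\<^sub>R start_loss a z s) \<in> borel_measurable lborel"
      unfolding start_loss_def by measurable
    have "start_loss a z s \<le> loss_rate s" if "s \<in> {a..b}" for s
      unfolding start_loss_def loss_rate_def
      using that ab transP_le_1[of "s - a"]
      by (intro sum_mono mult_right_mono state_loss_nonneg) (auto intro!: mult_left_le marg_nonneg)
    then show "AE s in lborel. norm (indicator {a..b} s *\<^sub>R start_loss a z s) \<le> norm (indicator {a..b} s *\<^sub>R loss_rate s)"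
      using start_loss_nonneg[of a] ab by (intro AE_I2) (force split: split_indicator)
  qed
qed

lemma sum_start_loss: "(\<Sum>z\<in>Y. start_loss a z s) = loss_rate s"
proof -
  have "(\<Sum>z\<in>Y. start_loss a z s) = (\<Sum>x\<in>Y. marg (T - s) x * state_loss s x * (\<Sum>z\<in>Y. transP K d (s - a) x z))"
    unfolding start_loss_def sum_distrib_left by (subst sum.swap) (simp add: mult_ac)
  then show ?thesis by (simp add: transP_sum loss_rate_def)
qed

text \<open>\<open>weighted_log_increment\<close> is applied with the joint law as the weight J: at
  s = a all mass sits at z, at s = b the terminal function appears. The increments are summed over x
  before the integrand is estimated, since only the sum obeys
  \<open>joint_drift_bound\<close>.\<close>

lemma window_entropy:
  assumes W: "jump_kernel Y p h 1 M a b"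
    and p: "\<And>s x x'. s \<in> {a..b} \<Longrightarrow> x \<in> Y \<Longrightarrow> x' \<in> Y \<Longrightarrow> p s x x' = stepP K d vt \<beta> s x x'"
    and \<beta>: "0 < \<beta>" "\<beta> = real K * real (numK K z) / (exp (T - b) - 1)"
    and ab: "0 \<le> a" "b < T" and z: "z \<in> Y"
    and int: "set_integrable lborel {a..b} loss_rate"
  shows "(\<Sum>x\<in>Y. marg (T - b) x * transP K d (b - a) x z * ln (h x))
      - marg (T - a) z * ln (exp (- (\<beta> * (b - a))) * jump_kernel.S Y p h a b \<beta> a z)
    \<le> integral {a..b} (start_loss a z)"
proof -
  interpret W: jump_kernel Y p h 1 M a b by (rule W)
  have \<beta>0: "0 \<le> \<beta>" using \<beta> by simp
  define S where "S = W.S \<beta>"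
  note S_lower = W.S_lower[OF \<beta>0, folded S_def] and S_upper = W.S_upper[OF \<beta>0, folded S_def]
    and S_eq = W.S_integral_equation[OF \<beta>0, folded S_def]
  have S_meas [measurable]: "(\<lambda>s. S s x) \<in> borel_measurable borel" for x
    unfolding S_def by (rule W.S_measurable[OF \<beta>0])
  have S_pos: "0 < S s x" if "x \<in> Y" for s x using S_lower[OF that, of s] by simp
  define g where "g x r = \<beta> * (\<Sum>x'\<in>Y. p r x x' * S r x')" for x r
  define J where "J x s = marg (T - s) x * transP K d (s - a) x z" for x s
  define j where "j x s = joint_drift (marg (T - s)) (\<lambda>x. transP K d (s - a) x z) x" for x s
  have ab': "a < b" by (rule W.ab)
  have J_nonneg: "0 \<le> J x s" if "s \<in> {a..b}" "x \<in> Y" for x s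
    unfolding J_def using that ab by (intro mult_nonneg_nonneg marg_nonneg transP_nonneg) auto
  have bnd: "\<bar>g x r\<bar> \<le> \<beta> * (M * exp (\<beta> * (b - a)))" if "x \<in> Y" for x r
  proof -
    have "1 \<le> (\<Sum>x'\<in>Y. p r x x' * S r x')" "(\<Sum>x'\<in>Y. p r x x' * S r x') \<le> M * exp (\<beta> * (b - a))"
      by (rule W.p_average_bounds[OF that S_lower S_upper]; assumption)+
    then show ?thesis unfolding g_def using \<beta>0 by (simp add: abs_mult mult_left_mono)
  qed
  have g_meas: "g x \<in> borel_measurable borel" for x
    unfolding g_def by measurable
  have cont: "continuous_on UNIV (\<lambda>s. marg (T - s) x)" "continuous_on UNIV (\<lambda>s. transP K d (s - a) x z)" for x
    by (rule continuous_on_compose2[OF marg_continuous[of UNIV] _ subset_UNIV], intro continuous_intros)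
       (rule continuous_on_compose2[OF transP_continuous[of UNIV] _ subset_UNIV], intro continuous_intros)
  have j_cont: "continuous_on UNIV (j x)" for x
    unfolding j_def joint_drift_def Rapply_def by (intro continuous_intros cont)
  have incr: "(\<lambda>r. j x r * ln (S r x) - J x r * g x r / S r x) integrable_on {a..b}"
    "J x b * ln (S b x) - J x a * ln (S a x) \<le> integral {a..b} (\<lambda>r. j x r * ln (S r x) - J x r * g x r / S r x)"
    if x: "x \<in> Y" for x
  proof -
    have S_eq': "S s x = h x + integral {s..b} (g x)" if "s \<in> {a..b}" for s
      unfolding g_def by (simp add: S_eq[OF x that])
    have J_deriv: "(J x has_real_derivative j x s) (at s)" for s
      unfolding J_def j_def by (rule joint_law_deriv[OF x])
    note * = weighted_log_increment[OF less_imp_le[OF ab'] g_meas bnd[OF x] S_meas S_eq' zero_less_one S_lower[OF x] S_upper[OF x]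
        J_deriv j_cont J_nonneg[OF _ x]]
    show "(\<lambda>r. j x r * ln (S r x) - J x r * g x r / S r x) integrable_on {a..b}"
      "J x b * ln (S b x) - J x a * ln (S a x) \<le> integral {a..b} (\<lambda>r. j x r * ln (S r x) - J x r * g x r / S r x)"
      by (rule *; assumption)+
  qed
  \<comment> \<open>Integrated over the window, this mass term becomes \<beta> (b - a) times the
    mass of z: up to sign, the weighted logarithm of the Poisson factor missing from S.\<close>
  let ?c = "\<beta> * marg (T - a) z"
  have pointwise: "(\<Sum>x\<in>Y. j x r * ln (S r x) - J x r * g x r / S r x) \<le> start_loss a z r - ?c"
    if r: "r \<in> {a..b}" for r
  proof -
    have rT: "0 \<le> r" "r < T" using r ab by auto
    have g: "g x r = \<beta> * (\<Sum>x'\<in>Y. stepP K d vt \<beta> r x x' * S r x')" if "x \<in> Y" for x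
      unfolding g_def using p[OF r that] by simp
    have "(\<Sum>x\<in>Y. j x r * ln (S r x) - J x r * g x r / S r x) + \<beta> * (\<Sum>x\<in>Y. J x r) =
      (\<Sum>x\<in>Y. joint_drift (marg (T - r)) (\<lambda>x. transP K d (r - a) x z) x * ln (S r x)
       - marg (T - r) x * transP K d (r - a) x z * (\<beta> * (\<Sum>x'\<in>Y. stepP K d vt \<beta> r x x' * S r x')) / S r x)
       + \<beta> * (\<Sum>x\<in>Y. marg (T - r) x * transP K d (r - a) x z)"
      unfolding j_def J_def by (intro arg_cong2[where f = "(+)"] sum.cong refl) (simp add: g)
    also have "\<dots> \<le> start_loss a z r"
      unfolding start_loss_def
    proof (rule joint_drift_bound[OF rT \<beta>(1)])
      fix x assume x: "x \<in> Y"
      show "0 \<le> transP K d (r - a) x z" using r by (intro transP_nonneg) auto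
      show "0 < S r x" by (rule S_pos[OF x])
      \<comment> \<open>On the support x has at most as many masks as z, and 1 / (exp (T - r) - 1)
        is largest at the end of the window, where \<beta> is evaluated.\<close>
      assume "transP K d (r - a) x z \<noteq> 0"
      then have "numK K x \<le> numK K z" by (rule transP_numK_mono[OF x z])
      also have "\<dots> \<le> K * numK K z" using K2 by simp
      finally have "real (numK K x) \<le> real K * real (numK K z)" by (metis of_nat_le_iff of_nat_mult)
      moreover have "exp (T - b) \<le> exp (T - r)" "1 < exp (T - b)" using r ab by auto
      ultimately show "real (numK K x) / (exp (T - r) - 1) \<le> \<beta>"
        unfolding \<beta>(2) by (intro frac_le) auto
    qed
    finally show ?thesis
      using joint_law_mass[OF z, of r a] by (simp add: J_def)
  qed
  have "(\<Sum>x\<in>Y. J x b * ln (S b x) - J x a * ln (S a x)) \<le>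
      (\<Sum>x\<in>Y. integral {a..b} (\<lambda>r. j x r * ln (S r x) - J x r * g x r / S r x))"
    by (intro sum_mono incr)
  also have "\<dots> = integral {a..b} (\<lambda>r. \<Sum>x\<in>Y. j x r * ln (S r x) - J x r * g x r / S r x)"
    by (intro integral_sum[symmetric] incr) auto
  also have "\<dots> \<le> integral {a..b} (\<lambda>r. start_loss a z r - ?c)"
    by (intro integral_le integrable_sum incr integrable_diff integrable_const_ivl
        start_loss_integrable_on[OF ab int] pointwise) auto
  also have "\<dots> = integral {a..b} (start_loss a z) - ?c * (b - a)"
    using ab' by (subst Henstock_Kurzweil_Integration.integral_diff)
      (auto intro: start_loss_integrable_on[OF ab int])
  finally have main: "(\<Sum>x\<in>Y. J x b * ln (S b x)) - (\<Sum>x\<in>Y. J x a * ln (S a x))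
      \<le> integral {a..b} (start_loss a z) - ?c * (b - a)"
    by (simp add: sum_subtractf)
  have "S b x = h x" if "x \<in> Y" for x
    using S_eq[OF that, of b] ab' by simp
  then have e1: "(\<Sum>x\<in>Y. J x b * ln (S b x)) = (\<Sum>x\<in>Y. marg (T - b) x * transP K d (b - a) x z * ln (h x))"
    by (intro sum.cong) (simp_all add: J_def)
  have "(\<Sum>x\<in>Y. J x a * ln (S a x)) = (\<Sum>x\<in>Y. if x = z then marg (T - a) z * ln (S a z) else 0)"
    by (intro sum.cong) (auto simp: J_def transP_0 z)
  then have e2: "(\<Sum>x\<in>Y. J x a * ln (S a x)) = marg (T - a) z * ln (S a z)"
    using z by simp
  have e3: "ln (exp (- (\<beta> * (b - a))) * S a z) = ln (S a z) - \<beta> * (b - a)"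
    using S_pos[OF z, of a] by (simp add: ln_mult)
  show ?thesis
    using main unfolding e1 e2 S_def[symmetric] e3 by (simp add: algebra_simps)
qed


section \<open>One window of the algorithm\<close>

text \<open>Outside the window the estimator need not be positive, so the kernel is made trivial there.\<close>

definition cutP :: "real \<Rightarrow> real \<Rightarrow> real \<Rightarrow> real \<Rightarrow> nat list \<Rightarrow> nat list \<Rightarrow> real" where
  "cutP \<beta> a b s x x' = (if s \<in> {a..b} then stepP K d vt \<beta> s x x' else of_bool (x = x'))"

lemma cutP_jump_kernel:
  assumes "0 \<le> a" "a < b" "b < T" "0 < \<beta>" "0 \<le> m"
    and "\<And>x. x \<in> Y \<Longrightarrow> m \<le> h x" "\<And>x. x \<in> Y \<Longrightarrow> h x \<le> M"
  shows "jump_kernel Y (cutP \<beta> a b) h m M a b"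
proof unfold_locales
  fix s x x' assume x: "x \<in> Y" and x': "x' \<in> Y"
  show "0 \<le> cutP \<beta> a b s x x'"
    unfolding cutP_def using assms x x' by (auto intro: stepP_nonneg)
next
  fix s x assume x: "x \<in> Y"
  show "(\<Sum>x'\<in>Y. cutP \<beta> a b s x x') = 1"
  proof (cases "s \<in> {a..b}")
    case True
    then show ?thesis
      using sum_stepP[OF x, of \<beta> s "\<lambda>_. 1"] by (simp add: cutP_def)
  next
    case False
    then have "(\<Sum>x'\<in>Y. cutP \<beta> a b s x x') = (\<Sum>x'\<in>Y. if x = x' then 1 else 0)"
      by (intro sum.cong) (auto simp: cutP_def)
    then show ?thesis using x by simp
  qed
next
  show "(\<lambda>s. cutP \<beta> a b s x x') \<in> borel_measurable borel" for x x'
    unfolding cutP_def by measurable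
qed (use assms in auto)

lemma step_kernel_stepP: "step_kernel Y (stepP K d vt \<beta>)"
  by unfold_locales auto

lemma runP_eq_run: "runP K d vt \<beta> ss z y = step_kernel.run Y (stepP K d vt \<beta>) (\<lambda>x. of_bool (x = y)) ss z"
proof -
  interpret step_kernel Y "stepP K d vt \<beta>" "\<lambda>x. of_bool (x = y)" by (rule step_kernel_stepP)
  show ?thesis by (induction ss arbitrary: z) auto
qed

text \<open>\<open>windowP\<close> is given entry by entry, through runs that end in an indicator of
  y. Runs are linear in the terminal function, so weighting the entries by h gives the run with
  terminal function h.\<close>

lemma windowP_average:
  fixes t :: "nat \<Rightarrow> real" and w :: nat and z :: "nat list"
  defines "a \<equiv> t (w - 1)" and "b \<equiv> t w"
  assumes ab: "0 \<le> a" "a < b" "b < T" and z: "z \<in> Y"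
    and h: "\<And>x. x \<in> Y \<Longrightarrow> 1 \<le> h x" "\<And>x. x \<in> Y \<Longrightarrow> h x \<le> M"
  defines "\<beta> \<equiv> betaw K T t w z"
  assumes \<beta>: "0 < \<beta>"
  shows "(\<Sum>y\<in>Y. windowP K d vt T t w z y * h y) = exp (- (\<beta> * (b - a))) * jump_kernel.S Y (cutP \<beta> a b) h a b \<beta> a z"
proof -
  interpret W: jump_kernel Y "cutP \<beta> a b" h 1 M a b
    using ab \<beta> h by (intro cutP_jump_kernel) auto
  have U: "jump_kernel Y (cutP \<beta> a b) (\<lambda>x. of_bool (x = y)) 0 1 a b" for y
    using ab \<beta> by (intro cutP_jump_kernel) auto
  have U': "step_kernel Y (cutP \<beta> a b)" by (rule W.step_kernel_axioms)
  have \<beta>0: "0 \<le> \<beta>" using \<beta> by simp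
  let ?P = "\<lambda>n. PiM {..<n::nat} (\<lambda>_. uniform_measure lborel {a..b})"
  let ?r = "\<lambda>y. step_kernel.run Y (cutP \<beta> a b) (\<lambda>x. of_bool (x = y))"
  let ?I = "\<lambda>n y. \<integral>\<omega>. ?r y (sort (map \<omega> [0..<n])) z \<partial>(?P n)"
  have run: "W.run ss x = (\<Sum>y\<in>Y. ?r y ss x * h y)" if "x \<in> Y" for ss x
    using that
  proof (induction ss arbitrary: x)
    case Nil
    have "(\<Sum>y\<in>Y. ?r y [] x * h y) = (\<Sum>y\<in>Y. if x = y then h y else 0)"
      by (intro sum.cong) (auto simp: step_kernel.run.simps[OF U'])
    then show ?case using Nil by simp
  next
    case (Cons s ss)
    have "(\<Sum>y\<in>Y. ?r y (s # ss) x * h y) = (\<Sum>y\<in>Y. \<Sum>x'\<in>Y. cutP \<beta> a b s x x' * (?r y ss x' * h y))"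
      by (simp add: step_kernel.run.simps[OF U'] sum_distrib_right mult.assoc)
    also have "\<dots> = (\<Sum>x'\<in>Y. cutP \<beta> a b s x x' * (\<Sum>y\<in>Y. ?r y ss x' * h y))"
      unfolding sum_distrib_left by (rule sum.swap)
    finally show ?case using Cons.IH by simp
  qed
  have int: "(\<integral>\<omega>. W.run (sort (map \<omega> [0..<n])) z \<partial>(?P n)) = (\<Sum>y\<in>Y. ?I n y * h y)" for n
    unfolding run[OF z]
    by (subst Bochner_Integration.integral_sum)
      (auto intro!: integrable_mult_left jump_kernel.integrable_run[OF U z])
  have window: "windowP K d vt T t w z y = (\<Sum>n. poissonP (\<beta> * (b - a)) n * ?I n y)" for y
  proof -
    have "(\<integral>\<omega>. step_kernel.run Y (stepP K d vt \<beta>) (\<lambda>x. of_bool (x = y)) (sort (map \<omega> [0..<n])) z \<partial>(?P n)) = ?I n y" for n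
      by (rule jump_kernel.integral_run_cong[OF U step_kernel_stepP _ z]) (simp add: cutP_def)
    then show ?thesis
      unfolding windowP_def Let_def runP_eq_run \<beta>_def[symmetric] a_def[symmetric] b_def[symmetric] by simp
  qed
  have summ: "summable (\<lambda>n. poissonP (\<beta> * (b - a)) n * ?I n y)" for y
    by (rule jump_kernel.poisson_summable[OF U \<beta>0 z])
  have "(\<Sum>y\<in>Y. windowP K d vt T t w z y * h y) = (\<Sum>y\<in>Y. \<Sum>n. poissonP (\<beta> * (b - a)) n * ?I n y * h y)"
    unfolding window by (simp add: suminf_mult2[OF summ])
  also have "\<dots> = (\<Sum>n. \<Sum>y\<in>Y. poissonP (\<beta> * (b - a)) n * ?I n y * h y)"
    by (intro suminf_sum[symmetric] summable_mult2 summ)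
  also have "\<dots> = (\<Sum>n. poissonP (\<beta> * (b - a)) n * (\<integral>\<omega>. W.run (sort (map \<omega> [0..<n])) z \<partial>(?P n)))"
    unfolding int by (simp add: sum_distrib_left mult.assoc)
  also have "\<dots> = exp (- (\<beta> * (b - a))) * W.S \<beta> a z"
    by (rule W.poisson_average[OF \<beta>0 z])
  finally show ?thesis .
qed

text \<open>Treated apart because the rate is 0 and \<open>stepP\<close> would divide by it. The
  Poisson weights with 0 ^ 0 = 1 put all mass on the empty run.\<close>

lemma windowP_unmasked:
  assumes "numK K z = 0"
  shows "windowP K d vt T t w z y = of_bool (y = z)"
proof -
  interpret prob_space "PiM {} (\<lambda>_::nat. uniform_measure lborel {t (w - 1)..t w})"
    by (intro prob_space_PiM) auto
  have "windowP K d vt T t w z y = (\<Sum>n. if n = 0 then of_bool (y = z) else 0)"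
    unfolding windowP_def Let_def
  proof (rule arg_cong[where f = suminf], rule ext)
    fix n
    show "poissonP (betaw K T t w z * (t w - t (w - 1))) n *
        (\<integral>taus. runP K d vt (betaw K T t w z) (sort (map taus [0..<n])) z y
          \<partial>(PiM {..<n} (\<lambda>_. uniform_measure lborel {t (w - 1)..t w}))) = (if n = 0 then of_bool (y = z) else 0)"
      using assms prob_space by (cases "n = 0") (auto simp: betaw_def poissonP_def)
  qed
  also have "\<dots> = of_bool (y = z)"
    using suminf_finite[of "{0::nat}" "\<lambda>n. if n = 0 then of_bool (y = z) else (0::real)"] by simp
  finally show ?thesis .
qed

lemma window_step:
  fixes t :: "nat \<Rightarrow> real" and w :: nat and h :: "nat list \<Rightarrow> real"
  assumes ab: "0 \<le> t (w - 1)" "t (w - 1) < t w" "t w < T"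
    and h: "\<And>x. x \<in> Y \<Longrightarrow> 1 \<le> h x" "\<And>x. x \<in> Y \<Longrightarrow> h x \<le> M"
    and int: "set_integrable lborel {t (w - 1)..t w} loss_rate"
  defines "h' \<equiv> \<lambda>z. \<Sum>y\<in>Y. windowP K d vt T t w z y * h y"
  shows "\<And>z. z \<in> Y \<Longrightarrow> 1 \<le> h' z" "\<And>z. z \<in> Y \<Longrightarrow> h' z \<le> M"
    and "(\<Sum>z\<in>Y. marg (T - t w) z * ln (h z)) - (\<Sum>z\<in>Y. marg (T - t (w - 1)) z * ln (h' z))
      \<le> integral {t (w - 1)..t w} loss_rate"
proof -
  let ?a = "t (w - 1)" and ?b = "t w"
  have main: "(1 \<le> h' z \<and> h' z \<le> M) \<and>
     (\<Sum>x\<in>Y. marg (T - ?b) x * transP K d (?b - ?a) x z * ln (h x)) - marg (T - ?a) z * ln (h' z)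
     \<le> integral {?a..?b} (start_loss ?a z)" if z: "z \<in> Y" for z
  proof (cases "numK K z = 0")
    case True
    have h': "h' z = h z"
    proof -
      have "h' z = (\<Sum>y\<in>Y. if y = z then h y else 0)"
        unfolding h'_def by (intro sum.cong) (auto simp: windowP_unmasked[OF True])
      then show ?thesis using z by simp
    qed
    \<comment> \<open>From a fully unmasked z the reverse chain cannot move, so the same mass
      multiplies ln (h z) at both ends of the window and the difference vanishes.\<close>
    have "(\<Sum>x\<in>Y. marg (T - ?b) x * transP K d (?b - ?a) x z * ln (h x)) =
        (\<Sum>x\<in>Y. if x = z then marg (T - ?b) z * exp (- (real d * (?b - ?a))) * ln (h z) else 0)"
      by (intro sum.cong) (auto simp: transP_unmasked[OF z True])
    also have "\<dots> = marg (T - ?b) z * exp (- (real d * (?b - ?a))) * ln (h z)"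
      using z by simp
    also have "marg (T - ?b) z * exp (- (real d * (?b - ?a))) = marg (T - ?a) z"
      unfolding marg_unmasked[OF z True] by (simp add: algebra_simps flip: exp_add)
    finally have "(\<Sum>x\<in>Y. marg (T - ?b) x * transP K d (?b - ?a) x z * ln (h x)) - marg (T - ?a) z * ln (h' z) = 0"
      by (simp add: h')
    moreover have "0 \<le> integral {?a..?b} (start_loss ?a z)"
      using ab by (intro Henstock_Kurzweil_Integration.integral_nonneg start_loss_integrable_on int start_loss_nonneg) auto
    ultimately show ?thesis using h[OF z] h' by simp
  next
    case False
    define \<beta> where "\<beta> = betaw K T t w z"
    have \<beta>: "0 < \<beta>" "\<beta> = real K * real (numK K z) / (exp (T - ?b) - 1)"
      using False K2 ab by (auto simp: \<beta>_def betaw_def intro!: divide_pos_pos)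
    have W: "jump_kernel Y (cutP \<beta> ?a ?b) h 1 M ?a ?b"
      using ab \<beta> h by (intro cutP_jump_kernel) auto
    have h': "h' z = exp (- (\<beta> * (?b - ?a))) * jump_kernel.S Y (cutP \<beta> ?a ?b) h ?a ?b \<beta> ?a z"
      unfolding h'_def \<beta>_def
      by (rule windowP_average[OF ab z h]) (use \<beta> in \<open>simp_all add: \<beta>_def\<close>)
    have "1 \<le> h' z" "h' z \<le> M"
      unfolding h' by (rule jump_kernel.poisson_average_bounds[OF W less_imp_le[OF \<beta>(1)] z])+
    moreover have "(\<Sum>x\<in>Y. marg (T - ?b) x * transP K d (?b - ?a) x z * ln (h x)) - marg (T - ?a) z * ln (h' z)
     \<le> integral {?a..?b} (start_loss ?a z)"
      unfolding h' by (rule window_entropy[OF W _ \<beta> ab(1,3) z int]) (simp add: cutP_def)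
    ultimately show ?thesis by blast
  qed
  then show "\<And>z. z \<in> Y \<Longrightarrow> 1 \<le> h' z" "\<And>z. z \<in> Y \<Longrightarrow> h' z \<le> M" by blast+
  have "(\<Sum>z\<in>Y. (\<Sum>x\<in>Y. marg (T - ?b) x * transP K d (?b - ?a) x z * ln (h x)) - marg (T - ?a) z * ln (h' z))
     \<le> (\<Sum>z\<in>Y. integral {?a..?b} (start_loss ?a z))"
    using main by (intro sum_mono) blast
  also have "\<dots> = integral {?a..?b} (\<lambda>s. \<Sum>z\<in>Y. start_loss ?a z s)"
    using ab by (intro integral_sum[symmetric] start_loss_integrable_on int) auto
  also have "\<dots> = integral {?a..?b} loss_rate" by (simp add: sum_start_loss)
  finally have le: "(\<Sum>z\<in>Y. \<Sum>x\<in>Y. marg (T - ?b) x * transP K d (?b - ?a) x z * ln (h x)) - (\<Sum>z\<in>Y. marg (T - ?a) z * ln (h' z))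
     \<le> integral {?a..?b} loss_rate"
    by (simp only: sum_subtractf)
  \<comment> \<open>Summing over the window start forgets it: the transition probabilities out of x
    add up to 1, and the marginal at the window end remains.\<close>
  have "(\<Sum>z\<in>Y. \<Sum>x\<in>Y. marg (T - ?b) x * transP K d (?b - ?a) x z * ln (h x)) =
      (\<Sum>x\<in>Y. marg (T - ?b) x * ln (h x) * (\<Sum>z\<in>Y. transP K d (?b - ?a) x z))"
    unfolding sum_distrib_left by (subst sum.swap) (simp add: mult_ac)
  also have "\<dots> = (\<Sum>x\<in>Y. marg (T - ?b) x * ln (h x))" by (simp add: transP_sum)
  finally show "(\<Sum>z\<in>Y. marg (T - ?b) z * ln (h z)) - (\<Sum>z\<in>Y. marg (T - ?a) z * ln (h' z))
      \<le> integral {?a..?b} loss_rate"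
    using le by simp
qed

text \<open>The last window is absorbed into the test function, so the induction needs an arbitrary
  h, and the bounds 1 and M must survive averaging. The witness g is the expected value of h as a
  function of the initial state: the algorithm sees it only at the fully masked state, the true
  reverse chain sees all of it under \<open>marg T\<close>.\<close>

lemma matu_duality:
  fixes t :: "nat \<Rightarrow> real"
  assumes t0: "t 0 = 0" and mono: "\<forall>w<W. t w < t (Suc w)" and tW: "t W < T"
    and int: "set_integrable lborel {0..t W} loss_rate"
    and w: "w \<le> W" and h: "\<And>x. x \<in> Y \<Longrightarrow> 1 \<le> h x" "\<And>x. x \<in> Y \<Longrightarrow> h x \<le> M"
  shows "\<exists>g. (\<forall>x\<in>Y. 1 \<le> g x \<and> g x \<le> M) \<and>
    (\<Sum>y\<in>Y. matu_dist K d vt T t w y * h y) = g (replicate d K) \<and>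
    (\<Sum>z\<in>Y. marg (T - t w) z * ln (h z)) \<le> (\<Sum>z\<in>Y. marg T z * ln (g z)) + integral {0..t w} loss_rate"
  using w h
proof (induction w arbitrary: h)
  case 0
  have "(\<Sum>y\<in>Y. matu_dist K d vt T t 0 y * h y) = (\<Sum>y\<in>Y. if y = replicate d K then h y else 0)"
    by (intro sum.cong) auto
  then show ?case using 0 all_masked_in t0 by (intro exI[of _ h]) simp
next
  case (Suc w)
  have ts: "t i \<le> t j" if "i \<le> j" "j \<le> W" for i j
    using that
  proof (induction j rule: dec_induct)
    case (step n)
    then show ?case using mono[rule_format, of n] by simp
  qed simp
  have ab: "0 \<le> t (Suc w - 1)" "t (Suc w - 1) < t (Suc w)" "t (Suc w) < T"
    using ts[of 0 w] ts[of "Suc w" W] mono[rule_format, of w] Suc.prems(1) t0 tW by auto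
  have int': "set_integrable lborel {t (Suc w - 1)..t (Suc w)} loss_rate"
    using ab ts[of "Suc w" W] Suc.prems(1) by (intro set_integrable_subset[OF int]) auto
  let ?h = "\<lambda>z. \<Sum>y\<in>Y. windowP K d vt T t (Suc w) z y * h y"
  have step: "1 \<le> ?h z" "?h z \<le> M" if "z \<in> Y" for z
    by (rule window_step(1,2)[OF ab _ _ int' that, where M = M]; erule Suc.prems)+
  have step3: "(\<Sum>z\<in>Y. marg (T - t (Suc w)) z * ln (h z)) - (\<Sum>z\<in>Y. marg (T - t w) z * ln (?h z))
      \<le> integral {t w..t (Suc w)} loss_rate"
    using window_step(3)[where h = h and M = M, OF ab _ _ int'] Suc.prems(2,3) by simp
  have w: "w \<le> W" using Suc.prems(1) by simp
  obtain g where g: "\<forall>x\<in>Y. 1 \<le> g x \<and> g x \<le> M"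
    "(\<Sum>y\<in>Y. matu_dist K d vt T t w y * ?h y) = g (replicate d K)"
    "(\<Sum>z\<in>Y. marg (T - t w) z * ln (?h z)) \<le> (\<Sum>z\<in>Y. marg T z * ln (g z)) + integral {0..t w} loss_rate"
    using Suc.IH[of ?h, OF w step] by blast
  have "(\<Sum>y\<in>Y. matu_dist K d vt T t (Suc w) y * h y) = (\<Sum>y\<in>Y. \<Sum>z\<in>Y. matu_dist K d vt T t w z * (windowP K d vt T t (Suc w) z y * h y))"
    by (simp add: sum_distrib_right mult.assoc)
  also have "\<dots> = (\<Sum>y\<in>Y. matu_dist K d vt T t w y * ?h y)"
    unfolding sum_distrib_left by (rule sum.swap)
  finally have 1: "(\<Sum>y\<in>Y. matu_dist K d vt T t (Suc w) y * h y) = g (replicate d K)"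
    using g(2) by simp
  have "set_integrable lborel {0..t (Suc w)} loss_rate"
    using ts[of "Suc w" W] Suc.prems(1) by (intro set_integrable_subset[OF int]) auto
  then have "integral {0..t w} loss_rate + integral {t w..t (Suc w)} loss_rate = integral {0..t (Suc w)} loss_rate"
    using ab by (intro Henstock_Kurzweil_Integration.integral_combine set_borel_integral_eq_integral(1)) auto
  then have "(\<Sum>z\<in>Y. marg (T - t (Suc w)) z * ln (h z)) \<le> (\<Sum>z\<in>Y. marg T z * ln (g z)) + integral {0..t (Suc w)} loss_rate"
    using step3 g(3) by linarith
  then show ?case using g(1) 1 by blast
qed


section \<open>Total variation bound\<close>

text \<open>Time is reversed by s = T - t. Dropping the times t < \<delta> only lowers a nonnegative
  integral, and at the remaining positive times \<open>qfwd\<close> may be replaced by the closed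
  form. Finiteness of the assumed bound yields integrability.\<close>

lemma loss_rate_budget:
  assumes T: "0 < T" and \<delta>: "0 < \<delta>"
    and L: "LSE K d q T vt \<le> ennreal (e\<^sup>2)"
  shows "set_integrable lborel {0..T - \<delta>} loss_rate" "integral {0..T - \<delta>} loss_rate \<le> T * e\<^sup>2"
proof -
  let ?\<Phi> = "\<lambda>t. ennreal (\<Sum>y\<in>Y. qfwd K d q t y * (\<Sum>y'\<in>Y - {y}. Rfwd K d y y' *
              Dphi (vscore K d q T (T - t) y y') (vt (T - t) y y')))"
  have \<Phi>: "?\<Phi> t = ennreal (loss_rate (T - t))" if "0 < t" for t
    unfolding loss_rate_def state_loss_def vscore_def using that
    by (intro arg_cong[where f = ennreal] sum.cong arg_cong2[where f = "(*)"] arg_cong2[where f = Dphi] refl)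
       (auto simp: qfwd_eq_marg)
  have "(\<integral>\<^sup>+ s. ennreal (loss_rate s) * indicator {0..T - \<delta>} s \<partial>lborel) =
      (\<integral>\<^sup>+ t. ennreal (loss_rate (T - t)) * indicator {\<delta>..T} t \<partial>lborel)"
    by (subst nn_integral_real_affine[where c = "- 1" and t = T])
      (auto intro!: nn_integral_cong split: split_indicator)
  also have "\<dots> \<le> (\<integral>\<^sup>+ t. ?\<Phi> t * indicator {0..T} t \<partial>lborel)"
    using \<delta> by (intro nn_integral_mono) (auto simp: \<Phi> split: split_indicator)
  also have "\<dots> = ennreal T * LSE K d q T vt"
    using T unfolding LSE_def by (simp add: mult.assoc[symmetric] ennreal_mult'[symmetric])
  also have "\<dots> \<le> ennreal T * ennreal (e\<^sup>2)"
    by (intro mult_left_mono L) simp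
  finally have le: "(\<integral>\<^sup>+ s. ennreal (loss_rate s) * indicator {0..T - \<delta>} s \<partial>lborel) \<le> ennreal (T * e\<^sup>2)"
    using T by (simp add: ennreal_mult')
  have nn: "0 \<le> indicator {0..T - \<delta>} s *\<^sub>R loss_rate s" for s
    using \<delta> by (auto split: split_indicator intro: loss_rate_nonneg)
  have eq: "ennreal (indicator {0..T - \<delta>} s *\<^sub>R loss_rate s) = ennreal (loss_rate s) * indicator {0..T - \<delta>} s" for s
    by (auto split: split_indicator)
  have int: "integrable lborel (\<lambda>s. indicator {0..T - \<delta>} s *\<^sub>R loss_rate s)"
  proof (rule integrableI_nonneg)
    show "(\<integral>\<^sup>+ s. ennreal (indicator {0..T - \<delta>} s *\<^sub>R loss_rate s) \<partial>lborel) < \<infinity>"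
      unfolding eq using le by (rule le_less_trans) simp
  qed (use nn in auto)
  then show si: "set_integrable lborel {0..T - \<delta>} loss_rate" by (simp add: set_integrable_def)
  have "ennreal (integral {0..T - \<delta>} loss_rate) \<le> ennreal (T * e\<^sup>2)"
    using le nn_integral_eq_integral[OF int] nn set_borel_integral_eq_integral(2)[OF si]
    unfolding eq set_lebesgue_integral_def by simp
  then show "integral {0..T - \<delta>} loss_rate \<le> T * e\<^sup>2"
    using T by (simp add: ennreal_le_iff)
qed

lemma reverse_marginal_le_matu:
  fixes t :: "nat \<Rightarrow> real"
  assumes t0: "t 0 = 0" and mono: "\<forall>w<W. t w < t (Suc w)" and tW: "t W < T"
    and int: "set_integrable lborel {0..t W} loss_rate" and T: "0 < T"
    and S: "S \<subseteq> Y" and l: "0 \<le> l"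
  shows "l * (\<Sum>y\<in>S. marg (T - t W) y) \<le> l * (\<Sum>y\<in>S. matu_dist K d vt T t W y) + l\<^sup>2 / 8
      + l * (real d * exp (- T)) + integral {0..t W} loss_rate"
    and "(\<Sum>y\<in>Y. matu_dist K d vt T t W y) = 1"
proof -
  note dual = matu_duality[where w = W, OF t0 mono tW int order_refl]
  let ?p = "matu_dist K d vt T t W" and ?z = "replicate d K"
  \<comment> \<open>For the test function 1 with M = 1 the bounds force g = 1.\<close>
  from dual[of "\<lambda>_. 1" 1] all_masked_in show total: "(\<Sum>y\<in>Y. ?p y) = 1" by force
  let ?h = "\<lambda>y. if y \<in> S then exp l else 1"
  have "\<exists>g. (\<forall>x\<in>Y. 1 \<le> g x \<and> g x \<le> exp l) \<and> (\<Sum>y\<in>Y. ?p y * ?h y) = g ?z \<and>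
    (\<Sum>z\<in>Y. marg (T - t W) z * ln (?h z)) \<le> (\<Sum>z\<in>Y. marg T z * ln (g z)) + integral {0..t W} loss_rate"
    using l by (intro dual) auto
  then obtain g where g: "\<And>x. x \<in> Y \<Longrightarrow> 1 \<le> g x" "\<And>x. x \<in> Y \<Longrightarrow> g x \<le> exp l"
    and gz: "(\<Sum>y\<in>Y. ?p y * ?h y) = g ?z"
    and le: "(\<Sum>z\<in>Y. marg (T - t W) z * ln (?h z)) \<le> (\<Sum>z\<in>Y. marg T z * ln (g z)) + integral {0..t W} loss_rate"
    by blast
  let ?P = "\<Sum>y\<in>S. ?p y"
  have restr: "(\<Sum>y\<in>Y. if y \<in> S then f y else 0) = (\<Sum>y\<in>S. f y)" for f :: "nat list \<Rightarrow> real"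
    using S by (simp add: sum.inter_restrict[symmetric] Int_absorb1)
  have "g ?z = (\<Sum>y\<in>Y. ?p y + (if y \<in> S then ?p y * (exp l - 1) else 0))"
    unfolding gz[symmetric] by (intro sum.cong) (auto simp: algebra_simps)
  then have gz': "g ?z = 1 + ?P * (exp l - 1)"
    using total restr[of "\<lambda>y. ?p y * (exp l - 1)"] by (simp add: sum.distrib sum_distrib_right)
  have lhs: "(\<Sum>z\<in>Y. marg (T - t W) z * ln (?h z)) = l * (\<Sum>y\<in>S. marg (T - t W) y)"
    unfolding sum_distrib_left restr[symmetric] by (intro sum.cong) auto
  have m: "0 \<le> marg T z" if "z \<in> Y" for z using T that by (intro marg_nonneg) auto
  have lng: "0 \<le> ln (g z)" "ln (g z) \<le> l" if "z \<in> Y" for z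
  proof -
    show "0 \<le> ln (g z)" using g(1)[OF that] by simp
    have "ln (g z) \<le> ln (exp l)" using g[OF that] by (intro ln_mono) auto
    then show "ln (g z) \<le> l" by simp
  qed
  have "(\<Sum>z\<in>Y. marg T z * ln (g z)) = marg T ?z * ln (g ?z) + (\<Sum>z\<in>Y - {?z}. marg T z * ln (g z))"
    using all_masked_in by (intro sum.remove) auto
  \<comment> \<open>Only the value of g at the fully masked state is tied to the algorithm;
    elsewhere ln g \<le> l is used. The mass elsewhere is 1 - (1 - e^(-T))^d, at most d e^(-T) by
    Bernoulli's inequality.\<close>
  also have "\<dots> \<le> 1 * ln (g ?z) + (\<Sum>z\<in>Y - {?z}. marg T z * l)"
    using T m lng all_masked_in by (intro add_mono sum_mono mult_right_mono mult_left_mono marg_le_1) auto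
  also have "(\<Sum>z\<in>Y - {?z}. marg T z * l) = (1 - marg T ?z) * l"
    using marg_sum[of T] all_masked_in by (simp add: sum_distrib_right[symmetric] sum_diff1)
  also have "(1 - marg T ?z) * l \<le> real d * exp (- T) * l"
    using Bernoulli_inequality[of "- exp (- T)" d] T l unfolding marg_all_masked
    by (intro mult_right_mono) auto
  finally have rhs: "(\<Sum>z\<in>Y. marg T z * ln (g z)) \<le> ln (g ?z) + l * (real d * exp (- T))"
    by (simp add: mult_ac)
  \<comment> \<open>By \<open>gz'\<close> the left side is the cumulant generating function at l of
    a Bernoulli variable with parameter \<open>?P\<close>.\<close>
  have ln: "ln (g ?z) \<le> l * ?P + l\<^sup>2 / 8"
  proof (cases "l = 0")
    case False
    then have "0 < exp l - 1" using l by simp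
    \<comment> \<open>Nonnegativity of \<open>?P\<close> is read off from 1 \<le> g, without
      returning to the single steps of the algorithm.\<close>
    moreover have "0 \<le> ?P * (exp l - 1)" using g(1)[OF all_masked_in] gz' by simp
    ultimately have "0 \<le> ?P" by (simp add: zero_le_mult_iff)
    from Hoeffdings_lemma_aux[OF l this] show ?thesis unfolding gz' by simp
  qed (use gz' in simp)
  show "l * (\<Sum>y\<in>S. marg (T - t W) y) \<le> l * (\<Sum>y\<in>S. ?p y) + l\<^sup>2 / 8
      + l * (real d * exp (- T)) + integral {0..t W} loss_rate"
    using le rhs ln unfolding lhs by simp
qed

text \<open>A state with masks has \<open>q y = 0\<close> and cannot lose mass. An unmasked state
  keeps the fraction exp (- d \<delta>) of its mass, and 1 - exp (- u) \<le> u.\<close>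

lemma early_stopping_error:
  assumes "0 \<le> \<delta>" "S \<subseteq> Y"
  shows "(\<Sum>y\<in>S. q y) - (\<Sum>y\<in>S. marg \<delta> y) \<le> real d * \<delta>"
proof -
  have "q y - marg \<delta> y \<le> real d * \<delta> * q y" if "y \<in> Y" for y
  proof (cases "numK K y = 0")
    case True
    have "(1 - exp (- (real d * \<delta>))) * q y \<le> real d * \<delta> * q y"
      using exp_ge_add_one_self[of "- (real d * \<delta>)"] q_nonneg[OF that] by (intro mult_right_mono) auto
    then show ?thesis by (simp add: marg_unmasked[OF that True] algebra_simps)
  qed (use q_masked marg_nonneg assms that in simp)
  then have "(\<Sum>y\<in>S. q y - marg \<delta> y) \<le> (\<Sum>y\<in>S. real d * \<delta> * q y)"
    using assms(2) by (intro sum_mono) auto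
  also have "\<dots> \<le> real d * \<delta> * (\<Sum>y\<in>Y. q y)"
    unfolding sum_distrib_left using assms
    by (intro sum_mono2) (auto intro!: mult_nonneg_nonneg q_nonneg)
  finally show ?thesis using q_sum by (simp add: sum_subtractf)
qed

end

theorem mainTheorem10:
  fixes K d W :: nat
    and q :: "nat list \<Rightarrow> real"
    and vt :: "real \<Rightarrow> nat list \<Rightarrow> nat list \<Rightarrow> real"
    and eps eps_score T \<delta> :: real
    and t :: "nat \<Rightarrow> real"
  assumes K2: "K \<ge> 2" and d1: "d \<ge> 1"
    and q_nonneg: "\<forall>y\<in>Ystates K d. q y \<ge> 0"
    and q_sum: "(\<Sum>y\<in>Ystates K d. q y) = 1"
    and A2: "\<forall>y\<in>Ystates K d. q y > 0 \<longleftrightarrow> numK K y = 0"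
    and vt_pos: "\<forall>s y y'. 0 \<le> s \<longrightarrow> s < T \<longrightarrow> y \<in> Ystates K d \<longrightarrow> y' \<in> Ystates K d \<longrightarrow>
                   Rfwd K d y y' = 1 \<longrightarrow> vt s y y' > 0"
    and vt_meas: "\<forall>y y'. (\<lambda>s. vt s y y') \<in> borel_measurable borel"
    and A1: "LSE K d q T vt \<le> ennreal (eps_score ^ 2)"
    and eps: "0 < eps" "eps < 1"
    and T_def: "T = ln (4 * real d / eps ^ 2)"
    and delta: "0 < \<delta>" "\<delta> \<le> eps / real d"
    and eps_score: "0 \<le> eps_score" "eps_score \<le> eps / sqrt T"
    and part0: "t 0 = 0"
    and part_mono: "\<forall>w<W. t w < t (Suc w)"
    and partW: "t W = T - \<delta>"
  shows "TV (Ystates K d) q (matu_dist K d vt T t W) \<le> 2 * eps"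
proof -
  interpret score_estimator K d q T vt
    using K2 q_nonneg q_sum A2 vt_pos vt_meas by unfold_locales auto
  let ?p = "matu_dist K d vt T t W"
  have eps2: "eps\<^sup>2 \<le> eps" "0 < eps\<^sup>2" using eps by (auto simp: power2_eq_square mult_left_le)
  have "1 < 4 * real d / eps\<^sup>2" using eps2 eps d1 by (simp add: field_simps)
  then have T: "0 < T" unfolding T_def by (rule ln_gt_zero)
  \<comment> \<open>T is chosen for this: d e^(-T) is the union bound for some coordinate being
    still unmasked at time T.\<close>
  have expT: "real d * exp (- T) = eps\<^sup>2 / 4"
    unfolding T_def using d1 eps by (simp add: exp_minus exp_ln field_simps)
  have int: "set_integrable lborel {0..t W} loss_rate" "integral {0..t W} loss_rate \<le> T * eps_score\<^sup>2"
    unfolding partW by (rule loss_rate_budget[OF T delta(1) A1])+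
  have "T * eps_score\<^sup>2 \<le> T * (eps / sqrt T)\<^sup>2"
    using eps_score T by (intro mult_left_mono power_mono) auto
  also have "\<dots> = eps\<^sup>2" using T by (simp add: power_divide)
  finally have budget: "integral {0..t W} loss_rate \<le> eps\<^sup>2" using int(2) by linarith
  have tW: "t W < T" using partW delta by simp
  note le = reverse_marginal_le_matu[OF part0 part_mono tW int(1) T]
  have total: "(\<Sum>y\<in>Y. ?p y) = 1" by (rule le(2)[of "{}" 0]) auto
  have one_sided: "(\<Sum>y\<in>S. q y) - (\<Sum>y\<in>S. ?p y) \<le> 2 * eps" if S: "S \<subseteq> Y" for S
  proof -
    let ?D = "(\<Sum>y\<in>S. marg \<delta> y) - (\<Sum>y\<in>S. ?p y)"
    \<comment> \<open>Here l = 3 eps. The right side is (9/8 + 1) eps^2 + (3/4) eps^3, at most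
      (23/8) eps^2 < 3 eps^2. Balancing l^2 / 8 against eps^2 would give l = 2 sqrt 2 eps, and 3 is
      a nearby integer.\<close>
    have "3 * eps * ?D \<le> (3 * eps)\<^sup>2 / 8 + 3 * eps * (eps\<^sup>2 / 4) + eps\<^sup>2"
      using le(1)[OF S, of "3 * eps"] budget eps expT by (simp add: partW right_diff_distrib)
    also have "\<dots> \<le> 3 * eps * eps"
    proof -
      have "eps * eps\<^sup>2 \<le> eps * eps" using eps2(1) eps(1) by (intro mult_left_mono) auto
      moreover have "0 \<le> eps * eps" by simp
      moreover have "(3 * eps)\<^sup>2 / 8 + 3 * eps * (eps\<^sup>2 / 4) + eps\<^sup>2 = 17 / 8 * (eps * eps) + 3 / 4 * (eps * eps\<^sup>2)"
        by (simp add: power2_eq_square)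
      ultimately show ?thesis by linarith
    qed
    finally have "?D \<le> eps" using eps by simp
    moreover have "(\<Sum>y\<in>S. q y) - (\<Sum>y\<in>S. marg \<delta> y) \<le> eps"
      using early_stopping_error[OF less_imp_le[OF delta(1)] S] delta(2) d1 by (simp add: field_simps)
    ultimately show ?thesis by linarith
  qed
  have "\<bar>(\<Sum>y\<in>S. q y) - (\<Sum>y\<in>S. ?p y)\<bar> \<le> 2 * eps" if S: "S \<subseteq> Y" for S
  proof -
    \<comment> \<open>Both laws have mass 1, so the one-sided bound for the complement is the
      reverse inequality for S.\<close>
    have "(\<Sum>y\<in>Y - S. q y) = 1 - (\<Sum>y\<in>S. q y)" "(\<Sum>y\<in>Y - S. ?p y) = 1 - (\<Sum>y\<in>S. ?p y)"
      using S q_sum total by (simp_all add: sum_diff finite_subset[OF S])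
    then show ?thesis
      using one_sided[OF S] one_sided[of "Y - S"] by auto
  qed
  then show ?thesis unfolding TV_def by (intro cSup_least) auto
qed

end
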